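(* Let $k\ge 3$ be an odd integer. Then $b_k\ge b^{\mathsf S}_k>\dfrac1k$.
   Context: For $b\in(0,1]$, let $T(1,b)=(\mathbb R/\mathbb Z)\times(\mathbb R/b\mathbb Z)$ be the flat torus. For a (nonempty) open set $\omega$ in $T(1,b)$ or in $\mathbb R^2$, $\lambda_1(\omega)$ denotes the first eigenvalue of the Laplacian $-\Delta$ on $\omega$ with Dirichlet boundary conditions. A $k$-partition of $T(1,b)$ is a family $\mathcal D=(D_i)_{1\le i\le k}$ of open, connected, mutually disjoint (nonempty) subsets of $T(1,b)$. Its energy is $\Lambda_k(\mathcal D)=\max_{1\le i\le k}\lambda_1(D_i)$, and $\mathfrak L_k(T(1,b))=\inf_{\mathcal D}\Lambda_k(\mathcal D)$ over all $k$-partitions. $\mathcal D$ is minimal if $\Lambda_k(\mathcal D)=\mathfrak L_k(T(1,b))$. $\mathcal D_k(1,b)$ is the $k$-partition of $T(1,b)$ with domains $D_i=\left(\frac{i-1}{k},\frac ik\right)\times(0,b)$, $i=1,\dots,k$, understood as vertical strips (annuli) of the torus: $D_i=\left(\frac{i-1}{k},\frac ik\right)\times(\mathbb R/b\mathbb Z)$; its energy is $k^2\pi^2$. The transition value is $$b_k=\sup\{b\in(0,1] : \mathcal D_k(1,b)\text{ is a minimal }k\text{-partition of }T(1,b)\}.$$ For $b\in(0,1]$, let $S_b=\mathbb R\times(0,b)\subset\mathbb R^2$, let $j(b)=\inf\{\lambda_1(\Omega) : \Omega\subset S_b \text{ open},\ |\Omega|\le b\}$ where $|\Omega|$ is the area,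 and define $$b^{\mathsf S}_k=\sup\{b\in(0,1] : j(b)>k^2\pi^2\}.$$ *)

theory Defs
  imports "HOL-Analysis.Analysis"
begin

type_synonym plane = "real \<times> real"

definition circle_proj :: "real \<Rightarrow> real \<Rightarrow> real set" where
  "circle_proj L x = range (\<lambda>n::int. x + of_int n * L)"

definition circle :: "real \<Rightarrow> real set topology" where
  "circle L = topology (\<lambda>U. U \<subseteq> range (circle_proj L) \<and> open (circle_proj L -` U))"

lemma openin_circle:
  "openin (circle L) U \<longleftrightarrow> U \<subseteq> range (circle_proj L) \<and> open (circle_proj L -` U)"
proof -
  have "istopology (\<lambda>U. U \<subseteq> range (circle_proj L) \<and> open (circle_proj L -` U))"
    unfolding istopology_def by (auto simp: vimage_Union intro: open_UN)
  then show ?thesis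
    by (simp add: circle_def topology_inverse')
qed

lemma topspace_circle: "topspace (circle L) = range (circle_proj L)"
proof (rule antisym)
  show "topspace (circle L) \<subseteq> range (circle_proj L)"
    using openin_circle[of L "topspace (circle L)"] openin_topspace by blast
  have "circle_proj L -` range (circle_proj L) = UNIV"
    by auto
  then have "openin (circle L) (range (circle_proj L))"
    by (simp add: openin_circle)
  then show "range (circle_proj L) \<subseteq> topspace (circle L)"
    by (rule openin_subset)
qed

lemma quotient_map_circle_proj: "quotient_map euclidean (circle L) (circle_proj L)"
  by (auto simp: quotient_map_def topspace_circle openin_circle vimage_def)

definition torus :: "real \<Rightarrow> (real set \<times> real set) topology" where
  "torus b = prod_topology (circle 1) (circle b)"

definition torus_proj :: "real \<Rightarrow> plane \<Rightarrow> real set \<times> real set" where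
  "torus_proj b p = (circle_proj 1 (fst p), circle_proj b (snd p))"

primrec C_k :: "nat \<Rightarrow> (plane \<Rightarrow> real) \<Rightarrow> bool" where
  "C_k 0 f \<longleftrightarrow> continuous_on UNIV f"
| "C_k (Suc n) f \<longleftrightarrow>
     (\<exists>f\<^sub>x f\<^sub>y. C_k n f\<^sub>x \<and> C_k n f\<^sub>y \<and> (\<forall>p. GDERIV f p :> (f\<^sub>x p, f\<^sub>y p)))"

definition smooth :: "(plane \<Rightarrow> real) \<Rightarrow> bool" where
  "smooth f \<longleftrightarrow> (\<forall>n. C_k n f)"

definition grad :: "(plane \<Rightarrow> real) \<Rightarrow> plane \<Rightarrow> plane" where
  "grad f p = (THE D. GDERIV f p :> D)"

text \<open>
  The parameters are a measure \<open>M\<close> on the plane and a space \<open>V\<close> of test functions.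
  For a planar open set \<open>\<omega>\<close>, \<open>M\<close> is Lebesgue measure and \<open>V\<close> is
  \<open>C\<^sub>c\<^sup>\<infinity>(\<omega>)\<close>, extended by zero. For the torus, functions are identified with their
  doubly periodic lifts to the plane, and \<open>M\<close> is Lebesgue measure on a fundamental cell.

  \<open>H10 M V\<close> is the closure of \<open>V\<close> in the \<open>H\<^sup>1\<close> norm, an element \<open>u\<close> being
  paired with its weak gradient \<open>g\<close>. Square integrability of \<open>u\<close> and \<open>g\<close>
  follows from the convergence of the approximating sequence.
\<close>

definition H10 :: "plane measure \<Rightarrow> (plane \<Rightarrow> real) set \<Rightarrow> ((plane \<Rightarrow> real) \<times> (plane \<Rightarrow> plane)) set" where
  "H10 M V = {(u, g).
     u \<in> borel_measurable M \<and> g \<in> borel_measurable M \<and>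
     (\<exists>\<phi>. (\<forall>n. \<phi> n \<in> V) \<and>
          (\<lambda>n::nat. \<integral>\<^sup>+p. ennreal ((\<phi> n p - u p)\<^sup>2) \<partial>M) \<longlonglongrightarrow> 0 \<and>
          (\<lambda>n. \<integral>\<^sup>+p. ennreal ((norm (grad (\<phi> n) p - g p))\<^sup>2) \<partial>M) \<longlonglongrightarrow> 0)}"

text \<open>\<open>-\<Delta>u = lu\<close> in the weak sense, for some nonzero \<open>u\<close> in \<open>H\<^sub>0\<^sup>1\<close>.\<close>

definition dirichlet_eigenvalue :: "plane measure \<Rightarrow> (plane \<Rightarrow> real) set \<Rightarrow> real \<Rightarrow> bool" where
  "dirichlet_eigenvalue M V l \<longleftrightarrow>
     (\<exists>(u, g) \<in> H10 M V. \<not> (AE p in M. u p = 0) \<and>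
        (\<forall>\<phi>\<in>V. (\<integral>p. g p \<bullet> grad \<phi> p \<partial>M) = l * (\<integral>p. u p * \<phi> p \<partial>M)))"

definition plane_test :: "plane set \<Rightarrow> (plane \<Rightarrow> real) set" where
  "plane_test \<omega> = {\<phi>. smooth \<phi> \<and> compact (closure {p. \<phi> p \<noteq> 0}) \<and> closure {p. \<phi> p \<noteq> 0} \<subseteq> \<omega>}"

text \<open>Compactness of the support is automatic in the compact torus.\<close>

definition torus_test :: "real \<Rightarrow> (real set \<times> real set) set \<Rightarrow> (plane \<Rightarrow> real) set" where
  "torus_test b \<omega> = {f \<circ> torus_proj b | f.
     smooth (f \<circ> torus_proj b) \<and>
     torus b closure_of {t \<in> topspace (torus b). f t \<noteq> 0} \<subseteq> \<omega>}"

text \<open>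
  On sets of finite area the spectrum is discrete, so that the least eigenvalue exists. All sets
  considered below are of this kind.
\<close>

definition plane_lambda1 :: "plane set \<Rightarrow> real" where
  "plane_lambda1 \<omega> = (LEAST l. dirichlet_eigenvalue lborel (plane_test \<omega>) l)"

definition torus_lambda1 :: "real \<Rightarrow> (real set \<times> real set) set \<Rightarrow> real" where
  "torus_lambda1 b \<omega> =
     (LEAST l. dirichlet_eigenvalue (restrict_space lborel ({0..<1} \<times> {0..<b})) (torus_test b \<omega>) l)"

definition is_partition :: "real \<Rightarrow> nat \<Rightarrow> (nat \<Rightarrow> (real set \<times> real set) set) \<Rightarrow> bool" where
  "is_partition b k D \<longleftrightarrow>
     (\<forall>i\<in>{1..k}. openin (torus b) (D i) \<and> connectedin (torus b) (D i) \<and> D i \<noteq> {}) \<and>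
     disjoint_family_on D {1..k}"

definition energy :: "real \<Rightarrow> nat \<Rightarrow> (nat \<Rightarrow> (real set \<times> real set) set) \<Rightarrow> real" where
  "energy b k D = Max ((\<lambda>i. torus_lambda1 b (D i)) ` {1..k})"

definition minimal_energy :: "real \<Rightarrow> nat \<Rightarrow> real" where
  "minimal_energy b k = Inf {energy b k D | D. is_partition b k D}"

definition is_minimal_partition :: "real \<Rightarrow> nat \<Rightarrow> (nat \<Rightarrow> (real set \<times> real set) set) \<Rightarrow> bool" where
  "is_minimal_partition b k D \<longleftrightarrow> is_partition b k D \<and> energy b k D = minimal_energy b k"

definition strip_partition :: "nat \<Rightarrow> real \<Rightarrow> nat \<Rightarrow> (real set \<times> real set) set" where
  "strip_partition k b i =
     (circle_proj 1 ` {(real i - 1) / real k <..< real i / real k}) \<times> topspace (circle b)"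

definition transition_value :: "nat \<Rightarrow> real" where
  "transition_value k = Sup {b. 0 < b \<and> b \<le> 1 \<and> is_minimal_partition b k (strip_partition k b)}"

definition strip :: "real \<Rightarrow> plane set" where
  "strip b = UNIV \<times> {0<..<b}"

definition strip_infimum :: "real \<Rightarrow> real" where
  "strip_infimum b = Inf {plane_lambda1 \<Omega> | \<Omega>.
     \<Omega> \<subseteq> strip b \<and> open \<Omega> \<and> \<Omega> \<noteq> {} \<and> emeasure lborel \<Omega> \<le> ennreal b}"

definition strip_transition_value :: "nat \<Rightarrow> real" where
  "strip_transition_value k = Sup {b. 0 < b \<and> b \<le> 1 \<and> strip_infimum b > (real k)\<^sup>2 * pi\<^sup>2}"

end

theory Submission
  imports Defs "HOL-Complex_Analysis.Great_Picard"
begin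

text \<open>
  On a set of finite area in the strip, or on an open subset of the torus, the Rayleigh quotient
  attains its infimum (a compactness argument based on the Poincare inequality on small cells), so
  the least eigenvalue is the infimum of the Rayleigh quotient over test functions.

  For a domain of area at most \<open>b\<close> in the strip of height \<open>b\<close>, most horizontal slices are short,
  which improves the bound \<open>\<pi>\<^sup>2/b\<^sup>2\<close> by a fixed amount; hence the strip transition value exceeds
  \<open>1/k\<close>. Testing with the rectangle \<open>(0,1) \<times> (0,b)\<close>, the condition on \<open>b\<close> in the definition of the
  strip transition value implies \<open>k\<^sup>2 < 1 + 1/b\<^sup>2\<close>, and this is all that is used about \<open>b\<close> from then on.

  Given a \<open>k\<close>-partition of the torus with energy below \<open>k\<^sup>2\<pi>\<^sup>2\<close>, lift almost optimal test functions to the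
  plane and multiply them by signs on the components of the lifted domains, so that they become
  antiperiodic in one or both directions. This is possible when the loops in the domains have even
  winding numbers in these directions. Functions antiperiodic in both directions have energy at least
  \<open>(1 + 1/b\<^sup>2)\<pi>\<^sup>2 > k\<^sup>2\<pi>\<^sup>2\<close>, so one domain suffices. For antiperiodicity in \<open>x\<close> only, and \<open>k\<close> odd,
  \<open>k - 1\<close> linear conditions force energy at least \<open>k\<^sup>2\<pi>\<^sup>2\<close>, and some combination of the \<open>k\<close> functions
  satisfies them; for \<open>y\<close> only, two conditions are enough. One of these cases always applies: loops in
  disjoint domains have vanishing intersection number, and a parity count excludes everything else.
\<close>

section \<open>One-dimensional Wirtinger inequalities\<close>

text \<open>The numbers of linear conditions come from counting eigenvalues. For functions
  antiperiodic in x, the modes independent of y have frequencies pi, 3 pi, 5 pi, ..., each of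
  multiplicity two (sine and cosine). If k is odd, then k pi is one of these frequencies and exactly
  k - 1 modes lie below it. For antiperiodicity in y the first frequency pi/b has two modes
  independent of x. Modes depending on both variables have energy at least (1 + 1/b^2) pi^2 and
  never matter. Functions with disjoint supports and energy quotients below the threshold span a
  space on which the quotient stays below it. With more functions than low modes, some combination
  avoids all of them. Rather than Fourier coefficients, integrals over k strips (two in the y case)
  are prescribed: the Wirtinger inequality on each strip then replaces the spectral decomposition.
  The available twists are the three nontrivial characters of Z^2 with values 1 and -1, namely
  (-1)^m, (-1)^n and (-1)^(m+n). A domain admits one of them exactly when it is trivial on the
  lattice vectors of its loops, so only the classes of loops modulo 2 enter the topological
  argument.\<close>

lemma Wirtinger_Dirichlet_aux:
  fixes v v' :: "real \<Rightarrow> real"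
  assumes ab: "a < b" and dv: "\<And>x. x \<in> {a..b} \<Longrightarrow> (v has_real_derivative v' x) (at x within {a..b})"
    and cont: "continuous_on {a..b} v'" and va: "v a = 0" and vb: "v b = 0"
    and c: "0 \<le> c" "c * (b - a) < pi"
  shows "c\<^sup>2 * integral {a..b} (\<lambda>x. (v x)\<^sup>2) \<le> integral {a..b} (\<lambda>x. (v' x)\<^sup>2)"
proof -
  define m where "m = (a + b) / 2"
  \<comment> \<open>Riccati substitution: \<open>cos (c * (x - m))\<close> is a positive solution of
    w'' = - c^2 w on the closed interval, with logarithmic derivative \<open>- c * T x\<close>.
    Adding the derivative of \<open>c * T x * (v x)^2\<close>, whose integral vanishes because v
    does at both ends, completes v'^2 - c^2 v^2 to the square of v' + c T v.\<close>
  define T where "T x = tan (c * (x - m))" for x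
  have cv: "continuous_on {a..b} v"
    using dv by (meson DERIV_continuous_on)
  have cpos: "cos (c * (x - m)) > 0" if "x \<in> {a..b}" for x
  proof (rule cos_gt_zero_pi)
    have "c * (x - m) \<le> c * ((b - a) / 2)"
      using that c by (intro mult_left_mono) (auto simp: m_def field_simps)
    then show "c * (x - m) < pi / 2" using c by simp
    have "c * (- ((b - a) / 2)) \<le> c * (x - m)"
      using that c by (intro mult_left_mono) (auto simp: m_def field_simps)
    then show "- (pi / 2) < c * (x - m)" using c by simp
  qed
  have dT: "(T has_real_derivative c * (1 + (T x)\<^sup>2)) (at x within {a..b})" if "x \<in> {a..b}" for x
    unfolding T_def using cpos[OF that]
    by (auto intro!: derivative_eq_intros simp: tan_sec power_inverse)
  have cT: "continuous_on {a..b} T"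
    using dT by (meson DERIV_continuous_on)
  have d: "((\<lambda>x. c * T x * (v x)\<^sup>2) has_real_derivative
      2 * (c * T x * v x * v' x) + c\<^sup>2 * (v x)\<^sup>2 * (1 + (T x)\<^sup>2)) (at x within {a..b})" if "x \<in> {a..b}" for x
    by (rule derivative_eq_intros dT dv that refl | simp add: power2_eq_square algebra_simps)+
  have "((\<lambda>x. 2 * (c * T x * v x * v' x) + c\<^sup>2 * (v x)\<^sup>2 * (1 + (T x)\<^sup>2)) has_integral
      c * T b * (v b)\<^sup>2 - c * T a * (v a)\<^sup>2) {a..b}"
    using ab by (intro fundamental_theorem_of_calculus)
      (auto simp: has_real_derivative_iff_has_vector_derivative[symmetric] intro!: d)
  then have I0: "integral {a..b} (\<lambda>x. 2 * (c * T x * v x * v' x) + c\<^sup>2 * (v x)\<^sup>2 * (1 + (T x)\<^sup>2)) = 0"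
    using va vb by (simp add: integral_unique)
  have "integral {a..b} (\<lambda>x. (v' x)\<^sup>2) - c\<^sup>2 * integral {a..b} (\<lambda>x. (v x)\<^sup>2)
     = integral {a..b} (\<lambda>x. (v' x)\<^sup>2 - c\<^sup>2 * (v x)\<^sup>2)"
    by (subst integral_diff)
      (auto intro!: integrable_continuous_interval continuous_intros cv cont)
  also have "\<dots> = integral {a..b} (\<lambda>x. (v' x)\<^sup>2 - c\<^sup>2 * (v x)\<^sup>2) +
      integral {a..b} (\<lambda>x. 2 * (c * T x * v x * v' x) + c\<^sup>2 * (v x)\<^sup>2 * (1 + (T x)\<^sup>2))"
    using I0 by simp
  also have "\<dots> = integral {a..b} (\<lambda>x. (v' x + c * T x * v x)\<^sup>2)"
    by (subst integral_add[symmetric])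
      (auto intro!: integrable_continuous_interval continuous_intros cv cont cT integral_cong
        simp: power2_eq_square algebra_simps)
  also have "\<dots> \<ge> 0"
    by (intro integral_nonneg integrable_continuous_interval continuous_intros cv cont cT) auto
  finally show ?thesis by simp
qed

lemma Wirtinger_Dirichlet:
  fixes v v' :: "real \<Rightarrow> real"
  assumes ab: "a \<le> b" and dv: "\<And>x. x \<in> {a..b} \<Longrightarrow> (v has_real_derivative v' x) (at x within {a..b})"
    and cont: "continuous_on {a..b} v'" and va: "v a = 0" and vb: "v b = 0"
  shows "pi\<^sup>2 * integral {a..b} (\<lambda>x. (v x)\<^sup>2) \<le> (b - a)\<^sup>2 * integral {a..b} (\<lambda>x. (v' x)\<^sup>2)"
proof (cases "a = b")
  case False
  with ab have ab: "a < b" by simp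
  let ?I = "integral {a..b} (\<lambda>x. (v x)\<^sup>2)" and ?J = "integral {a..b} (\<lambda>x. (v' x)\<^sup>2)"
  \<comment> \<open>Frequencies strictly below the critical one, since the tangent blows up at the
    end points for the critical value. The sharp constant is recovered in the limit.\<close>
  define X where "X n = pi / (b - a) * (1 - 1 / real (Suc n))" for n
  have "(X n)\<^sup>2 * ?I \<le> ?J" for n
  proof (intro Wirtinger_Dirichlet_aux[OF ab dv cont va vb])
    show "0 \<le> X n" using ab by (auto simp: X_def)
    have "X n * (b - a) = pi * (1 - 1 / real (Suc n))" using ab by (simp add: X_def)
    also have "\<dots> < pi" by (simp add: right_diff_distrib)
    finally show "X n * (b - a) < pi" .
  qed auto
  moreover have "(\<lambda>n. (X n)\<^sup>2 * ?I) \<longlonglongrightarrow> (pi / (b - a) * (1 - 0))\<^sup>2 * ?I"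
    unfolding X_def
    by (intro tendsto_intros LIMSEQ_Suc[OF lim_1_over_n])
  ultimately have "(pi / (b - a))\<^sup>2 * ?I \<le> ?J"
    by (intro LIMSEQ_le_const2) auto
  then show ?thesis using ab by (simp add: power_divide field_simps)
qed auto

text \<open>Reduction to the Dirichlet case: the primitive W of v vanishes at both ends because v
  has mean zero. The Dirichlet inequality bounds W by v, and integration by parts writes the
  integral of v^2 as minus that of W v'.\<close>

lemma Wirtinger_Neumann:
  fixes v v' :: "real \<Rightarrow> real"
  assumes ab: "a \<le> b" and dv: "\<And>x. x \<in> {a..b} \<Longrightarrow> (v has_real_derivative v' x) (at x within {a..b})"
    and cont: "continuous_on {a..b} v'" and mean: "integral {a..b} v = 0"
  shows "pi\<^sup>2 * integral {a..b} (\<lambda>x. (v x)\<^sup>2) \<le> (b - a)\<^sup>2 * integral {a..b} (\<lambda>x. (v' x)\<^sup>2)"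
proof (cases "a = b")
  case False
  with ab have ab: "a < b" by simp
  let ?I = "integral {a..b} (\<lambda>x. (v x)\<^sup>2)" and ?J = "integral {a..b} (\<lambda>x. (v' x)\<^sup>2)"
  have cv: "continuous_on {a..b} v"
    using dv by (meson DERIV_continuous_on)
  define W where "W x = integral {a..x} v" for x
  have dW: "(W has_real_derivative v x) (at x within {a..b})" if "x \<in> {a..b}" for x
    unfolding W_def by (rule integral_has_real_derivative[OF cv that])
  have cW: "continuous_on {a..b} W"
    using dW by (meson DERIV_continuous_on)
  have W0: "W a = 0" "W b = 0" using mean by (auto simp: W_def)
  \<comment> \<open>With this t the Dirichlet inequality reads: the integral of W^2 is at most t^2
    times that of v^2. It is also the weight that makes the square of t v' + W/t yield the sharp
    constant.\<close>
  define t where "t = (b - a) / pi"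
  have t: "t > 0" using ab by (simp add: t_def)
  have "pi\<^sup>2 * integral {a..b} (\<lambda>x. (W x)\<^sup>2) \<le> (b - a)\<^sup>2 * ?I"
    using ab by (intro Wirtinger_Dirichlet dW cv W0) auto
  then have WI: "integral {a..b} (\<lambda>x. (W x)\<^sup>2) \<le> t\<^sup>2 * ?I"
    by (simp add: t_def power_divide field_simps)
  have "((\<lambda>x. v x * v x + W x * v' x) has_integral W b * v b - W a * v a) {a..b}"
  proof (intro fundamental_theorem_of_calculus)
    show "((\<lambda>x. W x * v x) has_vector_derivative v x * v x + W x * v' x) (at x within {a..b})"
      if "x \<in> {a..b}" for x
      unfolding has_real_derivative_iff_has_vector_derivative[symmetric]
      by (rule derivative_eq_intros dW dv that refl | simp)+
  qed (use ab in auto)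
  then have I0: "integral {a..b} (\<lambda>x. v x * v x + W x * v' x) = 0"
    using W0 by (simp add: integral_unique)
  have "0 \<le> integral {a..b} (\<lambda>x. (t * v' x + W x / t)\<^sup>2)"
    by (intro integral_nonneg integrable_continuous_interval continuous_intros cv cont cW) (use t in auto)
  also have "\<dots> = integral {a..b} (\<lambda>x. (t\<^sup>2 * (v' x)\<^sup>2 + (1 / t\<^sup>2) * (W x)\<^sup>2 - 2 * (v x)\<^sup>2) + 2 * (v x * v x + W x * v' x))"
    using t by (intro integral_cong) (auto simp: power2_eq_square field_simps)
  also have "\<dots> = (t\<^sup>2 * ?J + (1 / t\<^sup>2) * integral {a..b} (\<lambda>x. (W x)\<^sup>2) - 2 * ?I) + 2 * 0"
  proof (rule integral_unique)
    show "((\<lambda>x. (t\<^sup>2 * (v' x)\<^sup>2 + (1 / t\<^sup>2) * (W x)\<^sup>2 - 2 * (v x)\<^sup>2) + 2 * (v x * v x + W x * v' x)) has_integral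
      (t\<^sup>2 * ?J + (1 / t\<^sup>2) * integral {a..b} (\<lambda>x. (W x)\<^sup>2) - 2 * ?I) + 2 * 0) {a..b}"
      unfolding I0[symmetric]
      by (intro has_integral_add has_integral_diff has_integral_mult_right integrable_integral
          integrable_continuous_interval continuous_intros cv cont cW)
  qed
  also have "\<dots> \<le> t\<^sup>2 * ?J + (1 / t\<^sup>2) * (t\<^sup>2 * ?I) - 2 * ?I"
    using mult_left_mono[OF WI, of "1/t\<^sup>2"] by simp
  also have "\<dots> = t\<^sup>2 * ?J - ?I" using t by simp
  finally show ?thesis using ab by (simp add: t_def power_divide field_simps)
qed auto

text \<open>An antiperiodic function changes sign, hence vanishes at some x0 and at x0 + l, so the
  Dirichlet inequality applies there. The squares of v and v' are l-periodic, which moves the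
  integrals back to [0, l].\<close>

lemma Wirtinger_antiperiodic:
  fixes v v' :: "real \<Rightarrow> real"
  assumes l: "l > 0" and dv: "\<And>x. (v has_real_derivative v' x) (at x)"
    and cont: "continuous_on UNIV v'" and anti: "\<And>x. v (x + l) = - v x"
  shows "pi\<^sup>2 * integral {0..l} (\<lambda>x. (v x)\<^sup>2) \<le> l\<^sup>2 * integral {0..l} (\<lambda>x. (v' x)\<^sup>2)"
proof -
  have cv: "continuous_on A v" for A
    using dv by (meson DERIV_continuous_on DERIV_subset subset_UNIV)
  have cv': "continuous_on A v'" for A
    using cont by (rule continuous_on_subset) auto
  have anti': "v' (x + l) = - v' x" for x
  proof -
    have "((\<lambda>x. v (x + l)) has_real_derivative v' (x + l)) (at x)"
      using dv[of "x + l"] by (simp add: DERIV_shift)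
    moreover have "((\<lambda>x. - v x) has_real_derivative - v' x) (at x)"
      by (intro derivative_intros dv)
    ultimately show ?thesis unfolding anti by (rule DERIV_unique)
  qed
  have "\<exists>x0\<ge>0. x0 \<le> l \<and> v x0 = 0"
  proof (cases "v 0 \<le> 0")
    case True
    then show ?thesis using IVT'[of v 0 0 l] anti[of 0] l cv by auto
  next
    case False
    then show ?thesis using IVT2'[of v l 0 0] anti[of 0] l cv by auto
  qed
  then obtain x0 where x0: "0 \<le> x0" "x0 \<le> l" "v x0 = 0" by auto
  have shift: "integral {x0..x0 + l} f = integral {0..l} f"
    if f: "continuous_on UNIV f" "\<And>x. f (x + l) = f x" for f :: "real \<Rightarrow> real"
  proof -
    have fi: "f integrable_on {c..d}" for c d
      by (intro integrable_continuous_interval continuous_on_subset[OF f(1)]) auto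
    have "integral {x0..x0 + l} f = integral {x0..l} f + integral {l..x0+l} f"
      by (rule Henstock_Kurzweil_Integration.integral_combine[symmetric]) (use x0 l fi in auto)
    also have "integral {l..x0+l} f = integral {0..x0} (\<lambda>x. f (x + l))"
      using integral_shift_Icc_real[of 0 x0 f l] by (simp add: o_def add.commute)
    also have "\<dots> = integral {0..x0} f" by (simp add: f)
    also have "integral {x0..l} f + integral {0..x0} f = integral {0..l} f"
      using Henstock_Kurzweil_Integration.integral_combine[of 0 x0 l f] x0 fi by auto
    finally show ?thesis .
  qed
  have "pi\<^sup>2 * integral {x0..x0+l} (\<lambda>x. (v x)\<^sup>2) \<le> (x0 + l - x0)\<^sup>2 * integral {x0..x0+l} (\<lambda>x. (v' x)\<^sup>2)"
    using l by (intro Wirtinger_Dirichlet cv') (auto simp: anti x0 intro: DERIV_subset[OF dv])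
  then show ?thesis
    by (subst (asm) shift, (auto intro!: continuous_intros cv simp: anti)[2])
       (subst (asm) shift, (auto intro!: continuous_intros cv' simp: anti')[2], simp)
qed

lemma sum_integral_consecutive:
  fixes f :: "real \<Rightarrow> real"
  assumes h: "0 \<le> h" and f: "continuous_on UNIV f"
  shows "(\<Sum>j<n. integral {real j * h..real (Suc j) * h} f) = integral {0..real n * h} f"
proof (induction n)
  case (Suc n)
  have "integral {0..real n * h} f + integral {real n * h..real (Suc n) * h} f = integral {0..real (Suc n) * h} f"
    using h by (intro Henstock_Kurzweil_Integration.integral_combine integrable_continuous_interval
        continuous_on_subset[OF f]) (auto intro: mult_right_mono)
  with Suc show ?case by simp
qed simp

text \<open>
  The eigenfunction \<open>s(x) = sin (k \<pi> x)\<close> is a null vector of the quadratic form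
  \<open>\<integral>v'\<^sup>2 - k\<^sup>2\<pi>\<^sup>2 \<integral>v\<^sup>2\<close> on antiperiodic functions, so a multiple of it can be subtracted
  from \<open>v\<close>. If the integrals of \<open>v\<close> over the \<open>k\<close> intervals alternate, this makes all of them zero.
\<close>

lemma Wirtinger_antiperiodic_alternating:
  fixes v v' :: "real \<Rightarrow> real" and k :: nat
  assumes k: "odd k" and dv: "\<And>x. (v has_real_derivative v' x) (at x)"
    and cont: "continuous_on UNIV v'" and anti: "v 1 = - v 0"
    and alt: "\<And>j. j < k \<Longrightarrow> integral {real j / k..real (Suc j) / k} v = (-1) ^ j * A"
  shows "(real k)\<^sup>2 * pi\<^sup>2 * integral {0..1} (\<lambda>x. (v x)\<^sup>2) \<le> integral {0..1} (\<lambda>x. (v' x)\<^sup>2)"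
proof -
  have k0: "k > 0" using k by (cases k) auto
  define K where "K = real k * pi"
  have K: "K > 0" using k0 by (simp add: K_def)
  have cv: "continuous_on S v" for S
    using dv by (meson DERIV_continuous_on DERIV_subset subset_UNIV)
  have cv': "continuous_on S v'" for S
    using cont by (rule continuous_on_subset) auto
  \<comment> \<open>The integral of \<open>sin (K * x)\<close> over the j-th interval is (-1)^j 2/K,
    so this multiple has the same alternating integrals as v and r has mean zero on every
    interval.\<close>
  define \<alpha> where "\<alpha> = A * K / 2"
  define r where "r x = v x - \<alpha> * sin (K * x)" for x
  define r' where "r' x = v' x - \<alpha> * (K * cos (K * x))" for x
  have dr: "(r has_real_derivative r' x) (at x)" for x
    unfolding r_def r'_def by (rule derivative_eq_intros dv refl | simp)+
  have cr: "continuous_on S r" for S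
    using dr by (meson DERIV_continuous_on DERIV_subset subset_UNIV)
  have cr': "continuous_on S r'" for S
    unfolding r'_def by (intro continuous_intros cv')
  have piece: "K\<^sup>2 * integral {real j / k..real (Suc j) / k} (\<lambda>x. (r x)\<^sup>2)
      \<le> integral {real j / k..real (Suc j) / k} (\<lambda>x. (r' x)\<^sup>2)" if "j < k" for j
  proof -
    let ?a = "real j / k" and ?b = "real (Suc j) / k"
    have ab: "?a \<le> ?b" using k0 by (simp add: divide_right_mono)
    have "((\<lambda>x. sin (K * x)) has_integral (- cos (K * ?b) / K) - (- cos (K * ?a) / K)) {?a..?b}"
      using K by (intro fundamental_theorem_of_calculus ab)
        (auto simp: has_real_derivative_iff_has_vector_derivative[symmetric] intro!: derivative_eq_intros)
    moreover have "K * ?a = real j * pi" "K * ?b = real (Suc j) * pi"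
      using k0 by (auto simp: K_def)
    ultimately have sI: "((\<lambda>x. sin (K * x)) has_integral (-1) ^ j * 2 / K) {?a..?b}"
      by (simp only: cos_npi) (simp add: field_simps)
    have "(v has_integral (-1) ^ j * A) {?a..?b}"
      using alt[OF that] integrable_integral[OF integrable_continuous_interval[OF cv]] by metis
    from has_integral_diff[OF this has_integral_mult_right[OF sI, of \<alpha>]]
    have "integral {?a..?b} r = 0"
      using K unfolding r_def by (intro integral_unique) (simp add: \<alpha>_def)
    then have le: "pi\<^sup>2 * integral {?a..?b} (\<lambda>x. (r x)\<^sup>2) \<le> (?b - ?a)\<^sup>2 * integral {?a..?b} (\<lambda>x. (r' x)\<^sup>2)"
      by (intro Wirtinger_Neumann ab cr') (auto intro: DERIV_subset[OF dr])
    have ba: "?b - ?a = 1 / k" by (simp add: diff_divide_distrib[symmetric])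
    note le = le[unfolded ba]
    show ?thesis
      using mult_left_mono[OF le, of "(real k)\<^sup>2"] k0 unfolding K_def power_mult_distrib power_divide
      by (simp del: of_nat_Suc)
  qed
  have rsum: "(\<Sum>j<k. integral {real j / k..real (Suc j) / k} f) = integral {0..1} f"
    if "continuous_on UNIV f" for f :: "real \<Rightarrow> real"
    using sum_integral_consecutive[of "1/k" f k] that k0 by (simp del: of_nat_Suc)
  have "K\<^sup>2 * (\<Sum>j<k. integral {real j / k..real (Suc j) / k} (\<lambda>x. (r x)\<^sup>2))
      \<le> (\<Sum>j<k. integral {real j / k..real (Suc j) / k} (\<lambda>x. (r' x)\<^sup>2))"
    unfolding sum_distrib_left by (intro sum_mono piece) simp
  then have R: "K\<^sup>2 * integral {0..1} (\<lambda>x. (r x)\<^sup>2) \<le> integral {0..1} (\<lambda>x. (r' x)\<^sup>2)"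
    by (subst (asm) (1 2) rsum) (auto intro: continuous_intros cr cr')
  \<comment> \<open>\<open>F'\<close> is exactly the difference between v'^2 - K^2 v^2 and r'^2 -
    K^2 r^2, so the cross terms are a boundary term. It cancels because v(1) = - v(0), cos K = -1
    and sin K = 0, which is where k odd enters.\<close>
  define F where "F x = (2 * \<alpha> * v x - \<alpha>\<^sup>2 * sin (K * x)) * (K * cos (K * x))" for x
  define F' where "F' x = 2 * \<alpha> * (v' x * (K * cos (K * x)) - K\<^sup>2 * v x * sin (K * x))
      - \<alpha>\<^sup>2 * ((K * cos (K * x))\<^sup>2 - K\<^sup>2 * (sin (K * x))\<^sup>2)" for x
  have dF: "(F has_real_derivative F' x) (at x)" for x
    unfolding F_def F'_def
    by (rule derivative_eq_intros dv refl | simp add: power2_eq_square algebra_simps)+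
  have cosK: "cos K = - 1" "sin K = 0" using k by (auto simp: K_def)
  have "(F' has_integral F 1 - F 0) {0..1}"
    by (intro fundamental_theorem_of_calculus)
       (auto simp: has_real_derivative_iff_has_vector_derivative[symmetric] intro: DERIV_subset[OF dF])
  moreover have "F 1 - F 0 = 0" by (simp add: F_def anti cosK)
  ultimately have F'0: "(F' has_integral 0) {0..1}" by simp
  have cint: "(f has_integral integral {0..1} f) {0..1::real}" if "continuous_on UNIV f" for f :: "real \<Rightarrow> real"
    by (intro integrable_integral integrable_continuous_interval continuous_on_subset[OF that]) auto
  let ?J = "integral {0..1} (\<lambda>x. (v' x)\<^sup>2)" and ?I = "integral {0..1} (\<lambda>x. (v x)\<^sup>2)"
  let ?J' = "integral {0..1} (\<lambda>x. (r' x)\<^sup>2)" and ?I' = "integral {0..1} (\<lambda>x. (r x)\<^sup>2)"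
  have 1: "((\<lambda>x. (r' x)\<^sup>2 - K\<^sup>2 * (r x)\<^sup>2 + F' x) has_integral ?J' - K\<^sup>2 * ?I' + 0) {0..1}"
    by (intro has_integral_add has_integral_diff has_integral_mult_right F'0 cint continuous_intros cr cr')
  have 2: "(\<lambda>x. (r' x)\<^sup>2 - K\<^sup>2 * (r x)\<^sup>2 + F' x) = (\<lambda>x. (v' x)\<^sup>2 - K\<^sup>2 * (v x)\<^sup>2)"
    by (auto simp: r_def r'_def F'_def power2_eq_square algebra_simps)
  have 3: "((\<lambda>x. (v' x)\<^sup>2 - K\<^sup>2 * (v x)\<^sup>2) has_integral ?J - K\<^sup>2 * ?I) {0..1}"
    by (intro has_integral_add has_integral_diff has_integral_mult_right cint continuous_intros cv cv')
  have "?J' - K\<^sup>2 * ?I' + 0 = ?J - K\<^sup>2 * ?I"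
    using 1[unfolded 2] 3 by (rule has_integral_unique)
  with R show ?thesis by (simp add: K_def power_mult_distrib)
qed

section \<open>Inequalities on rectangles\<close>

definition has_grad :: "(plane \<Rightarrow> real) \<Rightarrow> (plane \<Rightarrow> real) \<Rightarrow> (plane \<Rightarrow> real) \<Rightarrow> bool" where
  "has_grad f f\<^sub>1 f\<^sub>2 \<longleftrightarrow>
     continuous_on UNIV f\<^sub>1 \<and> continuous_on UNIV f\<^sub>2 \<and> (\<forall>p. GDERIV f p :> (f\<^sub>1 p, f\<^sub>2 p))"

lemma GDERIV_unique:
  assumes "GDERIV f p :> D" "GDERIV f p :> E"
  shows "D = E"
proof -
  have "(\<lambda>h. h \<bullet> D) = (\<lambda>h. h \<bullet> E)"
    using assms unfolding gderiv_def by (rule has_derivative_unique)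
  then show ?thesis
    by (metis inner_commute vector_eq_ldot)
qed

lemma grad_eq: "GDERIV f p :> D \<Longrightarrow> grad f p = D"
  unfolding grad_def by (rule the_equality) (auto intro: GDERIV_unique)

lemma has_grad_grad: "has_grad f f\<^sub>1 f\<^sub>2 \<Longrightarrow> grad f p = (f\<^sub>1 p, f\<^sub>2 p)"
  unfolding has_grad_def by (blast intro: grad_eq)

lemma has_grad_cont:
  assumes "has_grad f f\<^sub>1 f\<^sub>2"
  shows "continuous_on S f" "continuous_on S f\<^sub>1" "continuous_on S f\<^sub>2"
proof -
  have "continuous_on UNIV f"
    using assms unfolding has_grad_def gderiv_def
    by (blast intro: continuous_at_imp_continuous_on has_derivative_continuous)
  then show "continuous_on S f" "continuous_on S f\<^sub>1" "continuous_on S f\<^sub>2"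
    using assms unfolding has_grad_def by (auto intro: continuous_on_subset)
qed

lemma continuous_slice:
  assumes "continuous_on UNIV (F :: plane \<Rightarrow> real)"
  shows "continuous_on S (\<lambda>x. F (x, y))" "continuous_on S (\<lambda>y. F (x, y))"
  by (intro continuous_on_compose2[OF assms] continuous_intros; simp)+

lemma has_grad_slice:
  assumes "has_grad f f\<^sub>1 f\<^sub>2"
  shows "((\<lambda>x. f (x, y)) has_real_derivative f\<^sub>1 (x, y)) (at x)"
    and "((\<lambda>y. f (x, y)) has_real_derivative f\<^sub>2 (x, y)) (at y)"
proof -
  have d: "(f has_derivative (\<lambda>h. h \<bullet> (f\<^sub>1 (x,y), f\<^sub>2 (x,y)))) (at (x,y))"
    using assms by (auto simp: has_grad_def gderiv_def)
  have "((\<lambda>x. f (x, y)) has_derivative (\<lambda>h. (h, 0) \<bullet> (f\<^sub>1 (x,y), f\<^sub>2 (x,y)))) (at x)"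
    by (rule has_derivative_compose[of "\<lambda>x. (x, y)" "\<lambda>h. (h, 0)" x UNIV f, OF _ d]) (auto intro!: derivative_eq_intros)
  then show "((\<lambda>x. f (x, y)) has_real_derivative f\<^sub>1 (x, y)) (at x)"
    by (simp add: has_field_derivative_def mult_commute_abs)
  have "((\<lambda>y. f (x, y)) has_derivative (\<lambda>h. (0, h) \<bullet> (f\<^sub>1 (x,y), f\<^sub>2 (x,y)))) (at y)"
    by (rule has_derivative_compose[of "\<lambda>y. (x, y)" "\<lambda>h. (0, h)" y UNIV f, OF _ d]) (auto intro!: derivative_eq_intros)
  then show "((\<lambda>y. f (x, y)) has_real_derivative f\<^sub>2 (x, y)) (at y)"
    by (simp add: has_field_derivative_def mult_commute_abs)
qed

lemma continuous_on_integral_slice: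
  assumes "continuous_on UNIV (F :: plane \<Rightarrow> real)"
  shows "continuous_on S (\<lambda>x. integral {c..d} (\<lambda>y. F (x, y)))"
    and "continuous_on S (\<lambda>y. integral {a..b} (\<lambda>x. F (x, y)))"
proof -
  have "continuous_on S (\<lambda>x. integral (cbox c d) (\<lambda>y. F (x, y)))"
    by (intro integral_continuous_on_param) (auto intro!: continuous_on_compose2[OF assms] continuous_intros simp: split_def)
  then show "continuous_on S (\<lambda>x. integral {c..d} (\<lambda>y. F (x, y)))" by simp
  have "continuous_on S (\<lambda>y. integral (cbox a b) (\<lambda>x. F (x, y)))"
    by (intro integral_continuous_on_param) (auto intro!: continuous_on_compose2[OF assms] continuous_intros simp: split_def)
  then show "continuous_on S (\<lambda>y. integral {a..b} (\<lambda>x. F (x, y)))" by simp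
qed

lemma has_derivative_integral_slice:
  assumes "has_grad f f\<^sub>1 f\<^sub>2"
  shows "((\<lambda>x. integral {c..d} (\<lambda>y. f (x, y))) has_real_derivative integral {c..d} (\<lambda>y. f\<^sub>1 (x, y))) (at x)"
proof -
  have "((\<lambda>x. integral (cbox c d) (\<lambda>y. f (x, y))) has_real_derivative integral (cbox c d) (\<lambda>y. f\<^sub>1 (x, y)))
      (at x within UNIV)"
  proof (rule leibniz_rule_field_derivative)
    show "continuous_on (UNIV \<times> cbox c d) (\<lambda>(x, t). f\<^sub>1 (x, t))"
      using has_grad_cont(2)[OF assms] by (simp add: split_def)
    show "(\<lambda>y. f (x, y)) integrable_on cbox c d" for x
      using continuous_slice(2)[OF has_grad_cont(1)[OF assms]] by (simp add: integrable_continuous_interval)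
  qed (use has_grad_slice(1)[OF assms] in auto)
  then show ?thesis by simp
qed

lemma integrable_on_rect: "continuous_on UNIV (F :: plane \<Rightarrow> real) \<Longrightarrow> F integrable_on cbox p q"
  by (intro integrable_continuous) (auto intro: continuous_on_subset)

lemma rect_fubini:
  assumes "continuous_on UNIV (F :: plane \<Rightarrow> real)"
  shows "integral (cbox (a, c) (b, d)) F = integral {a..b} (\<lambda>x. integral {c..d} (\<lambda>y. F (x, y)))"
    and "integral (cbox (a, c) (b, d)) F = integral {c..d} (\<lambda>y. integral {a..b} (\<lambda>x. F (x, y)))"
proof -
  have c: "continuous_on (cbox (a, c) (b, d)) F" using assms by (rule continuous_on_subset) auto
  show 1: "integral (cbox (a, c) (b, d)) F = integral {a..b} (\<lambda>x. integral {c..d} (\<lambda>y. F (x, y)))"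
    using integral_prod_continuous[OF c] by simp
  show "integral (cbox (a, c) (b, d)) F = integral {c..d} (\<lambda>y. integral {a..b} (\<lambda>x. F (x, y)))"
    using integral_swap_continuous[of a c b d "\<lambda>x y. F (x, y)"] c 1 by (simp add: split_def)
qed

lemma integral_mono_cont:
  fixes f g :: "real \<Rightarrow> real"
  assumes "continuous_on UNIV f" "continuous_on UNIV g" "\<And>x. x \<in> {a..b} \<Longrightarrow> f x \<le> g x"
  shows "integral {a..b} f \<le> integral {a..b} g"
  by (intro integral_le integrable_continuous_interval) (use assms in \<open>auto intro: continuous_on_subset\<close>)

lemma variance_decomposition:
  fixes u :: "real \<Rightarrow> real"
  assumes cd: "c < d" and u: "continuous_on {c..d} u"
  shows "integral {c..d} (\<lambda>y. (u y)\<^sup>2)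
    = integral {c..d} (\<lambda>y. (u y - integral {c..d} u / (d - c))\<^sup>2) + (integral {c..d} u)\<^sup>2 / (d - c)"
proof -
  let ?S = "integral {c..d} u"
  define m where "m = ?S / (d - c)"
  have i: "(u has_integral ?S) {c..d}" "((\<lambda>y. (u y)\<^sup>2) has_integral integral {c..d} (\<lambda>y. (u y)\<^sup>2)) {c..d}"
    by (intro integrable_integral integrable_continuous_interval continuous_intros u)+
  have "((\<lambda>y. (u y)\<^sup>2 - 2 * m * u y + m\<^sup>2) has_integral
      integral {c..d} (\<lambda>y. (u y)\<^sup>2) - 2 * m * ?S + (d - c) * m\<^sup>2) {c..d}"
    using cd has_integral_const_real[of "m\<^sup>2" c d]
    by (intro has_integral_add has_integral_diff has_integral_mult_right i) simp
  then have "integral {c..d} (\<lambda>y. (u y)\<^sup>2 - 2 * m * u y + m\<^sup>2) =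
      integral {c..d} (\<lambda>y. (u y)\<^sup>2) - 2 * m * ?S + (d - c) * m\<^sup>2"
    by (rule integral_unique)
  also have "(\<lambda>y. (u y)\<^sup>2 - 2 * m * u y + m\<^sup>2) = (\<lambda>y. (u y - m)\<^sup>2)"
    by (auto simp: power2_eq_square algebra_simps)
  also have "integral {c..d} (\<lambda>y. (u y)\<^sup>2) - 2 * m * ?S + (d - c) * m\<^sup>2
      = integral {c..d} (\<lambda>y. (u y)\<^sup>2) - ?S\<^sup>2 / (d - c)"
  proof -
    have S: "?S = m * (d - c)" using cd by (simp add: m_def)
    have "(m * (d - c))\<^sup>2 / (d - c) = m\<^sup>2 * (d - c)" using cd by (simp add: power2_eq_square)
    then show ?thesis unfolding S by (simp add: power2_eq_square algebra_simps)
  qed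
  finally show ?thesis by (simp add: m_def)
qed

text \<open>Orthogonal splitting into the mean over vertical segments and the fluctuation about it.
  \<open>Poincare_rect\<close> and \<open>twisted_inequality\<close> estimate the two parts
  separately, the mean being a function of one variable.\<close>

lemma rect_variance:
  assumes cd: "c < d" and F: "continuous_on UNIV (F :: plane \<Rightarrow> real)"
  shows "integral (cbox (a, c) (b, d)) (\<lambda>p. (F p)\<^sup>2) =
    integral (cbox (a, c) (b, d)) (\<lambda>p. (F p - integral {c..d} (\<lambda>y. F (fst p, y)) / (d - c))\<^sup>2)
    + integral {a..b} (\<lambda>x. (integral {c..d} (\<lambda>y. F (x, y)))\<^sup>2) / (d - c)"
proof -
  define J where "J x = integral {c..d} (\<lambda>y. F (x, y))" for x
  have cJ: "continuous_on S J" for S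
    unfolding J_def by (rule continuous_on_integral_slice[OF F])
  have cJ': "continuous_on S (\<lambda>p::plane. J (fst p))" for S
    by (rule continuous_on_compose2[OF cJ[of UNIV]]) (auto intro!: continuous_intros)
  have cF2: "continuous_on UNIV (\<lambda>p. (F p)\<^sup>2)" "continuous_on UNIV (\<lambda>p. (F p - J (fst p) / (d - c))\<^sup>2)"
    using cd by (intro continuous_intros F cJ'; simp)+
  have "integral (cbox (a, c) (b, d)) (\<lambda>p. (F p)\<^sup>2) =
     integral {a..b} (\<lambda>x. integral {c..d} (\<lambda>y. (F (x, y) - J x / (d - c))\<^sup>2) + (J x)\<^sup>2 / (d - c))"
    unfolding rect_fubini(1)[OF cF2(1)]
    by (subst variance_decomposition[OF cd continuous_slice(2)[OF F]]) (simp add: J_def)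
  also have "\<dots> = integral {a..b} (\<lambda>x. integral {c..d} (\<lambda>y. (F (x, y) - J x / (d - c))\<^sup>2))
     + integral {a..b} (\<lambda>x. (J x)\<^sup>2 / (d - c))"
    using cd continuous_on_integral_slice(1)[OF cF2(2)]
    by (intro integral_add integrable_continuous_interval continuous_intros cJ) auto
  also have "integral {a..b} (\<lambda>x. integral {c..d} (\<lambda>y. (F (x, y) - J x / (d - c))\<^sup>2))
     = integral (cbox (a, c) (b, d)) (\<lambda>p. (F p - J (fst p) / (d - c))\<^sup>2)"
    unfolding rect_fubini(1)[OF cF2(2)] by simp
  also have "integral {a..b} (\<lambda>x. (J x)\<^sup>2 / (d - c)) = integral {a..b} (\<lambda>x. (J x)\<^sup>2) / (d - c)"
    by simp
  finally show ?thesis by (simp add: J_def)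
qed

lemma Neumann_slices:
  assumes cd: "c < d" and g: "has_grad f f\<^sub>1 f\<^sub>2"
  shows "pi\<^sup>2 * integral (cbox (a, c) (b, d)) (\<lambda>p. (f p - integral {c..d} (\<lambda>y. f (fst p, y)) / (d - c))\<^sup>2)
    \<le> (d - c)\<^sup>2 * integral (cbox (a, c) (b, d)) (\<lambda>p. (f\<^sub>2 p)\<^sup>2)"
proof -
  note cf = has_grad_cont[OF g]
  define J where "J x = integral {c..d} (\<lambda>y. f (x, y))" for x
  have cJ: "continuous_on S J" for S
    unfolding J_def by (rule continuous_on_integral_slice[OF cf(1)])
  have cJ': "continuous_on S (\<lambda>p::plane. J (fst p))" for S
    by (rule continuous_on_compose2[OF cJ[of UNIV]]) (auto intro!: continuous_intros)
  have c2: "continuous_on UNIV (\<lambda>p. (f\<^sub>2 p)\<^sup>2)" "continuous_on UNIV (\<lambda>p. (f p - J (fst p) / (d - c))\<^sup>2)"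
    using cd by (intro continuous_intros cf cJ'; simp)+
  have slice: "pi\<^sup>2 * integral {c..d} (\<lambda>y. (f (x, y) - J x / (d - c))\<^sup>2)
      \<le> (d - c)\<^sup>2 * integral {c..d} (\<lambda>y. (f\<^sub>2 (x, y))\<^sup>2)" for x
  proof (rule Wirtinger_Neumann)
    show "((\<lambda>y. f (x, y) - J x / (d - c)) has_real_derivative f\<^sub>2 (x, y)) (at y within {c..d})" for y
      using DERIV_subset[OF has_grad_slice(2)[OF g, of x y], of "{c..d}"]
      by (auto intro!: derivative_eq_intros)
    have "((\<lambda>y. f (x, y) - J x / (d - c)) has_integral J x - J x / (d - c) * (d - c)) {c..d}"
    proof (rule has_integral_diff)
      show "((\<lambda>y. f (x, y)) has_integral J x) {c..d}"
        unfolding J_def by (intro integrable_integral integrable_continuous_interval continuous_slice(2)[OF cf(1)])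
      show "((\<lambda>y. J x / (d - c)) has_integral J x / (d - c) * (d - c)) {c..d}"
        using has_integral_const_real[of "J x / (d - c)" c d] cd by simp
    qed
    then show "integral {c..d} (\<lambda>y. f (x, y) - J x / (d - c)) = 0"
      using cd by (simp add: integral_unique)
  qed (use cd continuous_slice(2)[OF cf(3)] in auto)
  have "integral {a..b} (\<lambda>x. pi\<^sup>2 * integral {c..d} (\<lambda>y. (f (x, y) - J x / (d - c))\<^sup>2))
      \<le> integral {a..b} (\<lambda>x. (d - c)\<^sup>2 * integral {c..d} (\<lambda>y. (f\<^sub>2 (x, y))\<^sup>2))"
    using continuous_on_integral_slice(1)[OF c2(1)] continuous_on_integral_slice(1)[OF c2(2)]
    by (intro integral_mono_cont continuous_intros slice) auto
  then show ?thesis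
    unfolding J_def[symmetric] rect_fubini(1)[OF c2(1)] rect_fubini(1)[OF c2(2)] by simp
qed

text \<open>The Neumann inequality is used along vertical slices for the fluctuation, then in x for
  the vertical mean; only the total mean is left over.\<close>

lemma Poincare_rect:
  assumes ab: "a < b" and cd: "c < d" and g: "has_grad f f\<^sub>1 f\<^sub>2"
  shows "integral (cbox (a, c) (b, d)) (\<lambda>p. (f p)\<^sup>2)
    \<le> (b - a)\<^sup>2 * integral (cbox (a, c) (b, d)) (\<lambda>p. (f\<^sub>1 p)\<^sup>2)
      + (d - c)\<^sup>2 * integral (cbox (a, c) (b, d)) (\<lambda>p. (f\<^sub>2 p)\<^sup>2)
      + (integral (cbox (a, c) (b, d)) f)\<^sup>2 / ((b - a) * (d - c))"
proof -
  note cf = has_grad_cont[OF g]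
  let ?R = "cbox (a, c) (b, d)"
  define J where "J x = integral {c..d} (\<lambda>y. f (x, y))" for x
  define J' where "J' x = integral {c..d} (\<lambda>y. f\<^sub>1 (x, y))" for x
  have cJ: "continuous_on S J" "continuous_on S J'" for S
    unfolding J_def J'_def by (rule continuous_on_integral_slice cf)+
  have pi1: "pi\<^sup>2 \<ge> 1" using pi_ge_two power_mono[of 1 pi 2] by simp
  \<comment> \<open>The factor pi^2 is given away: compactness only needs a constant that tends to 0
    with the sides of the rectangle.\<close>
  have drop: "x \<le> y" if "pi\<^sup>2 * x \<le> y" "x \<ge> 0" for x y :: real
    using that pi1 mult_right_mono[of 1 "pi\<^sup>2" x] by simp
  have c2: "continuous_on UNIV (\<lambda>p. (f p)\<^sup>2)" "continuous_on UNIV (\<lambda>p. (f\<^sub>1 p)\<^sup>2)" by (intro continuous_intros cf)+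
  have cJ1: "continuous_on S (\<lambda>p::plane. J (fst p))" "continuous_on S (\<lambda>p::plane. J' (fst p))" for S
    by (rule continuous_on_compose2[OF cJ(1)[of UNIV]] continuous_on_compose2[OF cJ(2)[of UNIV]]; auto intro!: continuous_intros)+
  have A: "integral ?R (\<lambda>p. (f p - J (fst p) / (d - c))\<^sup>2) \<le> (d - c)\<^sup>2 * integral ?R (\<lambda>p. (f\<^sub>2 p)\<^sup>2)"
  proof (rule drop)
    show "integral ?R (\<lambda>p. (f p - J (fst p) / (d - c))\<^sup>2) \<ge> 0"
      using cd by (intro integral_nonneg integrable_on_rect continuous_intros cf cJ1) auto
  qed (use Neumann_slices[OF cd g, of a b] in \<open>simp add: J_def\<close>)
  have J2: "integral {a..b} (\<lambda>x. (J x - integral {a..b} J / (b - a))\<^sup>2) \<le> (b - a)\<^sup>2 * integral {a..b} (\<lambda>x. (J' x)\<^sup>2)"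
  proof (rule drop)
    show "pi\<^sup>2 * integral {a..b} (\<lambda>x. (J x - integral {a..b} J / (b - a))\<^sup>2) \<le> (b - a)\<^sup>2 * integral {a..b} (\<lambda>x. (J' x)\<^sup>2)"
    proof (rule Wirtinger_Neumann)
      show "((\<lambda>x. J x - integral {a..b} J / (b - a)) has_real_derivative J' x) (at x within {a..b})" for x
        unfolding J_def J'_def
        using DERIV_subset[OF has_derivative_integral_slice[OF g, of c d x], of "{a..b}"]
        by (auto intro!: derivative_eq_intros)
      have "((\<lambda>x. J x - integral {a..b} J / (b - a)) has_integral
          integral {a..b} J - integral {a..b} J / (b - a) * (b - a)) {a..b}"
        using ab has_integral_const_real[of "integral {a..b} J / (b - a)" a b]
        by (intro has_integral_diff integrable_integral integrable_continuous_interval cJ) auto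
      then show "integral {a..b} (\<lambda>x. J x - integral {a..b} J / (b - a)) = 0"
        using ab by (simp add: integral_unique)
    qed (use ab cJ in auto)
  qed (use ab in \<open>auto intro!: integral_nonneg integrable_continuous_interval continuous_intros cJ\<close>)
  have "integral {a..b} (\<lambda>x. (J' x)\<^sup>2) / (d - c) \<le> integral ?R (\<lambda>p. (f\<^sub>1 p)\<^sup>2)"
    unfolding J'_def rect_variance[OF cd cf(2), of a b]
    unfolding J'_def[symmetric]
    using cd by (auto intro!: integral_nonneg integrable_on_rect continuous_intros cf cJ1)
  then have J'2: "integral {a..b} (\<lambda>x. (J' x)\<^sup>2) \<le> (d - c) * integral ?R (\<lambda>p. (f\<^sub>1 p)\<^sup>2)"
    using cd by (simp add: field_simps)
  have "integral {a..b} (\<lambda>x. (J x)\<^sup>2) \<le> (b - a)\<^sup>2 * integral {a..b} (\<lambda>x. (J' x)\<^sup>2) + (integral {a..b} J)\<^sup>2 / (b - a)"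
    using J2 variance_decomposition[OF ab cJ(1)] by simp
  also have "\<dots> \<le> (b - a)\<^sup>2 * ((d - c) * integral ?R (\<lambda>p. (f\<^sub>1 p)\<^sup>2)) + (integral ?R f)\<^sup>2 / (b - a)"
    unfolding rect_fubini(1)[OF cf(1)] J_def
    using mult_left_mono[OF J'2, of "(b-a)\<^sup>2"] by simp
  finally have "integral {a..b} (\<lambda>x. (J x)\<^sup>2) / (d - c) \<le>
      ((b - a)\<^sup>2 * ((d - c) * integral ?R (\<lambda>p. (f\<^sub>1 p)\<^sup>2)) + (integral ?R f)\<^sup>2 / (b - a)) / (d - c)"
    using cd by (intro divide_right_mono) auto
  also have "\<dots> = (b - a)\<^sup>2 * integral ?R (\<lambda>p. (f\<^sub>1 p)\<^sup>2) + (integral ?R f)\<^sup>2 / ((b - a) * (d - c))"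
    using cd by (simp add: add_divide_distrib)
  finally show ?thesis
    using A rect_variance[OF cd cf(1), of a b] by (simp add: J_def)
qed

section \<open>Energy inequalities for antiperiodic functions of two variables\<close>

lemma combine_inverse_squares:
  fixes A B V W X p :: real
  assumes "A > 0" "B > 0" "p * V \<le> A\<^sup>2 * W" "p * V \<le> B\<^sup>2 * X"
  shows "(p / A\<^sup>2 + p / B\<^sup>2) * V \<le> W + X"
proof -
  have "p / A\<^sup>2 * V \<le> W" "p / B\<^sup>2 * V \<le> X"
    using assms by (simp_all add: pos_divide_le_eq mult.commute)
  then show ?thesis unfolding distrib_right by linarith
qed

text \<open>The fluctuation about the vertical mean is antiperiodic in x and has mean zero on each
  vertical segment. Its x-energy is thus at least pi^2/A^2 and its y-energy at least pi^2/B^2 times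
  its mass, which together cover \<nu>. Only the vertical mean, a function of x alone, has to
  satisfy the inequality by assumption.\<close>

lemma twisted_inequality:
  assumes A: "A > 0" and B: "B > 0" and g: "has_grad f f\<^sub>1 f\<^sub>2"
    and anti: "\<And>x y. f (x + A, y) = - f (x, y)"
    and mean: "\<nu> * integral {0..A} (\<lambda>x. (integral {0..B} (\<lambda>y. f (x, y)))\<^sup>2)
       \<le> integral {0..A} (\<lambda>x. (integral {0..B} (\<lambda>y. f\<^sub>1 (x, y)))\<^sup>2)"
    and \<nu>: "\<nu> \<le> pi\<^sup>2 / A\<^sup>2 + pi\<^sup>2 / B\<^sup>2"
  shows "\<nu> * integral (cbox (0, 0) (A, B)) (\<lambda>p. (f p)\<^sup>2)
    \<le> integral (cbox (0, 0) (A, B)) (\<lambda>p. (f\<^sub>1 p)\<^sup>2) + integral (cbox (0, 0) (A, B)) (\<lambda>p. (f\<^sub>2 p)\<^sup>2)"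
proof -
  note cf = has_grad_cont[OF g]
  let ?R = "cbox (0, 0) (A, B)"
  define J where "J x = integral {0..B} (\<lambda>y. f (x, y))" for x
  define J' where "J' x = integral {0..B} (\<lambda>y. f\<^sub>1 (x, y))" for x
  have cJ: "continuous_on S J" "continuous_on S J'" for S
    unfolding J_def J'_def by (rule continuous_on_integral_slice cf)+
  have cJ1: "continuous_on S (\<lambda>p::plane. J (fst p))" "continuous_on S (\<lambda>p::plane. J' (fst p))" for S
    by (rule continuous_on_compose2[OF cJ(1)[of UNIV]] continuous_on_compose2[OF cJ(2)[of UNIV]]; auto intro!: continuous_intros)+
  have J_anti: "J (x + A) = - J x" for x
    unfolding J_def anti by simp
  let ?V = "integral ?R (\<lambda>p. (f p - J (fst p) / B)\<^sup>2)"
  let ?W = "integral ?R (\<lambda>p. (f\<^sub>1 p - J' (fst p) / B)\<^sup>2)"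
  have V0: "?V \<ge> 0" 
    using B by (intro integral_nonneg integrable_on_rect continuous_intros cf cJ1) auto
  have V2: "pi\<^sup>2 * ?V \<le> B\<^sup>2 * integral ?R (\<lambda>p. (f\<^sub>2 p)\<^sup>2)"
    using Neumann_slices[OF B g, of 0 A] by (simp add: J_def)
  have slice: "pi\<^sup>2 * integral {0..A} (\<lambda>x. (f (x, y) - J x / B)\<^sup>2)
      \<le> A\<^sup>2 * integral {0..A} (\<lambda>x. (f\<^sub>1 (x, y) - J' x / B)\<^sup>2)" for y
  proof (rule Wirtinger_antiperiodic[OF A])
    show "((\<lambda>x. f (x, y) - J x / B) has_real_derivative f\<^sub>1 (x, y) - J' x / B) (at x)" for x
      unfolding J_def J'_def
      by (intro derivative_intros has_grad_slice(1)[OF g] DERIV_cdivide has_derivative_integral_slice[OF g])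
    show "continuous_on UNIV (\<lambda>x. f\<^sub>1 (x, y) - J' x / B)"
      using B by (intro continuous_intros continuous_slice(1)[OF cf(2)] cJ) auto
  qed (simp add: anti J_anti)
  have c2: "continuous_on UNIV (\<lambda>p. (f p - J (fst p) / B)\<^sup>2)" "continuous_on UNIV (\<lambda>p. (f\<^sub>1 p - J' (fst p) / B)\<^sup>2)"
    using B by (intro continuous_intros cf cJ1; simp)+
  have "integral {0..B} (\<lambda>y. pi\<^sup>2 * integral {0..A} (\<lambda>x. (f (x, y) - J x / B)\<^sup>2))
      \<le> integral {0..B} (\<lambda>y. A\<^sup>2 * integral {0..A} (\<lambda>x. (f\<^sub>1 (x, y) - J' x / B)\<^sup>2))"
    using continuous_on_integral_slice(2)[OF c2(1)] continuous_on_integral_slice(2)[OF c2(2)]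
    by (intro integral_mono_cont continuous_intros slice) auto
  then have V1: "pi\<^sup>2 * ?V \<le> A\<^sup>2 * ?W"
    unfolding rect_fubini(2)[OF c2(1)] rect_fubini(2)[OF c2(2)] by simp
  have "\<nu> * ?V \<le> (pi\<^sup>2 / A\<^sup>2 + pi\<^sup>2 / B\<^sup>2) * ?V"
    by (rule mult_right_mono[OF \<nu> V0])
  also have "\<dots> \<le> ?W + integral ?R (\<lambda>p. (f\<^sub>2 p)\<^sup>2)"
    by (rule combine_inverse_squares[OF A B V1 V2])
  finally have 1: "\<nu> * ?V \<le> ?W + integral ?R (\<lambda>p. (f\<^sub>2 p)\<^sup>2)" .
  have 2: "\<nu> * (integral {0..A} (\<lambda>x. (J x)\<^sup>2) / B) \<le> integral {0..A} (\<lambda>x. (J' x)\<^sup>2) / B"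
    using mean B by (simp add: J_def J'_def divide_right_mono)
  show ?thesis
    using 1 2 rect_variance[OF B cf(1), of 0 A] rect_variance[OF B cf(2), of 0 A]
    by (simp add: J_def J'_def distrib_left)
qed

lemma antiperiodic_both:
  assumes A: "A > 0" and B: "B > 0" and g: "has_grad f f\<^sub>1 f\<^sub>2"
    and anti1: "\<And>x y. f (x + A, y) = - f (x, y)" and anti2: "\<And>x y. f (x, y + B) = - f (x, y)"
  shows "(pi\<^sup>2 / A\<^sup>2 + pi\<^sup>2 / B\<^sup>2) * integral (cbox (0, 0) (A, B)) (\<lambda>p. (f p)\<^sup>2)
    \<le> integral (cbox (0, 0) (A, B)) (\<lambda>p. (f\<^sub>1 p)\<^sup>2) + integral (cbox (0, 0) (A, B)) (\<lambda>p. (f\<^sub>2 p)\<^sup>2)"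
proof -
  note cf = has_grad_cont[OF g]
  have c2: "continuous_on UNIV (\<lambda>p. (f p)\<^sup>2)" "continuous_on UNIV (\<lambda>p. (f\<^sub>1 p)\<^sup>2)" "continuous_on UNIV (\<lambda>p. (f\<^sub>2 p)\<^sup>2)"
    by (intro continuous_intros cf)+
  let ?R = "cbox (0, 0) (A, B)"
  have "integral {0..B} (\<lambda>y. pi\<^sup>2 * integral {0..A} (\<lambda>x. (f (x, y))\<^sup>2))
      \<le> integral {0..B} (\<lambda>y. A\<^sup>2 * integral {0..A} (\<lambda>x. (f\<^sub>1 (x, y))\<^sup>2))"
    using continuous_on_integral_slice(2)[OF c2(1)] continuous_on_integral_slice(2)[OF c2(2)]
    by (intro integral_mono_cont continuous_intros Wirtinger_antiperiodic[OF A])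
       (auto intro: has_grad_slice(1)[OF g] continuous_slice(1)[OF cf(2)] simp: anti1)
  then have 1: "pi\<^sup>2 * integral ?R (\<lambda>p. (f p)\<^sup>2) \<le> A\<^sup>2 * integral ?R (\<lambda>p. (f\<^sub>1 p)\<^sup>2)"
    unfolding rect_fubini(2)[OF c2(1)] rect_fubini(2)[OF c2(2)] by simp
  have "integral {0..A} (\<lambda>x. pi\<^sup>2 * integral {0..B} (\<lambda>y. (f (x, y))\<^sup>2))
      \<le> integral {0..A} (\<lambda>x. B\<^sup>2 * integral {0..B} (\<lambda>y. (f\<^sub>2 (x, y))\<^sup>2))"
    using continuous_on_integral_slice(1)[OF c2(1)] continuous_on_integral_slice(1)[OF c2(3)]
    by (intro integral_mono_cont continuous_intros Wirtinger_antiperiodic[OF B])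
       (auto intro: has_grad_slice(2)[OF g] continuous_slice(2)[OF cf(3)] simp: anti2)
  then have 2: "pi\<^sup>2 * integral ?R (\<lambda>p. (f p)\<^sup>2) \<le> B\<^sup>2 * integral ?R (\<lambda>p. (f\<^sub>2 p)\<^sup>2)"
    unfolding rect_fubini(1)[OF c2(1)] rect_fubini(1)[OF c2(3)] by simp
  show ?thesis by (rule combine_inverse_squares[OF A B 1 2])
qed

text \<open>Integrals of f over the k vertical strips are integrals of its vertical mean over the k
  intervals, so the one-variable alternating inequality supplies the assumption on the mean. The
  bound on b makes the fluctuation harmless.\<close>

lemma twisted_inequality_x:
  assumes k: "odd k" and b: "b > 0" "(real k)\<^sup>2 \<le> 1 + 1 / b\<^sup>2" and g: "has_grad f f\<^sub>1 f\<^sub>2"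
    and anti: "\<And>x y. f (x + 1, y) = - f (x, y)"
    and alt: "\<And>j. j < k \<Longrightarrow> integral (cbox (real j / k, 0) (real (Suc j) / k, b)) f = (-1) ^ j * C"
  shows "(real k)\<^sup>2 * pi\<^sup>2 * integral (cbox (0, 0) (1, b)) (\<lambda>p. (f p)\<^sup>2)
    \<le> integral (cbox (0, 0) (1, b)) (\<lambda>p. (f\<^sub>1 p)\<^sup>2) + integral (cbox (0, 0) (1, b)) (\<lambda>p. (f\<^sub>2 p)\<^sup>2)"
proof (rule twisted_inequality[OF _ b(1) g])
  note cf = has_grad_cont[OF g]
  show "(real k)\<^sup>2 * pi\<^sup>2 * integral {0..1} (\<lambda>x. (integral {0..b} (\<lambda>y. f (x, y)))\<^sup>2)
     \<le> integral {0..1} (\<lambda>x. (integral {0..b} (\<lambda>y. f\<^sub>1 (x, y)))\<^sup>2)"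
  proof (rule Wirtinger_antiperiodic_alternating[OF k])
    show "integral {0..b} (\<lambda>y. f (1, y)) = - integral {0..b} (\<lambda>y. f (0, y))"
      using anti[of 0] by simp
    show "integral {real j / k..real (Suc j) / k} (\<lambda>x. integral {0..b} (\<lambda>y. f (x, y))) = (-1) ^ j * C" if "j < k" for j
      using alt[OF that] unfolding rect_fubini(1)[OF cf(1)] .
  qed (rule has_derivative_integral_slice[OF g] continuous_on_integral_slice cf)+
  show "(real k)\<^sup>2 * pi\<^sup>2 \<le> pi\<^sup>2 / 1\<^sup>2 + pi\<^sup>2 / b\<^sup>2"
    using mult_right_mono[OF b(2), of "pi\<^sup>2"] by (simp add: distrib_right)
qed (use anti in auto)

lemma has_grad_swap:
  assumes g: "has_grad f f\<^sub>1 f\<^sub>2"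
  shows "has_grad (\<lambda>p. f (snd p, fst p)) (\<lambda>p. f\<^sub>2 (snd p, fst p)) (\<lambda>p. f\<^sub>1 (snd p, fst p))"
  unfolding has_grad_def gderiv_def
proof (intro conjI allI)
  note cf = has_grad_cont[OF g]
  show "continuous_on UNIV (\<lambda>p. f\<^sub>2 (snd p, fst p))" "continuous_on UNIV (\<lambda>p. f\<^sub>1 (snd p, fst p))"
    by (intro continuous_on_compose2[OF cf(3)[of UNIV]] continuous_on_compose2[OF cf(2)[of UNIV]] continuous_intros; simp)+
  fix p :: plane
  have d: "(f has_derivative (\<lambda>h. h \<bullet> (f\<^sub>1 (snd p, fst p), f\<^sub>2 (snd p, fst p)))) (at (snd p, fst p))"
    using g by (auto simp: has_grad_def gderiv_def)
  have "((\<lambda>p. f (snd p, fst p)) has_derivative (\<lambda>h. (snd h, fst h) \<bullet> (f\<^sub>1 (snd p, fst p), f\<^sub>2 (snd p, fst p)))) (at p)"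
    by (rule has_derivative_compose[of "\<lambda>p. (snd p, fst p)" "\<lambda>h. (snd h, fst h)" p UNIV f, OF _ d]) (auto intro!: derivative_eq_intros)
  then show "((\<lambda>p. f (snd p, fst p)) has_derivative (\<lambda>h. h \<bullet> (f\<^sub>2 (snd p, fst p), f\<^sub>1 (snd p, fst p)))) (at p)"
    by (simp add: inner_prod_def add.commute)
qed

lemma integral_rect_swap:
  assumes F: "continuous_on UNIV (F :: plane \<Rightarrow> real)"
  shows "integral (cbox (c, a) (d, b)) (\<lambda>p. F (snd p, fst p)) = integral (cbox (a, c) (b, d)) F"
proof -
  have "continuous_on UNIV (\<lambda>p. F (snd p, fst p))"
    by (intro continuous_on_compose2[OF F] continuous_intros; simp)
  from rect_fubini(1)[OF this] rect_fubini(2)[OF F] show ?thesis by simp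
qed

text \<open>After exchanging the coordinates, the horizontal mean J has integral zero on both halves
  of [0, b]. The Neumann inequality on an interval of length b/2 has the constant 4
  pi^2/b^2.\<close>

lemma twisted_inequality_y:
  assumes b: "b > 0" and g: "has_grad f f\<^sub>1 f\<^sub>2"
    and anti: "\<And>x y. f (x, y + b) = - f (x, y)"
    and m1: "integral (cbox (0, 0) (1, b / 2)) f = 0" and m2: "integral (cbox (0, b / 2) (1, b)) f = 0"
    and \<nu>: "\<nu> \<le> 4 * pi\<^sup>2 / b\<^sup>2" "\<nu> \<le> pi\<^sup>2 + pi\<^sup>2 / b\<^sup>2"
  shows "\<nu> * integral (cbox (0, 0) (1, b)) (\<lambda>p. (f p)\<^sup>2)
    \<le> integral (cbox (0, 0) (1, b)) (\<lambda>p. (f\<^sub>1 p)\<^sup>2) + integral (cbox (0, 0) (1, b)) (\<lambda>p. (f\<^sub>2 p)\<^sup>2)"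
proof -
  note cf = has_grad_cont[OF g]
  note g' = has_grad_swap[OF g]
  note cf' = has_grad_cont[OF g']
  have c2: "continuous_on UNIV (\<lambda>p. (f p)\<^sup>2)" "continuous_on UNIV (\<lambda>p. (f\<^sub>1 p)\<^sup>2)" "continuous_on UNIV (\<lambda>p. (f\<^sub>2 p)\<^sup>2)"
    by (intro continuous_intros cf)+
  define J where "J y = integral {0..1} (\<lambda>x. f (x, y))" for y
  define J' where "J' y = integral {0..1} (\<lambda>x. f\<^sub>2 (x, y))" for y
  have dJ: "(J has_real_derivative J' y) (at y)" for y
    unfolding J_def J'_def using has_derivative_integral_slice[OF g'] by simp
  have cJ: "continuous_on S J" "continuous_on S J'" for S
    unfolding J_def J'_def by (rule continuous_on_integral_slice cf)+
  have piece: "4 * pi\<^sup>2 * integral {s..t} (\<lambda>x. (J x)\<^sup>2) \<le> b\<^sup>2 * integral {s..t} (\<lambda>x. (J' x)\<^sup>2)"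
    if "t - s = b / 2" "integral {s..t} J = 0" for s t
  proof -
    have "pi\<^sup>2 * integral {s..t} (\<lambda>x. (J x)\<^sup>2) \<le> (t - s)\<^sup>2 * integral {s..t} (\<lambda>x. (J' x)\<^sup>2)"
      using that b by (intro Wirtinger_Neumann cJ) (auto intro: DERIV_subset[OF dJ])
    then show ?thesis unfolding that by (simp add: power_divide)
  qed
  have 1: "4 * pi\<^sup>2 * integral {0..b/2} (\<lambda>x. (J x)\<^sup>2) \<le> b\<^sup>2 * integral {0..b/2} (\<lambda>x. (J' x)\<^sup>2)"
    by (rule piece) (use m1 in \<open>auto simp: rect_fubini(2)[OF cf(1)] J_def[abs_def]\<close>)
  have 2: "4 * pi\<^sup>2 * integral {b/2..b} (\<lambda>x. (J x)\<^sup>2) \<le> b\<^sup>2 * integral {b/2..b} (\<lambda>x. (J' x)\<^sup>2)"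
    by (rule piece) (use m2 in \<open>auto simp: rect_fubini(2)[OF cf(1)] J_def[abs_def]\<close>)
  have comb: "integral {0..b/2} F + integral {b/2..b} F = integral {0..b} F" if "continuous_on UNIV F" for F :: "real \<Rightarrow> real"
    using b by (intro Henstock_Kurzweil_Integration.integral_combine integrable_continuous_interval
        continuous_on_subset[OF that]) auto
  have cJ2: "continuous_on UNIV (\<lambda>x. (J x)\<^sup>2)" "continuous_on UNIV (\<lambda>x. (J' x)\<^sup>2)"
    by (intro continuous_intros cJ)+
  have "4 * pi\<^sup>2 * integral {0..b} (\<lambda>x. (J x)\<^sup>2) \<le> b\<^sup>2 * integral {0..b} (\<lambda>x. (J' x)\<^sup>2)"
    using 1 2 unfolding comb[OF cJ2(1), symmetric] comb[OF cJ2(2), symmetric] distrib_left by linarith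
  then have J: "4 * pi\<^sup>2 / b\<^sup>2 * integral {0..b} (\<lambda>x. (J x)\<^sup>2) \<le> integral {0..b} (\<lambda>x. (J' x)\<^sup>2)"
    using b by (simp add: field_simps)
  have "\<nu> * integral {0..b} (\<lambda>x. (J x)\<^sup>2) \<le> integral {0..b} (\<lambda>x. (J' x)\<^sup>2)"
    by (rule order_trans[OF mult_right_mono[OF \<nu>(1)] J])
      (auto intro!: integral_nonneg integrable_continuous_interval continuous_intros cJ)
  then have "\<nu> * integral (cbox (0, 0) (b, 1)) (\<lambda>p. (f (snd p, fst p))\<^sup>2)
    \<le> integral (cbox (0, 0) (b, 1)) (\<lambda>p. (f\<^sub>2 (snd p, fst p))\<^sup>2) + integral (cbox (0, 0) (b, 1)) (\<lambda>p. (f\<^sub>1 (snd p, fst p))\<^sup>2)"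
    using \<nu>(2) b by (intro twisted_inequality g') (auto simp: J_def J'_def anti)
  then show ?thesis
    unfolding integral_rect_swap[OF c2(1)] integral_rect_swap[OF c2(2)] integral_rect_swap[OF c2(3)] by simp
qed

section \<open>Square integrable functions\<close>

text \<open>Values in a Euclidean space, so that functions and their gradients are covered by the
  same lemmas.\<close>

definition sq_int :: "'x measure \<Rightarrow> ('x \<Rightarrow> 'a::euclidean_space) \<Rightarrow> bool" where
  "sq_int M f \<longleftrightarrow> f \<in> borel_measurable M \<and> integrable M (\<lambda>x. (norm (f x))\<^sup>2)"

lemma sq_int_measurable [measurable_dest]: "sq_int M f \<Longrightarrow> f \<in> borel_measurable M"
  by (simp add: sq_int_def)

lemma sq_int_integrable: "sq_int M f \<Longrightarrow> integrable M (\<lambda>x. (norm (f x))\<^sup>2)"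
  by (simp add: sq_int_def)

lemma sq_int_inner:
  assumes "sq_int M f" "sq_int M g"
  shows "integrable M (\<lambda>x. f x \<bullet> g x)"
proof (rule Bochner_Integration.integrable_bound)
  show "integrable M (\<lambda>x. (norm (f x))\<^sup>2 + (norm (g x))\<^sup>2)"
    using assms by (intro Bochner_Integration.integrable_add sq_int_integrable)
  show "(\<lambda>x. f x \<bullet> g x) \<in> borel_measurable M"
    using assms[THEN sq_int_measurable] by simp
  have "\<bar>f x \<bullet> g x\<bar> \<le> (norm (f x))\<^sup>2 + (norm (g x))\<^sup>2" for x
  proof -
    have "\<bar>f x \<bullet> g x\<bar> \<le> norm (f x) * norm (g x)" by (rule Cauchy_Schwarz_ineq2)
    moreover have "2 * (norm (f x) * norm (g x)) \<le> (norm (f x))\<^sup>2 + (norm (g x))\<^sup>2"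
      using sum_squares_bound[of "norm (f x)" "norm (g x)"] by simp
    moreover have "0 \<le> norm (f x) * norm (g x)" by simp
    ultimately show ?thesis by linarith
  qed
  then show "AE x in M. norm (f x \<bullet> g x) \<le> norm ((norm (f x))\<^sup>2 + (norm (g x))\<^sup>2)"
    by simp
qed

lemma norm_add_scale_sq:
  fixes f g :: "'a::real_inner"
  shows "(norm (f + c *\<^sub>R g))\<^sup>2 = (norm f)\<^sup>2 + 2 * c * (f \<bullet> g) + c\<^sup>2 * (norm g)\<^sup>2"
  unfolding power2_norm_eq_inner
  by (simp add: inner_add_left inner_add_right inner_commute[of g f] power2_eq_square algebra_simps)

lemma sq_int_add_scale:
  assumes "sq_int M f" "sq_int M g"
  shows "sq_int M (\<lambda>x. f x + c *\<^sub>R g x)"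
  unfolding sq_int_def norm_add_scale_sq
  using assms[THEN sq_int_measurable] assms[THEN sq_int_integrable] sq_int_inner[OF assms]
  by (auto intro!: Bochner_Integration.integrable_add borel_measurable_add borel_measurable_scaleR)

lemma sq_int_diff:
  assumes "sq_int M f" "sq_int M g"
  shows "sq_int M (\<lambda>x. f x - g x)"
  using sq_int_add_scale[OF assms, of "-1"] by simp

lemma sq_int_expand:
  assumes "sq_int M f" "sq_int M g"
  shows "(\<integral>x. (norm (f x + c *\<^sub>R g x))\<^sup>2 \<partial>M) =
    (\<integral>x. (norm (f x))\<^sup>2 \<partial>M) + 2 * c * (\<integral>x. f x \<bullet> g x \<partial>M) + c\<^sup>2 * (\<integral>x. (norm (g x))\<^sup>2 \<partial>M)"
  unfolding norm_add_scale_sq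
  using assms[THEN sq_int_integrable] sq_int_inner[OF assms] by simp

text \<open>Serves the Cauchy-Schwarz inequality for integrals and, in
  \<open>eigenvalue_rayleigh_inf\<close>, for the form E - l N. The latter can vanish on a
  direction, hence the separate case c = 0.\<close>

lemma quadratic_nonneg_discriminant:
  fixes a b c :: real
  assumes "\<And>t. 0 \<le> a + 2 * t * b + t\<^sup>2 * c" and c: "0 \<le> c"
  shows "b\<^sup>2 \<le> a * c"
proof (cases "c = 0")
  case True
  have "b = 0"
  proof (rule ccontr)
    assume b: "b \<noteq> 0"
    have "2 * (- (a + 1) / (2 * b)) * b = - (a + 1)" using b by (simp add: field_simps)
    then show False using assms(1)[of "- (a + 1) / (2 * b)"] True by simp
  qed
  then show ?thesis using True by simp
next
  case False
  with c have c: "c > 0" by simp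
  have "0 \<le> a + 2 * (- b / c) * b + (- b / c)\<^sup>2 * c" by (rule assms)
  also have "\<dots> = a - b\<^sup>2 / c" using c by (simp add: power2_eq_square field_simps)
  finally show ?thesis using c by (simp add: field_simps)
qed

lemma sq_int_Cauchy_Schwarz:
  assumes "sq_int M f" "sq_int M g"
  shows "(\<integral>x. f x \<bullet> g x \<partial>M)\<^sup>2 \<le> (\<integral>x. (norm (f x))\<^sup>2 \<partial>M) * (\<integral>x. (norm (g x))\<^sup>2 \<partial>M)"
proof (rule quadratic_nonneg_discriminant)
  fix t
  show "0 \<le> (\<integral>x. (norm (f x))\<^sup>2 \<partial>M) + 2 * t * (\<integral>x. f x \<bullet> g x \<partial>M) + t\<^sup>2 * (\<integral>x. (norm (g x))\<^sup>2 \<partial>M)"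
    unfolding sq_int_expand[OF assms, symmetric] by simp
qed simp

lemma sq_int_tendsto_inner:
  assumes f: "\<And>n. sq_int M (f n)" and u: "sq_int M u" and h: "sq_int M h"
    and lim: "(\<lambda>n. \<integral>x. (norm (f n x - u x))\<^sup>2 \<partial>M) \<longlonglongrightarrow> 0"
  shows "(\<lambda>n. \<integral>x. f n x \<bullet> h x \<partial>M) \<longlonglongrightarrow> (\<integral>x. u x \<bullet> h x \<partial>M)"
proof -
  note d = sq_int_diff[OF f u]
  have eq: "(\<integral>x. (f n x - u x) \<bullet> h x \<partial>M) = (\<integral>x. f n x \<bullet> h x \<partial>M) - (\<integral>x. u x \<bullet> h x \<partial>M)" for n
    using sq_int_inner[OF f h] sq_int_inner[OF u h] by (simp add: inner_diff_left)
  have "(\<lambda>n. (\<integral>x. (f n x - u x) \<bullet> h x \<partial>M)\<^sup>2) \<longlonglongrightarrow> 0"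
  proof (rule tendsto_sandwich[OF _ _ tendsto_const])
    show "\<forall>\<^sub>F n in sequentially. (\<integral>x. (f n x - u x) \<bullet> h x \<partial>M)\<^sup>2
        \<le> (\<integral>x. (norm (f n x - u x))\<^sup>2 \<partial>M) * (\<integral>x. (norm (h x))\<^sup>2 \<partial>M)"
      by (intro always_eventually allI sq_int_Cauchy_Schwarz d h)
    show "(\<lambda>n. (\<integral>x. (norm (f n x - u x))\<^sup>2 \<partial>M) * (\<integral>x. (norm (h x))\<^sup>2 \<partial>M)) \<longlonglongrightarrow> 0"
      using tendsto_mult_left_zero[OF lim] .
  qed auto
  then have "(\<lambda>n. \<integral>x. (f n x - u x) \<bullet> h x \<partial>M) \<longlonglongrightarrow> 0"
    by (simp only: power_tendsto_0_iff[OF zero_less_numeral])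
  then show ?thesis
    unfolding eq by (rule LIM_zero_cancel)
qed

lemma sq_int_tendsto_norm:
  assumes f: "\<And>n. sq_int M (f n)" and u: "sq_int M u"
    and lim: "(\<lambda>n. \<integral>x. (norm (f n x - u x))\<^sup>2 \<partial>M) \<longlonglongrightarrow> 0"
  shows "(\<lambda>n. \<integral>x. (norm (f n x))\<^sup>2 \<partial>M) \<longlonglongrightarrow> (\<integral>x. (norm (u x))\<^sup>2 \<partial>M)"
proof -
  have "(\<integral>x. (norm (f n x))\<^sup>2 \<partial>M) = (\<integral>x. (norm (f n x - u x))\<^sup>2 \<partial>M)
      + 2 * (\<integral>x. f n x \<bullet> u x \<partial>M) - (\<integral>x. u x \<bullet> u x \<partial>M)" for n
    using sq_int_expand[OF f u, of n "-1"] by (simp add: power2_norm_eq_inner[of "u _"])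
  moreover have "(\<lambda>n. (\<integral>x. (norm (f n x - u x))\<^sup>2 \<partial>M) + 2 * (\<integral>x. f n x \<bullet> u x \<partial>M) - (\<integral>x. u x \<bullet> u x \<partial>M))
     \<longlonglongrightarrow> 0 + 2 * (\<integral>x. u x \<bullet> u x \<partial>M) - (\<integral>x. u x \<bullet> u x \<partial>M)"
    by (intro tendsto_intros lim sq_int_tendsto_inner f u)
  ultimately show ?thesis by (simp add: power2_norm_eq_inner)
qed

lemma summable_imp_convergent_differences:
  fixes s :: "nat \<Rightarrow> 'a::banach"
  assumes "summable (\<lambda>n. norm (s (Suc n) - s n))"
  shows "convergent s"
proof -
  have "convergent (\<lambda>n. \<Sum>i<n. s (Suc i) - s i)"
    using summable_norm_cancel[OF assms] unfolding summable_iff_convergent .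
  then have "convergent (\<lambda>n. s n - s 0)"
    unfolding sum_lessThan_telescope .
  from convergent_add[OF this convergent_const[of "s 0"]] show ?thesis by simp
qed

text \<open>Riesz-Fischer: a rapidly convergent subsequence converges almost everywhere, and Fatou's
  lemma identifies its limit as the limit in square mean of the whole sequence.\<close>

lemma sq_int_complete:
  fixes f :: "nat \<Rightarrow> 'x \<Rightarrow> 'a::euclidean_space"
  assumes f: "\<And>n. sq_int M (f n)"
    and cauchy: "\<And>e. e > 0 \<Longrightarrow> \<exists>N. \<forall>m\<ge>N. \<forall>n\<ge>N. (\<integral>x. (norm (f m x - f n x))\<^sup>2 \<partial>M) < e"
  obtains u where "sq_int M u" "(\<lambda>n. \<integral>x. (norm (f n x - u x))\<^sup>2 \<partial>M) \<longlonglongrightarrow> 0"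
proof -
  have [measurable]: "f n \<in> borel_measurable M" for n by (rule sq_int_measurable[OF f])
  have nn: "(\<integral>\<^sup>+x. ennreal ((norm (f m x - f n x))\<^sup>2) \<partial>M) = ennreal (\<integral>x. (norm (f m x - f n x))\<^sup>2 \<partial>M)" for m n
    by (intro nn_integral_eq_integral sq_int_integrable sq_int_diff f) auto
  obtain r where r: "strict_mono r" "\<And>n m. m \<ge> r n \<Longrightarrow> (\<integral>x. (norm (f m x - f (r n) x))\<^sup>2 \<partial>M) \<le> (1/4) ^ n"
  proof -
    have "\<exists>N. \<forall>m\<ge>N. \<forall>n\<ge>N. (\<integral>x. (norm (f m x - f n x))\<^sup>2 \<partial>M) < (1/4) ^ j" for j :: nat
      by (rule cauchy) simp
    then obtain N where N: "\<And>j m n. m \<ge> N j \<Longrightarrow> n \<ge> N j \<Longrightarrow> (\<integral>x. (norm (f m x - f n x))\<^sup>2 \<partial>M) < (1/4) ^ j"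
      by metis
    define r where "r = rec_nat (N 0) (\<lambda>n rn. max (Suc rn) (N (Suc n)))"
    have "r (Suc n) > r n" for n by (simp add: r_def)
    then have 1: "strict_mono r" by (simp add: strict_mono_Suc_iff)
    have 2: "r n \<ge> N n" for n by (cases n) (auto simp: r_def)
    show ?thesis
    proof (rule that[OF 1])
      fix n m assume "m \<ge> r n"
      then have "m \<ge> N n" using 2[of n] by simp
      then show "(\<integral>x. (norm (f m x - f (r n) x))\<^sup>2 \<partial>M) \<le> (1/4) ^ n"
        using N[of n m "r n"] 2[of n] by simp
    qed
  qed
  \<comment> \<open>The squared norms of d_n are at most 4^(-n), so the weighted sum of 2^n d_n^2
    has finite integral. Where that sum is finite, d_n decays like 2^(-n/2) and the differences are
    summable.\<close>
  define d where "d n x = norm (f (r (Suc n)) x - f (r n) x)" for n x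
  have [measurable]: "d n \<in> borel_measurable M" for n unfolding d_def by measurable
  have "(\<integral>\<^sup>+x. (\<Sum>n. ennreal (2 ^ n * (d n x)\<^sup>2)) \<partial>M) = (\<Sum>n. \<integral>\<^sup>+x. ennreal (2 ^ n * (d n x)\<^sup>2) \<partial>M)"
    by (rule nn_integral_suminf) measurable
  also have "\<dots> \<le> (\<Sum>n. ennreal ((1/2) ^ n))"
  proof (intro suminf_le)
    fix n
    have "(\<integral>\<^sup>+x. ennreal (2 ^ n * (d n x)\<^sup>2) \<partial>M) = ennreal (2 ^ n) * (\<integral>\<^sup>+x. ennreal ((d n x)\<^sup>2) \<partial>M)"
      by (subst nn_integral_cmult[symmetric]) (auto simp: ennreal_mult)
    also have "\<dots> = ennreal (2 ^ n) * ennreal (\<integral>x. (norm (f (r (Suc n)) x - f (r n) x))\<^sup>2 \<partial>M)"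
      by (simp add: d_def nn)
    also have "\<dots> \<le> ennreal (2 ^ n) * ennreal ((1/4) ^ n)"
      using r(1) by (intro mult_left_mono ennreal_leI r(2)) (auto simp: strict_mono_less_eq)
    also have "\<dots> = ennreal ((1/2) ^ n)"
      by (simp add: ennreal_mult[symmetric] power_mult_distrib[symmetric])
    finally show "(\<integral>\<^sup>+x. ennreal (2 ^ n * (d n x)\<^sup>2) \<partial>M) \<le> ennreal ((1/2) ^ n)" .
  qed auto
  also have "\<dots> = ennreal (\<Sum>n. (1/2) ^ n)"
    by (rule suminf_ennreal2) (auto intro: summable_geometric)
  also have "\<dots> < \<infinity>" by simp
  finally have "AE x in M. (\<Sum>n. ennreal (2 ^ n * (d n x)\<^sup>2)) \<noteq> \<infinity>"
    by (intro nn_integral_noteq_infinite) auto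
  then have conv: "AE x in M. convergent (\<lambda>n. f (r n) x)"
  proof eventually_elim
    case (elim x)
    define S where "S = (\<Sum>n. ennreal (2 ^ n * (d n x)\<^sup>2))"
    have "S \<noteq> \<infinity>" using elim unfolding S_def .
    then obtain K where K: "S = ennreal K" "K \<ge> 0"
      by (cases S) auto
    have "d n x \<le> sqrt K * (1 / sqrt 2) ^ n" for n
    proof -
      have "(\<Sum>n\<in>{n}. ennreal (2 ^ n * (d n x)\<^sup>2)) \<le> S"
        unfolding S_def by (rule sum_le_suminf) auto
      then have "2 ^ n * (d n x)\<^sup>2 \<le> K" using K by simp
      then have "(d n x)\<^sup>2 \<le> K / 2 ^ n" by (simp add: field_simps)
      then have "sqrt ((d n x)\<^sup>2) \<le> sqrt (K / 2 ^ n)" by (rule real_sqrt_le_mono)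
      moreover have "sqrt ((d n x)\<^sup>2) = d n x" by (simp add: d_def)
      moreover have "sqrt (K / 2 ^ n) = sqrt K * (1 / sqrt 2) ^ n"
        by (simp add: real_sqrt_divide real_sqrt_power power_one_over)
      ultimately show ?thesis by simp
    qed
    then have "summable (\<lambda>n. d n x)"
      by (intro summable_comparison_test[OF _ summable_mult[OF summable_geometric[of "1 / sqrt 2"]]])
         (auto simp: d_def)
    then show ?case
      unfolding d_def by (rule summable_imp_convergent_differences)
  qed
  define u where "u x = lim (\<lambda>n. f (r n) x)" for x
  have um [measurable]: "u \<in> borel_measurable M" unfolding u_def by measurable
  have AEu: "AE x in M. (\<lambda>n. f (r n) x) \<longlonglongrightarrow> u x"
    using conv by eventually_elim (simp add: u_def convergent_LIMSEQ_iff)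
  have bound: "(\<integral>\<^sup>+x. ennreal ((norm (f m x - u x))\<^sup>2) \<partial>M) \<le> ennreal e"
    if m: "\<And>n. n \<ge> N \<Longrightarrow> (\<integral>x. (norm (f m x - f n x))\<^sup>2 \<partial>M) \<le> e" for m N e
  proof -
    have "(\<integral>\<^sup>+x. ennreal ((norm (f m x - u x))\<^sup>2) \<partial>M)
        = (\<integral>\<^sup>+x. liminf (\<lambda>n. ennreal ((norm (f m x - f (r n) x))\<^sup>2)) \<partial>M)"
    proof (rule nn_integral_cong_AE)
      show "AE x in M. ennreal ((norm (f m x - u x))\<^sup>2) = liminf (\<lambda>n. ennreal ((norm (f m x - f (r n) x))\<^sup>2))"
        using AEu
      proof eventually_elim
        case (elim x)
        then have "(\<lambda>n. ennreal ((norm (f m x - f (r n) x))\<^sup>2)) \<longlonglongrightarrow> ennreal ((norm (f m x - u x))\<^sup>2)"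
          by (intro tendsto_intros)
        then show ?case by (intro lim_imp_Liminf[symmetric]) auto
      qed
    qed
    also have "\<dots> \<le> liminf (\<lambda>n. \<integral>\<^sup>+x. ennreal ((norm (f m x - f (r n) x))\<^sup>2) \<partial>M)"
      by (rule nn_integral_liminf) measurable
    also have "\<dots> \<le> ennreal e"
    proof (rule Liminf_le)
      show "\<forall>\<^sub>F n in sequentially. (\<integral>\<^sup>+x. ennreal ((norm (f m x - f (r n) x))\<^sup>2) \<partial>M) \<le> ennreal e"
        using eventually_ge_at_top[of N]
      proof eventually_elim
        case (elim n)
        then have "N \<le> r n" using seq_suble[OF r(1), of n] by simp
        then show ?case unfolding nn by (intro ennreal_leI m)
      qed
    qed simp
    finally show ?thesis .
  qed
  obtain N1 where N1: "\<And>m n. m \<ge> N1 \<Longrightarrow> n \<ge> N1 \<Longrightarrow> (\<integral>x. (norm (f m x - f n x))\<^sup>2 \<partial>M) < 1"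
    using cauchy[of 1] by auto
  have "(\<integral>\<^sup>+x. ennreal ((norm (f N1 x - u x))\<^sup>2) \<partial>M) \<le> ennreal 1"
    by (rule bound[of N1]) (auto intro: less_imp_le N1)
  also have "\<dots> < \<infinity>" by simp
  finally have "sq_int M (\<lambda>x. f N1 x - u x)"
    unfolding sq_int_def integrable_iff_bounded by auto
  from sq_int_diff[OF f[of N1] this] have u: "sq_int M u" by simp
  have "(\<lambda>n. \<integral>x. (norm (f n x - u x))\<^sup>2 \<partial>M) \<longlonglongrightarrow> 0"
  proof (rule LIMSEQ_I)
    fix e :: real assume e: "e > 0"
    then obtain N where N: "\<And>m n. m \<ge> N \<Longrightarrow> n \<ge> N \<Longrightarrow> (\<integral>x. (norm (f m x - f n x))\<^sup>2 \<partial>M) < e / 2"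
      using cauchy[of "e/2"] by auto
    have "norm ((\<integral>x. (norm (f m x - u x))\<^sup>2 \<partial>M) - 0) < e" if "m \<ge> N" for m
    proof -
      have "ennreal (\<integral>x. (norm (f m x - u x))\<^sup>2 \<partial>M) = (\<integral>\<^sup>+x. ennreal ((norm (f m x - u x))\<^sup>2) \<partial>M)"
        by (intro nn_integral_eq_integral[symmetric] sq_int_integrable sq_int_diff f u) auto
      also have "\<dots> \<le> ennreal (e / 2)"
        using less_imp_le[OF N[OF that]] by (rule bound)
      finally have "(\<integral>x. (norm (f m x - u x))\<^sup>2 \<partial>M) \<le> e / 2" using e by simp
      moreover have "0 \<le> (\<integral>x. (norm (f m x - u x))\<^sup>2 \<partial>M)" by simp
      ultimately show ?thesis using e by simp
    qed
    then show "\<exists>no. \<forall>n\<ge>no. norm ((\<integral>x. (norm (f n x - u x))\<^sup>2 \<partial>M) - 0) < e" by blast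
  qed
  with u show ?thesis by (rule that)
qed

section \<open>The first eigenvalue\<close>

text \<open>Common ground of plane and torus domains. \<open>V_compact\<close> is Rellich's theorem
  in quantitative form: up to an arbitrarily small multiple of the energy, the mass is controlled by
  finitely many integrals over sets of finite measure. This is the only compactness input.\<close>

locale dirichlet_space =
  fixes M :: "plane measure" and V :: "(plane \<Rightarrow> real) set"
  assumes V_add: "\<phi> \<in> V \<Longrightarrow> \<psi> \<in> V \<Longrightarrow> (\<lambda>p. \<phi> p + c * \<psi> p) \<in> V"
    and V_sq: "\<phi> \<in> V \<Longrightarrow> sq_int M \<phi>"
    and V_grad_sq: "\<phi> \<in> V \<Longrightarrow> sq_int M (grad \<phi>)"
    and V_grad_add: "\<phi> \<in> V \<Longrightarrow> \<psi> \<in> V \<Longrightarrow> grad (\<lambda>p. \<phi> p + c * \<psi> p) p = grad \<phi> p + c *\<^sub>R grad \<psi> p"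
    and V_compact: "\<epsilon> > 0 \<Longrightarrow> \<exists>F C. finite F \<and> (\<forall>A\<in>F. A \<in> sets M \<and> emeasure M A < \<infinity>) \<and> 0 \<le> C \<and>
      (\<forall>\<phi>\<in>V. (\<integral>p. (\<phi> p)\<^sup>2 \<partial>M) \<le> \<epsilon> * (\<integral>p. (norm (grad \<phi> p))\<^sup>2 \<partial>M) + C * (\<Sum>A\<in>F. (\<integral>p. indicator A p * \<phi> p \<partial>M)\<^sup>2))"
    and V_nontrivial: "\<exists>\<phi>\<in>V. (\<integral>p. (\<phi> p)\<^sup>2 \<partial>M) > 0"
begin

definition N :: "(plane \<Rightarrow> real) \<Rightarrow> real" where "N \<phi> = (\<integral>p. (\<phi> p)\<^sup>2 \<partial>M)"
definition E :: "(plane \<Rightarrow> real) \<Rightarrow> real" where "E \<phi> = (\<integral>p. (norm (grad \<phi> p))\<^sup>2 \<partial>M)"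

definition rayleigh_inf :: real where "rayleigh_inf = Inf {E \<phi> / N \<phi> | \<phi>. \<phi> \<in> V \<and> N \<phi> > 0}"

lemma N_nonneg: "N \<phi> \<ge> 0" and E_nonneg: "E \<phi> \<ge> 0"
  by (simp_all add: N_def E_def)

lemma N_expand:
  assumes "\<phi> \<in> V" "\<psi> \<in> V"
  shows "N (\<lambda>p. \<phi> p + c * \<psi> p) = N \<phi> + 2 * c * (\<integral>p. \<phi> p * \<psi> p \<partial>M) + c\<^sup>2 * N \<psi>"
  using sq_int_expand[OF assms[THEN V_sq], of c] by (simp add: N_def)

lemma E_expand:
  assumes "\<phi> \<in> V" "\<psi> \<in> V"
  shows "E (\<lambda>p. \<phi> p + c * \<psi> p) = E \<phi> + 2 * c * (\<integral>p. grad \<phi> p \<bullet> grad \<psi> p \<partial>M) + c\<^sup>2 * E \<psi>"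
  using sq_int_expand[OF assms[THEN V_grad_sq], of c] by (simp add: E_def V_grad_add[OF assms])

lemma rayleigh_bdd: "bdd_below {E \<phi> / N \<phi> | \<phi>. \<phi> \<in> V \<and> N \<phi> > 0}"
  by (rule bdd_belowI[of _ 0]) (auto simp: N_nonneg E_nonneg)

lemma rayleigh_inf_le: "\<phi> \<in> V \<Longrightarrow> rayleigh_inf * N \<phi> \<le> E \<phi>"
proof (cases "N \<phi> > 0")
  case True
  assume "\<phi> \<in> V"
  then have "rayleigh_inf \<le> E \<phi> / N \<phi>"
    unfolding rayleigh_inf_def using True by (intro cInf_lower rayleigh_bdd) auto
  then show ?thesis using True by (simp add: field_simps)
next
  case False
  then have "N \<phi> = 0" using N_nonneg[of \<phi>] by simp
  then show ?thesis by (simp add: E_nonneg)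
qed

lemma rayleigh_inf_approx: "e > 0 \<Longrightarrow> \<exists>\<phi>\<in>V. N \<phi> > 0 \<and> E \<phi> < (rayleigh_inf + e) * N \<phi>"
proof -
  assume "e > 0"
  then have "rayleigh_inf < rayleigh_inf + e" by simp
  then obtain x where "x \<in> {E \<phi> / N \<phi> | \<phi>. \<phi> \<in> V \<and> N \<phi> > 0}" "x < rayleigh_inf + e"
    using V_nontrivial unfolding rayleigh_inf_def N_def[symmetric] by (subst (asm) cInf_less_iff) (auto simp: rayleigh_bdd)
  then show ?thesis by (auto simp: field_simps)
qed

lemma rayleigh_inf_nonneg: "rayleigh_inf \<ge> 0"
  using V_nontrivial unfolding rayleigh_inf_def N_def[symmetric]
  by (intro cInf_greatest) (auto simp: N_nonneg E_nonneg)

text \<open>\<open>H10\<close> is phrased with nonnegative integrals that could be infinite. A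
  single member of the sequence at finite distance shows u and g to be square integrable, after
  which the convergence can be restated with Bochner integrals.\<close>

lemma H10_limit:
  assumes "(u, g) \<in> H10 M V"
  obtains \<phi> where "\<forall>n. \<phi> n \<in> V" "sq_int M u" "sq_int M g"
    "(\<lambda>n. \<integral>p. (norm (\<phi> n p - u p))\<^sup>2 \<partial>M) \<longlonglongrightarrow> 0"
    "(\<lambda>n. \<integral>p. (norm (grad (\<phi> n) p - g p))\<^sup>2 \<partial>M) \<longlonglongrightarrow> 0"
proof -
  obtain \<phi> where [measurable]: "u \<in> borel_measurable M" "g \<in> borel_measurable M"
    and \<phi>: "\<And>n. \<phi> n \<in> V"
    and lu: "(\<lambda>n. \<integral>\<^sup>+p. ennreal ((\<phi> n p - u p)\<^sup>2) \<partial>M) \<longlonglongrightarrow> 0"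
    and lg: "(\<lambda>n. \<integral>\<^sup>+p. ennreal ((norm (grad (\<phi> n) p - g p))\<^sup>2) \<partial>M) \<longlonglongrightarrow> 0"
    using assms unfolding H10_def by auto
  have [measurable]: "\<phi> n \<in> borel_measurable M" "grad (\<phi> n) \<in> borel_measurable M" for n
    using V_sq[OF \<phi>] V_grad_sq[OF \<phi>] by (auto simp: sq_int_def)
  have lu': "(\<lambda>n. \<integral>\<^sup>+p. ennreal ((norm (\<phi> n p - u p))\<^sup>2) \<partial>M) \<longlonglongrightarrow> 0"
    using lu by simp
  have "\<exists>n. (\<integral>\<^sup>+p. ennreal ((norm (\<phi> n p - u p))\<^sup>2) \<partial>M) < 1"
    using order_tendstoD(2)[OF lu', of 1] by (auto simp: eventually_sequentially)
  then obtain n where "(\<integral>\<^sup>+p. ennreal ((norm (\<phi> n p - u p))\<^sup>2) \<partial>M) < 1" by auto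
  then have "sq_int M (\<lambda>p. \<phi> n p - u p)"
    unfolding sq_int_def integrable_iff_bounded by (auto intro: less_trans)
  from sq_int_diff[OF V_sq[OF \<phi>[of n]] this] have u: "sq_int M u" by simp
  have "\<exists>n. (\<integral>\<^sup>+p. ennreal ((norm (grad (\<phi> n) p - g p))\<^sup>2) \<partial>M) < 1"
    using order_tendstoD(2)[OF lg, of 1] by (auto simp: eventually_sequentially)
  then obtain n where "(\<integral>\<^sup>+p. ennreal ((norm (grad (\<phi> n) p - g p))\<^sup>2) \<partial>M) < 1" by auto
  then have "sq_int M (\<lambda>p. grad (\<phi> n) p - g p)"
    unfolding sq_int_def integrable_iff_bounded by (auto intro: less_trans)
  from sq_int_diff[OF V_grad_sq[OF \<phi>[of n]] this] have g: "sq_int M g" by simp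
  have "(\<integral>\<^sup>+p. ennreal ((norm (\<phi> n p - u p))\<^sup>2) \<partial>M) = ennreal (\<integral>p. (norm (\<phi> n p - u p))\<^sup>2 \<partial>M)" for n
    by (intro nn_integral_eq_integral sq_int_integrable[OF sq_int_diff[OF V_sq[OF \<phi>] u]]) simp
  with lu' have 1: "(\<lambda>n. ennreal (\<integral>p. (norm (\<phi> n p - u p))\<^sup>2 \<partial>M)) \<longlonglongrightarrow> ennreal 0" by (simp del: real_norm_def)
  have "(\<integral>\<^sup>+p. ennreal ((norm (grad (\<phi> n) p - g p))\<^sup>2) \<partial>M) = ennreal (\<integral>p. (norm (grad (\<phi> n) p - g p))\<^sup>2 \<partial>M)" for n
    by (intro nn_integral_eq_integral sq_int_integrable[OF sq_int_diff[OF V_grad_sq[OF \<phi>] g]]) simp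
  with lg have 2: "(\<lambda>n. ennreal (\<integral>p. (norm (grad (\<phi> n) p - g p))\<^sup>2 \<partial>M)) \<longlonglongrightarrow> ennreal 0" by simp
  show ?thesis
    by (rule that[OF _ u g]) (use \<phi> 1 2 in \<open>simp_all add: tendsto_ennreal_iff del: ennreal_0\<close>)
qed

lemma H10_energy:
  assumes "(u, g) \<in> H10 M V"
  shows "rayleigh_inf * (\<integral>p. (norm (u p))\<^sup>2 \<partial>M) \<le> (\<integral>p. (norm (g p))\<^sup>2 \<partial>M)"
proof -
  obtain \<phi> where \<phi>': "\<forall>n. \<phi> n \<in> V" and u: "sq_int M u" and g: "sq_int M g"
    and lim: "(\<lambda>n. \<integral>p. (norm (\<phi> n p - u p))\<^sup>2 \<partial>M) \<longlonglongrightarrow> 0"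
    "(\<lambda>n. \<integral>p. (norm (grad (\<phi> n) p - g p))\<^sup>2 \<partial>M) \<longlonglongrightarrow> 0"
    by (rule H10_limit[OF assms])
  note \<phi> = \<phi>'[rule_format]
  show ?thesis
  proof (rule LIMSEQ_le)
    show "(\<lambda>n. rayleigh_inf * (\<integral>p. (norm (\<phi> n p))\<^sup>2 \<partial>M)) \<longlonglongrightarrow> rayleigh_inf * (\<integral>p. (norm (u p))\<^sup>2 \<partial>M)"
      by (intro tendsto_intros sq_int_tendsto_norm V_sq \<phi> u lim)
    show "(\<lambda>n. \<integral>p. (norm (grad (\<phi> n) p))\<^sup>2 \<partial>M) \<longlonglongrightarrow> (\<integral>p. (norm (g p))\<^sup>2 \<partial>M)"
      by (intro sq_int_tendsto_norm V_grad_sq \<phi> g lim)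
    show "\<exists>N. \<forall>n\<ge>N. rayleigh_inf * (\<integral>p. (norm (\<phi> n p))\<^sup>2 \<partial>M) \<le> (\<integral>p. (norm (grad (\<phi> n) p))\<^sup>2 \<partial>M)"
      using rayleigh_inf_le[OF \<phi>] by (simp add: N_def E_def)
  qed
qed

text \<open>An eigenfunction need not be a test function, so the weak equation is tested with a
  sequence approximating it. In the limit its energy equals l times its mass, and
  \<open>H10_energy\<close> compares that with the infimum.\<close>

lemma rayleigh_inf_least:
  assumes "dirichlet_eigenvalue M V l"
  shows "rayleigh_inf \<le> l"
proof -
  obtain u g where ug: "(u, g) \<in> H10 M V" and nz: "\<not> (AE p in M. u p = 0)"
    and weak: "\<And>\<phi>. \<phi> \<in> V \<Longrightarrow> (\<integral>p. g p \<bullet> grad \<phi> p \<partial>M) = l * (\<integral>p. u p * \<phi> p \<partial>M)"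
    using assms unfolding dirichlet_eigenvalue_def by auto
  obtain \<phi> where \<phi>': "\<forall>n. \<phi> n \<in> V" and u: "sq_int M u" and g: "sq_int M g"
    and lim: "(\<lambda>n. \<integral>p. (norm (\<phi> n p - u p))\<^sup>2 \<partial>M) \<longlonglongrightarrow> 0"
    "(\<lambda>n. \<integral>p. (norm (grad (\<phi> n) p - g p))\<^sup>2 \<partial>M) \<longlonglongrightarrow> 0"
    by (rule H10_limit[OF ug])
  note \<phi> = \<phi>'[rule_format]
  have "(\<lambda>n. \<integral>p. grad (\<phi> n) p \<bullet> g p \<partial>M) \<longlonglongrightarrow> (\<integral>p. g p \<bullet> g p \<partial>M)"
    by (intro sq_int_tendsto_inner V_grad_sq \<phi> g lim)
  moreover have "(\<integral>p. grad (\<phi> n) p \<bullet> g p \<partial>M) = l * (\<integral>p. \<phi> n p \<bullet> u p \<partial>M)" for n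
    using weak[OF \<phi>, of n] by (simp add: inner_commute mult.commute)
  moreover have "(\<lambda>n. l * (\<integral>p. \<phi> n p \<bullet> u p \<partial>M)) \<longlonglongrightarrow> l * (\<integral>p. u p \<bullet> u p \<partial>M)"
    by (intro tendsto_intros sq_int_tendsto_inner V_sq \<phi> u lim)
  ultimately have "(\<integral>p. g p \<bullet> g p \<partial>M) = l * (\<integral>p. u p \<bullet> u p \<partial>M)"
    by (simp add: LIMSEQ_unique)
  then have "rayleigh_inf * (\<integral>p. (norm (u p))\<^sup>2 \<partial>M) \<le> l * (\<integral>p. (norm (u p))\<^sup>2 \<partial>M)"
    using H10_energy[OF ug] by (simp add: power2_norm_eq_inner del: real_norm_def)
  moreover have "(\<integral>p. (norm (u p))\<^sup>2 \<partial>M) > 0"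
  proof -
    have "(\<integral>p. (norm (u p))\<^sup>2 \<partial>M) \<noteq> 0"
      using nz integral_nonneg_eq_0_iff_AE[OF sq_int_integrable[OF u]] by simp
    moreover have "(\<integral>p. (norm (u p))\<^sup>2 \<partial>M) \<ge> 0" by simp
    ultimately show ?thesis by linarith
  qed
  ultimately show ?thesis by (simp add: mult_le_cancel_right)
qed

lemma minimizing_sequence:
  obtains \<phi> where "\<forall>n. \<phi> n \<in> V \<and> N (\<phi> n) = 1 \<and> E (\<phi> n) < rayleigh_inf + 1 / real (Suc n)"
proof -
  have "\<exists>\<phi>\<in>V. N \<phi> = 1 \<and> E \<phi> < rayleigh_inf + 1 / real (Suc n)" for n
  proof -
    obtain \<phi> where \<phi>: "\<phi> \<in> V" "N \<phi> > 0" "E \<phi> < (rayleigh_inf + 1 / real (Suc n)) * N \<phi>"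
      using rayleigh_inf_approx[of "1 / real (Suc n)"] by auto
    \<comment> \<open>Normalization of \<phi>, written as \<phi> + c \<phi> because the locale
      offers closure of V only under combinations of this form.\<close>
    define c where "c = 1 / sqrt (N \<phi>) - 1"
    have c1: "(1 + c)\<^sup>2 = 1 / N \<phi>" using \<phi>(2) by (simp add: c_def power_divide)
    have n: "(\<integral>p. \<phi> p * \<phi> p \<partial>M) = N \<phi>" "(\<integral>p. grad \<phi> p \<bullet> grad \<phi> p \<partial>M) = E \<phi>"
      by (simp_all add: N_def E_def power2_eq_square power2_norm_eq_inner[symmetric])
    have "N (\<lambda>p. \<phi> p + c * \<phi> p) = (1 + c)\<^sup>2 * N \<phi>" "E (\<lambda>p. \<phi> p + c * \<phi> p) = (1 + c)\<^sup>2 * E \<phi>"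
      unfolding N_expand[OF \<phi>(1) \<phi>(1)] E_expand[OF \<phi>(1) \<phi>(1)] n by (simp_all add: power2_eq_square algebra_simps)
    moreover have "E \<phi> / N \<phi> < rayleigh_inf + 1 / real (Suc n)"
      using \<phi> by (simp only: pos_divide_less_eq)
    ultimately show ?thesis
      using \<phi>(2) c1 V_add[OF \<phi>(1) \<phi>(1), of c] by (intro bexI[of _ "\<lambda>p. \<phi> p + c * \<phi> p"]) auto
  qed
  then have "\<exists>\<phi>. \<forall>n. \<phi> n \<in> V \<and> N (\<phi> n) = 1 \<and> E (\<phi> n) < rayleigh_inf + 1 / real (Suc n)"
    by (intro choice) blast
  then show ?thesis using that by blast
qed

text \<open>Apply \<open>V_compact\<close> with the tolerances 1/(j+1). Countably many sets occur in
  all, so a diagonal subsequence makes every integral over them converge, and the energy bound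
  absorbs the rest.\<close>

lemma bounded_sequence_Cauchy:
  assumes \<phi>: "\<And>n. \<phi> n \<in> V" and N1: "\<And>n. N (\<phi> n) = 1" and EK: "\<And>n. E (\<phi> n) \<le> K"
  obtains k where "strict_mono (k :: nat \<Rightarrow> nat)"
    "\<forall>e>0. \<exists>n0. \<forall>m\<ge>n0. \<forall>n\<ge>n0. N (\<lambda>p. \<phi> (k m) p + (-1) * \<phi> (k n) p) < e"
proof -
  define good where "good j F C \<longleftrightarrow> finite F \<and> (\<forall>A\<in>F. A \<in> sets M \<and> emeasure M A < \<infinity>) \<and> 0 \<le> C \<and>
      (\<forall>\<phi>\<in>V. N \<phi> \<le> 1 / real (Suc j) * E \<phi> + C * (\<Sum>A\<in>F. (\<integral>p. indicator A p * \<phi> p \<partial>M)\<^sup>2))"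
    for j :: nat and F and C :: real
  have "\<exists>F C. good j F C" for j
    unfolding good_def N_def E_def by (rule V_compact) simp
  then obtain F C where good: "\<And>j. good j (F j) (C j)"
    by metis
  have F: "\<And>j. finite (F j)" "\<And>j A. A \<in> F j \<Longrightarrow> A \<in> sets M \<and> emeasure M A < \<infinity>"
    and C: "\<And>j. 0 \<le> C j"
    and FC: "\<And>j \<phi>. \<phi> \<in> V \<Longrightarrow> N \<phi> \<le> 1 / real (Suc j) * E \<phi> + C j * (\<Sum>A\<in>F j. (\<integral>p. indicator A p * \<phi> p \<partial>M)\<^sup>2)"
    using good unfolding good_def by auto
  have sq: "(\<lambda>p. (norm (indicator A p :: real))\<^sup>2) = indicator A" for A :: "plane set"
    by (auto simp: indicator_def)
  have ind: "sq_int M (\<lambda>p. indicator A p :: real)" if "A \<in> F j" for A j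
    unfolding sq_int_def sq using F(2)[OF that] by (auto intro!: integrable_real_indicator)
  have int: "integrable M (\<lambda>p. indicator A p * \<psi> p)" if "\<psi> \<in> V" "A \<in> F j" for A \<psi> j
    using sq_int_inner[OF ind[OF that(2)] V_sq[OF that(1)]] by simp
  \<comment> \<open>By Cauchy-Schwarz the integral over A is at most the square root of the measure
    of A, hence at most 1 plus that measure. The quotient is bounded by 1 uniformly in A, as the
    diagonal argument requires.\<close>
  define a where "a n A = (\<integral>p. indicator A p * \<phi> n p \<partial>M) / (1 + measure M A)" for n A
  have bd: "norm (a n A) \<le> 1" if A_in: "A \<in> (\<Union>j. F j)" for n A
  proof -
    obtain j where j: "A \<in> F j" using A_in by auto
    have A: "A \<in> sets M" "emeasure M A < \<infinity>" using F(2)[OF j] by auto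
    have "(\<integral>p. indicator A p * \<phi> n p \<partial>M)\<^sup>2 \<le> measure M A * 1"
      using sq_int_Cauchy_Schwarz[OF ind[OF j] V_sq[OF \<phi>[of n]]] N1[of n] A
      unfolding sq by (simp add: N_def)
    also have "\<dots> \<le> (1 + measure M A)\<^sup>2" by (simp add: power2_eq_square algebra_simps)
    finally have "\<bar>\<integral>p. indicator A p * \<phi> n p \<partial>M\<bar> \<le> 1 + measure M A"
      by (rule abs_le_square_iff[THEN iffD2, of _ "1 + measure M A", THEN order_trans]) simp
    moreover have "0 < 1 + measure M A" by (simp add: add_pos_nonneg)
    ultimately show ?thesis by (simp add: a_def)
  qed
  have cnt: "countable (\<Union>j. F j)" using F(1) by (auto intro: countable_finite)
  have "\<exists>k::nat\<Rightarrow>nat. strict_mono k \<and> (\<forall>A\<in>(\<Union>j. F j). \<exists>l. (\<lambda>n. a (k n) A) \<longlonglongrightarrow> l)"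
  proof (rule function_convergent_subsequence[OF cnt bd])
    fix k :: "nat \<Rightarrow> nat"
    assume "strict_mono k" "\<And>A. A \<in> (\<Union>j. F j) \<Longrightarrow> \<exists>l. (\<lambda>n. a (k n) A) \<longlonglongrightarrow> l"
    then show ?thesis by (intro exI[of _ k] conjI ballI)
  qed
  then obtain k where k: "strict_mono (k :: nat \<Rightarrow> nat)" "\<forall>A\<in>(\<Union>j. F j). \<exists>l. (\<lambda>n. a (k n) A) \<longlonglongrightarrow> l"
    by (elim exE conjE)
  show ?thesis
  proof (rule that[OF k(1)], intro allI impI)
    fix e :: real assume e: "e > 0"
    have K: "K \<ge> 0" using EK[of 0] E_nonneg[of "\<phi> 0"] by simp
    \<comment> \<open>Differences of members of the sequence have energy at most 4 K; this j makes
      the energy term smaller than e/2.\<close>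
    obtain j where "4 * K / e * 2 < real j"
      using reals_Archimedean2 by blast
    then have j: "4 * K / e * 2 < real (Suc j)" by simp
    have jK: "1 / real (Suc j) * (4 * K) < e / 2"
      using j e by (simp add: field_simps)
    define c where "c A n = (\<integral>p. indicator A p * \<phi> (k n) p \<partial>M)" for A n
    have conv: "convergent (c A)" if A: "A \<in> F j" for A
    proof -
      obtain l where "(\<lambda>n. a (k n) A) \<longlonglongrightarrow> l" using bspec[OF k(2), of A] A by auto
      from tendsto_mult_right[OF this, of "1 + measure M A"]
      have "c A \<longlonglongrightarrow> l * (1 + measure M A)"
        by (simp add: a_def c_def[abs_def] add_nonneg_eq_0_iff)
      then show ?thesis by (rule convergentI)
    qed
    have "\<exists>n0. \<forall>m\<ge>n0. \<forall>n\<ge>n0. C j * (\<Sum>A\<in>F j. (c A m - c A n)\<^sup>2) < e / 2"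
    proof -
      define \<delta> where "\<delta> = e / (4 * (C j * card (F j) + 1))"
      have pos: "C j * card (F j) + 1 > 0" using C[of j] by (simp add: add_nonneg_pos)
      have \<delta>: "\<delta> > 0" using pos e by (simp add: \<delta>_def)
      have "\<exists>n0. \<forall>m\<ge>n0. \<forall>n\<ge>n0. (c A m - c A n)\<^sup>2 < \<delta>" if "A \<in> F j" for A
      proof -
        have "Cauchy (c A)" using conv[OF that] by (simp add: Cauchy_convergent_iff)
        then obtain n0 where n0: "\<And>m n. m \<ge> n0 \<Longrightarrow> n \<ge> n0 \<Longrightarrow> \<bar>c A m - c A n\<bar> < sqrt \<delta>"
          unfolding Cauchy_iff using \<delta> by (metis real_norm_def real_sqrt_gt_zero)
        have "(c A m - c A n)\<^sup>2 < \<delta>" if "m \<ge> n0" "n \<ge> n0" for m n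
          using power_strict_mono[OF n0[OF that], of 2] \<delta> by simp
        then show ?thesis by blast
      qed
      then obtain n0 where n0: "\<And>A m n. A \<in> F j \<Longrightarrow> m \<ge> n0 A \<Longrightarrow> n \<ge> n0 A \<Longrightarrow> (c A m - c A n)\<^sup>2 < \<delta>"
        by metis
      have "C j * (\<Sum>A\<in>F j. (c A m - c A n)\<^sup>2) < e / 2"
        if "m \<ge> Max (insert 0 (n0 ` F j))" "n \<ge> Max (insert 0 (n0 ` F j))" for m n
      proof -
        have "(\<Sum>A\<in>F j. (c A m - c A n)\<^sup>2) \<le> (\<Sum>A\<in>F j. \<delta>)"
          using that F(1) by (intro sum_mono less_imp_le[OF n0]) auto
        then have "C j * (\<Sum>A\<in>F j. (c A m - c A n)\<^sup>2) \<le> C j * (card (F j) * \<delta>)"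
          using C by (intro mult_left_mono) auto
        also have "\<dots> \<le> (C j * card (F j) + 1) * \<delta>" using \<delta> by (simp add: algebra_simps)
        also have "\<dots> = e / 4"
        proof -
          have "x * (e / (4 * x)) = e / 4" if "x > 0" for x using that by simp
          from this[OF pos] show ?thesis unfolding \<delta>_def .
        qed
        also have "\<dots> < e / 2" using e by simp
        finally show ?thesis .
      qed
      then show ?thesis by blast
    qed
    then obtain n0 where n0: "\<And>m n. m \<ge> n0 \<Longrightarrow> n \<ge> n0 \<Longrightarrow> C j * (\<Sum>A\<in>F j. (c A m - c A n)\<^sup>2) < e / 2" by blast
    have "N (\<lambda>p. \<phi> (k m) p + (-1) * \<phi> (k n) p) < e" if mn: "m \<ge> n0" "n \<ge> n0" for m n
    proof -
      let ?d = "\<lambda>p. \<phi> (k m) p + (-1) * \<phi> (k n) p"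
      have d: "?d \<in> V" by (intro V_add \<phi>)
      have "E ?d \<le> 2 * E (\<phi> (k m)) + 2 * E (\<phi> (k n))"
      proof -
        have "0 \<le> E (\<lambda>p. \<phi> (k m) p + 1 * \<phi> (k n) p)" by (rule E_nonneg)
        then show ?thesis unfolding E_expand[OF \<phi> \<phi>] by simp
      qed
      also have "\<dots> \<le> 4 * K" using EK[of "k m"] EK[of "k n"] by simp
      finally have Ed: "E ?d \<le> 4 * K" .
      have cd: "(\<integral>p. indicator A p * ?d p \<partial>M) = c A m - c A n" if "A \<in> F j" for A
        using int[OF \<phi> that] by (simp add: c_def right_diff_distrib)
      have "N ?d \<le> 1 / real (Suc j) * E ?d + C j * (\<Sum>A\<in>F j. (\<integral>p. indicator A p * ?d p \<partial>M)\<^sup>2)"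
        by (rule FC[OF d])
      also have "(\<Sum>A\<in>F j. (\<integral>p. indicator A p * ?d p \<partial>M)\<^sup>2) = (\<Sum>A\<in>F j. (c A m - c A n)\<^sup>2)"
        by (intro sum.cong refl) (simp only: cd)
      also have "1 / real (Suc j) * E ?d \<le> 1 / real (Suc j) * (4 * K)"
        by (intro mult_left_mono Ed) simp
      finally show ?thesis using jK n0[OF mn] by linarith
    qed
    then show "\<exists>n0. \<forall>m\<ge>n0. \<forall>n\<ge>n0. N (\<lambda>p. \<phi> (k m) p + (-1) * \<phi> (k n) p) < e" by blast
  qed
qed

text \<open>
  By the parallelogram identity, a minimizing sequence which is Cauchy in \<open>L\<^sup>2\<close> is also Cauchy
  in the energy norm.
\<close>

lemma eigenvalue_rayleigh_inf: "dirichlet_eigenvalue M V rayleigh_inf"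
proof -
  let ?l = rayleigh_inf
  obtain \<phi>' where min: "\<forall>n. \<phi>' n \<in> V \<and> N (\<phi>' n) = 1 \<and> E (\<phi>' n) < ?l + 1 / real (Suc n)"
    by (rule minimizing_sequence)
  have \<phi>': "\<phi>' n \<in> V" "N (\<phi>' n) = 1" "E (\<phi>' n) < ?l + 1 / real (Suc n)" for n
    using min by blast+
  have "E (\<phi>' n) \<le> ?l + 1" for n
    using \<phi>'(3)[of n] by (rule less_imp_le[OF order_less_le_trans]) simp
  from bounded_sequence_Cauchy[OF \<phi>'(1,2) this]
  obtain k where k1: "strict_mono (k :: nat \<Rightarrow> nat)"
    and k2: "\<forall>e>0. \<exists>n0. \<forall>m\<ge>n0. \<forall>n\<ge>n0. N (\<lambda>p. \<phi>' (k m) p + (-1) * \<phi>' (k n) p) < e" .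
  note k = k1 k2[rule_format]
  define \<phi> where "\<phi> n = \<phi>' (k n)" for n
  have \<phi>: "\<And>n. \<phi> n \<in> V" "\<And>n. N (\<phi> n) = 1" by (simp_all add: \<phi>_def \<phi>')
  have E\<phi>: "E (\<phi> n) < ?l + 1 / real (Suc n)" for n
  proof -
    have "1 / real (Suc (k n)) \<le> 1 / real (Suc n)"
      using seq_suble[OF k(1), of n] by (intro divide_left_mono) auto
    then show ?thesis using \<phi>'(3)[of "k n"] by (simp add: \<phi>_def)
  qed
  have Ediff: "E (\<lambda>p. \<phi> m p + (-1) * \<phi> n p) \<le> 2 / real (Suc m) + 2 / real (Suc n) + ?l * N (\<lambda>p. \<phi> m p + (-1) * \<phi> n p)" for m n
  proof -
    have "?l * N (\<lambda>p. \<phi> m p + 1 * \<phi> n p) \<le> E (\<lambda>p. \<phi> m p + 1 * \<phi> n p)"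
      by (rule rayleigh_inf_le[OF V_add[OF \<phi>(1) \<phi>(1)]])
    then show ?thesis
      using E\<phi>[of m] E\<phi>[of n] unfolding N_expand[OF \<phi>(1) \<phi>(1)] E_expand[OF \<phi>(1) \<phi>(1)] \<phi>(2)
      by (simp add: algebra_simps)
  qed
  have norm_diff: "(\<integral>p. (norm (\<phi> m p - \<phi> n p))\<^sup>2 \<partial>M) = N (\<lambda>p. \<phi> m p + (-1) * \<phi> n p)"
    "(\<integral>p. (norm (grad (\<phi> m) p - grad (\<phi> n) p))\<^sup>2 \<partial>M) = E (\<lambda>p. \<phi> m p + (-1) * \<phi> n p)" for m n
    using V_grad_add[OF \<phi>(1) \<phi>(1), of m "-1" n] by (simp_all add: N_def E_def)
  have Ncauchy: "\<exists>n0. \<forall>m\<ge>n0. \<forall>n\<ge>n0. (\<integral>p. (norm (\<phi> m p - \<phi> n p))\<^sup>2 \<partial>M) < e" if "e > 0" for e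
    unfolding norm_diff unfolding \<phi>_def using k(2)[OF that] .
  have Ecauchy: "\<exists>n0. \<forall>m\<ge>n0. \<forall>n\<ge>n0. (\<integral>p. (norm (grad (\<phi> m) p - grad (\<phi> n) p))\<^sup>2 \<partial>M) < e" if e: "e > 0" for e
  proof -
    \<comment> \<open>The summand 1 keeps the denominator positive even if the infimum is 0.\<close>
    define e' where "e' = e / (2 * (?l + 1))"
    have e': "e' > 0" "?l * e' \<le> e / 2" using e rayleigh_inf_nonneg by (auto simp: e'_def field_simps)
    obtain n0 where n0: "\<forall>m\<ge>n0. \<forall>n\<ge>n0. N (\<lambda>p. \<phi> m p + (-1) * \<phi> n p) < e'"
      using Ncauchy[OF e'(1)] unfolding norm_diff by blast
    obtain n1 where n1: "8 / e < real n1" using reals_Archimedean2 by blast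
    have small: "2 / real (Suc m) < e / 4" if "m \<ge> n1" for m
    proof -
      have "8 / e < real (Suc m)" using that n1 by simp
      then show ?thesis using e by (simp add: field_simps)
    qed
    have "E (\<lambda>p. \<phi> m p + (-1) * \<phi> n p) < e" if "m \<ge> max n0 n1" "n \<ge> max n0 n1" for m n
    proof -
      have "?l * N (\<lambda>p. \<phi> m p + (-1) * \<phi> n p) \<le> ?l * e'"
        using n0[rule_format, of m n] that rayleigh_inf_nonneg by (intro mult_left_mono) auto
      then show ?thesis using Ediff[of m n] small[of m] small[of n] that e'(2) by linarith
    qed
    then show ?thesis unfolding norm_diff by blast
  qed
  obtain u where u: "sq_int M u" and lu: "(\<lambda>n. \<integral>p. (norm (\<phi> n p - u p))\<^sup>2 \<partial>M) \<longlonglongrightarrow> 0"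
    by (rule sq_int_complete[OF V_sq[OF \<phi>(1)] Ncauchy])
  obtain g where g: "sq_int M g" and lg: "(\<lambda>n. \<integral>p. (norm (grad (\<phi> n) p - g p))\<^sup>2 \<partial>M) \<longlonglongrightarrow> 0"
    by (rule sq_int_complete[OF V_grad_sq[OF \<phi>(1)] Ecauchy])
  have nu: "(\<integral>\<^sup>+p. ennreal ((\<phi> n p - u p)\<^sup>2) \<partial>M) = ennreal (\<integral>p. (norm (\<phi> n p - u p))\<^sup>2 \<partial>M)" for n
    using nn_integral_eq_integral[OF sq_int_integrable[OF sq_int_diff[OF V_sq[OF \<phi>(1)] u]], of n] by simp
  have ng: "(\<integral>\<^sup>+p. ennreal ((norm (grad (\<phi> n) p - g p))\<^sup>2) \<partial>M) = ennreal (\<integral>p. (norm (grad (\<phi> n) p - g p))\<^sup>2 \<partial>M)" for n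
    using nn_integral_eq_integral[OF sq_int_integrable[OF sq_int_diff[OF V_grad_sq[OF \<phi>(1)] g]], of n] by simp
  have ug: "(u, g) \<in> H10 M V"
    unfolding H10_def using sq_int_measurable[OF u] sq_int_measurable[OF g] \<phi>(1)
      tendsto_ennrealI[OF lu] tendsto_ennrealI[OF lg] by (auto simp: nu ng intro!: exI[of _ \<phi>])
  have "(\<lambda>n. \<integral>p. (norm (\<phi> n p))\<^sup>2 \<partial>M) \<longlonglongrightarrow> (\<integral>p. (norm (u p))\<^sup>2 \<partial>M)"
    by (intro sq_int_tendsto_norm V_sq \<phi> u lu)
  moreover have "(\<integral>p. (norm (\<phi> n p))\<^sup>2 \<partial>M) = 1" for n
    using \<phi>(2)[of n] by (simp add: N_def)
  ultimately have u1: "(\<integral>p. (norm (u p))\<^sup>2 \<partial>M) = 1"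
    by (simp add: LIMSEQ_const_iff)
  have nz: "\<not> (AE p in M. u p = 0)"
  proof
    assume "AE p in M. u p = 0"
    then have "(\<integral>p. (norm (u p))\<^sup>2 \<partial>M) = (\<integral>p. 0 \<partial>M)"
      using sq_int_measurable[OF u] by (intro integral_cong_AE) auto
    with u1 show False by simp
  qed
  have weak: "(\<integral>p. g p \<bullet> grad \<psi> p \<partial>M) = ?l * (\<integral>p. u p * \<psi> p \<partial>M)" if \<psi>: "\<psi> \<in> V" for \<psi>
  proof -
    \<comment> \<open>First variation of E - l N at \<phi>_n in the direction \<psi>. That form is
      nonnegative, so Cauchy-Schwarz bounds B_n^2 by its value at \<phi>_n, which tends to 0, times
      its value at \<psi>. The limit of B_n is the weak equation.\<close>
    define B where "B n = (\<integral>p. grad (\<phi> n) p \<bullet> grad \<psi> p \<partial>M) - ?l * (\<integral>p. \<phi> n p \<bullet> \<psi> p \<partial>M)" for n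
    have B: "(B n)\<^sup>2 \<le> (E (\<phi> n) - ?l) * (E \<psi> - ?l * N \<psi>)" for n
    proof (rule quadratic_nonneg_discriminant)
      fix t
      have "?l * N (\<lambda>p. \<phi> n p + t * \<psi> p) \<le> E (\<lambda>p. \<phi> n p + t * \<psi> p)"
        by (rule rayleigh_inf_le[OF V_add[OF \<phi>(1) \<psi>]])
      then show "0 \<le> E (\<phi> n) - ?l + 2 * t * B n + t\<^sup>2 * (E \<psi> - ?l * N \<psi>)"
        unfolding N_expand[OF \<phi>(1) \<psi>] E_expand[OF \<phi>(1) \<psi>] \<phi>(2) B_def by (simp add: algebra_simps)
    qed (use rayleigh_inf_le[OF \<psi>] in simp)
    have limB: "B \<longlonglongrightarrow> (\<integral>p. g p \<bullet> grad \<psi> p \<partial>M) - ?l * (\<integral>p. u p \<bullet> \<psi> p \<partial>M)"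
      unfolding B_def
      by (intro tendsto_intros sq_int_tendsto_inner V_sq V_grad_sq \<phi>(1) \<psi> u g lu lg)
    have "(\<lambda>n. (B n)\<^sup>2) \<longlonglongrightarrow> 0"
    proof (rule tendsto_sandwich[OF _ _ tendsto_const])
      show "\<forall>\<^sub>F n in sequentially. (B n)\<^sup>2 \<le> 1 / real (Suc n) * (E \<psi> - ?l * N \<psi>)"
      proof (intro always_eventually allI)
        fix n
        have "(E (\<phi> n) - ?l) * (E \<psi> - ?l * N \<psi>) \<le> 1 / real (Suc n) * (E \<psi> - ?l * N \<psi>)"
          using E\<phi>[of n] rayleigh_inf_le[OF \<psi>] by (intro mult_right_mono) auto
        with B[of n] show "(B n)\<^sup>2 \<le> 1 / real (Suc n) * (E \<psi> - ?l * N \<psi>)" by linarith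
      qed
      show "(\<lambda>n. 1 / real (Suc n) * (E \<psi> - ?l * N \<psi>)) \<longlonglongrightarrow> 0"
        using tendsto_mult_left_zero[OF LIMSEQ_Suc[OF lim_1_over_n]] .
    qed auto
    then have "B \<longlonglongrightarrow> 0"
      by (simp only: power_tendsto_0_iff[OF zero_less_numeral])
    from LIMSEQ_unique[OF limB this] show ?thesis by simp
  qed
  show ?thesis
    unfolding dirichlet_eigenvalue_def by (rule bexI[OF _ ug]) (use nz weak in simp)
qed

lemma least_eigenvalue: "(LEAST l. dirichlet_eigenvalue M V l) = rayleigh_inf"
  by (rule Least_equality) (rule eigenvalue_rayleigh_inf, rule rayleigh_inf_least)

end

section \<open>Smooth functions\<close>

lemma C_k_continuous: "C_k n f \<Longrightarrow> continuous_on UNIV f"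
proof (cases n)
  case (Suc m)
  assume "C_k n f"
  then show ?thesis
    unfolding Suc C_k.simps gderiv_def
    by (blast intro: continuous_at_imp_continuous_on has_derivative_continuous)
qed simp

lemma C_k_Suc: "C_k (Suc n) f \<Longrightarrow> C_k n f"
proof (induction n arbitrary: f)
  case 0
  then show ?case using C_k_continuous[OF 0] by simp
next
  case (Suc n)
  from Suc.prems obtain f\<^sub>1 f\<^sub>2 where f: "C_k (Suc n) f\<^sub>1" "C_k (Suc n) f\<^sub>2" "\<forall>p. GDERIV f p :> (f\<^sub>1 p, f\<^sub>2 p)"
    by (subst (asm) C_k.simps) blast
  show ?case
    using f(3) Suc.IH[OF f(1)] Suc.IH[OF f(2)] by (subst C_k.simps) blast
qed

lemma C_k_has_grad: "C_k (Suc 0) f \<longleftrightarrow> (\<exists>f\<^sub>1 f\<^sub>2. has_grad f f\<^sub>1 f\<^sub>2)"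
  by (auto simp: has_grad_def)

lemma C_k_const: "C_k n (\<lambda>p. c)"
proof (induction n arbitrary: c)
  case (Suc n)
  have "\<forall>p. GDERIV (\<lambda>p::plane. c) p :> (0, 0)"
    by (auto simp: zero_prod_def[symmetric] intro: GDERIV_const)
  then show ?case unfolding C_k.simps
    using Suc[of 0] by (intro exI[of _ "\<lambda>p. 0"] conjI)
qed simp

lemma C_k_add: "C_k n f \<Longrightarrow> C_k n g \<Longrightarrow> C_k n (\<lambda>p. f p + g p)"
proof (induction n arbitrary: f g)
  case 0
  then show ?case by (simp add: continuous_on_add)
next
  case (Suc n)
  from Suc.prems obtain f\<^sub>1 f\<^sub>2 g\<^sub>1 g\<^sub>2 where f: "C_k n f\<^sub>1" "C_k n f\<^sub>2" "\<And>p. GDERIV f p :> (f\<^sub>1 p, f\<^sub>2 p)"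
    and g: "C_k n g\<^sub>1" "C_k n g\<^sub>2" "\<And>p. GDERIV g p :> (g\<^sub>1 p, g\<^sub>2 p)"
    unfolding C_k.simps by blast
  have "\<forall>p. GDERIV (\<lambda>p. f p + g p) p :> (f\<^sub>1 p + g\<^sub>1 p, f\<^sub>2 p + g\<^sub>2 p)"
    using GDERIV_add[OF f(3) g(3)] by simp
  then show ?case unfolding C_k.simps
    using Suc.IH[OF f(1) g(1)] Suc.IH[OF f(2) g(2)] by (intro exI conjI)
qed

lemma C_k_mult: "C_k n f \<Longrightarrow> C_k n g \<Longrightarrow> C_k n (\<lambda>p. f p * g p)"
proof (induction n arbitrary: f g)
  case 0
  then show ?case by (simp add: continuous_on_mult)
next
  case (Suc n)
  note fg = C_k_Suc[OF Suc.prems(1)] C_k_Suc[OF Suc.prems(2)]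
  from Suc.prems obtain f\<^sub>1 f\<^sub>2 g\<^sub>1 g\<^sub>2 where f: "C_k n f\<^sub>1" "C_k n f\<^sub>2" "\<And>p. GDERIV f p :> (f\<^sub>1 p, f\<^sub>2 p)"
    and g: "C_k n g\<^sub>1" "C_k n g\<^sub>2" "\<And>p. GDERIV g p :> (g\<^sub>1 p, g\<^sub>2 p)"
    unfolding C_k.simps by blast
  have "\<forall>p. GDERIV (\<lambda>p. f p * g p) p :> (f p * g\<^sub>1 p + g p * f\<^sub>1 p, f p * g\<^sub>2 p + g p * f\<^sub>2 p)"
    using GDERIV_mult[OF f(3) g(3)] by simp
  then show ?case unfolding C_k.simps
    using C_k_add[OF Suc.IH[OF fg(1) g(1)] Suc.IH[OF fg(2) f(1)]]
      C_k_add[OF Suc.IH[OF fg(1) g(2)] Suc.IH[OF fg(2) f(2)]] by (intro exI conjI)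
qed

lemma smooth_const: "smooth (\<lambda>p. c)" and smooth_add: "smooth f \<Longrightarrow> smooth g \<Longrightarrow> smooth (\<lambda>p. f p + g p)"
  and smooth_mult: "smooth f \<Longrightarrow> smooth g \<Longrightarrow> smooth (\<lambda>p. f p * g p)"
  by (auto simp: smooth_def intro: C_k_const C_k_add C_k_mult)

lemma smooth_fst: "smooth fst" and smooth_snd: "smooth snd"
proof -
  have "GDERIV fst p :> (1, 0)" "GDERIV snd p :> (0, 1)" for p :: plane
    by (auto simp: gderiv_def inner_prod_def intro!: has_derivative_fst has_derivative_snd)
  then have "C_k (Suc n) fst" "C_k (Suc n) snd" for n
    unfolding C_k.simps using C_k_const[of n 1] C_k_const[of n 0]
    by - (rule exI[of _ "\<lambda>p. 1"], rule exI[of _ "\<lambda>p. 0"], simp,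
        rule exI[of _ "\<lambda>p. 0"], rule exI[of _ "\<lambda>p. 1"], simp)
  then show "smooth fst" "smooth snd"
    unfolding smooth_def by (auto intro: C_k_Suc)
qed

lemma smooth_has_grad: "smooth f \<Longrightarrow> has_grad f (\<lambda>p. fst (grad f p)) (\<lambda>p. snd (grad f p))"
proof -
  assume "smooth f"
  then have "C_k (Suc 0) f" by (simp only: smooth_def)
  then obtain f\<^sub>1 f\<^sub>2 where f: "has_grad f f\<^sub>1 f\<^sub>2" unfolding C_k_has_grad by blast
  have "grad f = (\<lambda>p. (f\<^sub>1 p, f\<^sub>2 p))" using has_grad_grad[OF f] by auto
  with f show ?thesis by simp
qed

text \<open>The bumps below are given by different formulas on different open sets, so smoothness
  has to be a local property. The induction uses the components of \<open>grad f\<close>, which are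
  determined pointwise and hence agree with every local formula.\<close>

lemma C_k_local:
  assumes "\<And>p. \<exists>U g. open U \<and> p \<in> U \<and> C_k n g \<and> (\<forall>q\<in>U. f q = g q)"
  shows "C_k n f"
  using assms
proof (induction n arbitrary: f)
  case 0
  have "isCont f p" for p
  proof -
    obtain U g where U: "open U" "p \<in> U" "C_k 0 g" "\<forall>q\<in>U. f q = g q" using 0[of p] by blast
    then have "isCont g p" by (simp add: continuous_on_eq_continuous_at del: split_paired_All)
    moreover have "eventually (\<lambda>q. f q = g q) (nhds p)"
      using U by (auto simp: eventually_nhds)
    ultimately show ?thesis by (simp add: isCont_cong)
  qed
  then show ?case by (simp add: continuous_at_imp_continuous_on)
next
  case (Suc n)
  have key: "\<exists>U g\<^sub>1 g\<^sub>2. open U \<and> p \<in> U \<and> C_k n g\<^sub>1 \<and> C_k n g\<^sub>2 \<and> (\<forall>q\<in>U. GDERIV f q :> (g\<^sub>1 q, g\<^sub>2 q))" for p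
  proof -
    obtain U g where U: "open U" "p \<in> U" "C_k (Suc n) g" "\<forall>q\<in>U. f q = g q" using Suc.prems[of p] by blast
    from U(3) obtain g\<^sub>1 g\<^sub>2 where g: "C_k n g\<^sub>1" "C_k n g\<^sub>2" "\<And>p. GDERIV g p :> (g\<^sub>1 p, g\<^sub>2 p)"
      unfolding C_k.simps by blast
    have "GDERIV f q :> (g\<^sub>1 q, g\<^sub>2 q)" if "q \<in> U" for q
      using g(3)[of q] unfolding gderiv_def
      by (rule has_derivative_transform_within_open[OF _ U(1) that]) (use U(4) in auto)
    then show ?thesis using U g by blast
  qed
  have der: "GDERIV f p :> (fst (grad f p), snd (grad f p))" for p
  proof -
    obtain D where "GDERIV f p :> D" using key[of p] by blast
    then show ?thesis using grad_eq by simp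
  qed
  have "C_k n (\<lambda>p. fst (grad f p))"
  proof (rule Suc.IH)
    fix p
    obtain U g\<^sub>1 g\<^sub>2 where "open U" "p \<in> U" "C_k n g\<^sub>1" "C_k n g\<^sub>2" "\<forall>q\<in>U. GDERIV f q :> (g\<^sub>1 q, g\<^sub>2 q)"
      using key[of p] by blast
    then show "\<exists>U g. open U \<and> p \<in> U \<and> C_k n g \<and> (\<forall>q\<in>U. fst (grad f q) = g q)"
      by (intro exI[of _ U] exI[of _ g\<^sub>1]) (auto dest!: grad_eq)
  qed
  moreover have "C_k n (\<lambda>p. snd (grad f p))"
  proof (rule Suc.IH)
    fix p
    obtain U g\<^sub>1 g\<^sub>2 where "open U" "p \<in> U" "C_k n g\<^sub>1" "C_k n g\<^sub>2" "\<forall>q\<in>U. GDERIV f q :> (g\<^sub>1 q, g\<^sub>2 q)"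
      using key[of p] by blast
    then show "\<exists>U g. open U \<and> p \<in> U \<and> C_k n g \<and> (\<forall>q\<in>U. snd (grad f q) = g q)"
      by (intro exI[of _ U] exI[of _ g\<^sub>2]) (auto dest!: grad_eq)
  qed
  ultimately show ?case unfolding C_k.simps using der by blast
qed

lemma smooth_local:
  assumes "\<And>p. \<exists>U g. open U \<and> p \<in> U \<and> smooth g \<and> (\<forall>q\<in>U. f q = g q)"
  shows "smooth f"
  unfolding smooth_def using assms by (intro allI C_k_local) (meson smooth_def)

section \<open>Smooth functions of one variable and smooth truncation\<close>

definition smooth1 :: "(real \<Rightarrow> real) \<Rightarrow> bool" where
  "smooth1 h \<longleftrightarrow> (\<exists>D. D 0 = h \<and> (\<forall>n t. (D n has_real_derivative D (Suc n) t) (at t)))"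

text \<open>Having all derivatives of h at hand as one sequence D lets the induction run over every
  \<open>D m\<close> at once: the chain rule replaces \<open>D m\<close> by
  \<open>D (Suc m)\<close>.\<close>

lemma smooth_compose:
  assumes "smooth1 h" "smooth f"
  shows "smooth (\<lambda>p. h (f p))"
proof -
  obtain D where D: "D 0 = h" "\<And>n t. (D n has_real_derivative D (Suc n) t) (at t)"
    using assms(1) unfolding smooth1_def by blast
  have "C_k n f \<Longrightarrow> C_k n (\<lambda>p. D m (f p))" for n m
  proof (induction n arbitrary: m)
    case 0
    have "continuous_on UNIV (D m)"
      using D(2) by (meson DERIV_continuous continuous_at_imp_continuous_on)
    then show ?case using 0 by (auto intro: continuous_on_compose2)
  next
    case (Suc n)
    from Suc.prems obtain f\<^sub>1 f\<^sub>2 where f: "C_k n f\<^sub>1" "C_k n f\<^sub>2" "\<And>p. GDERIV f p :> (f\<^sub>1 p, f\<^sub>2 p)"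
      unfolding C_k.simps by blast
    have "\<forall>p. GDERIV (\<lambda>p. D m (f p)) p :> (D (Suc m) (f p) * f\<^sub>1 p, D (Suc m) (f p) * f\<^sub>2 p)"
      using GDERIV_DERIV_compose[OF f(3) D(2)] by simp
    then show ?case unfolding C_k.simps
      using C_k_mult[OF Suc.IH[OF C_k_Suc[OF Suc.prems]] f(1)] C_k_mult[OF Suc.IH[OF C_k_Suc[OF Suc.prems]] f(2)]
      by (intro exI conjI)
  qed
  then show ?thesis using assms(2) D(1) unfolding smooth_def by blast
qed

lemma smooth1_sin: "smooth1 sin"
  unfolding smooth1_def
proof (intro exI[of _ "\<lambda>n t. sin (t + real n * pi / 2)"] conjI allI)
  fix n t
  have "sin (t + real (Suc n) * pi / 2) = sin ((t + real n * pi / 2) + pi / 2)"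
    by (simp add: field_simps)
  also have "\<dots> = cos (t + real n * pi / 2)" by (simp only: sin_add) simp
  finally have e: "sin (t + real (Suc n) * pi / 2) = cos (t + real n * pi / 2)" .
  show "((\<lambda>t. sin (t + real n * pi / 2)) has_real_derivative sin (t + real (Suc n) * pi / 2)) (at t)"
    unfolding e by (auto intro!: derivative_eq_intros)
qed simp

text \<open>
  Smooth truncation: since its derivative lies in \<open>[0, 1]\<close>, composing with this approximation of
  the positive part does not increase the energy.
\<close>

definition soft_pos :: "real \<Rightarrow> real \<Rightarrow> real" where
  "soft_pos \<delta> t = (if t > 0 then t * exp (- \<delta> / t) else 0)"

text \<open>A family closed under differentiation, so that all derivatives of
  \<open>soft_pos\<close> (the case p = 1) are given by a recursion on polynomials in 1/t. At t = 0
  the difference quotients vanish because the exponential beats every polynomial.\<close>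

definition soft_pos_poly :: "real \<Rightarrow> real poly \<Rightarrow> real \<Rightarrow> real" where
  "soft_pos_poly \<delta> p t = (if t > 0 then t * poly p (1 / t) * exp (- \<delta> / t) else 0)"

lemma poly_times_exp_tendsto_0:
  fixes \<delta> :: real
  assumes "\<delta> > 0"
  shows "((\<lambda>s. s ^ k * poly p s * exp (- \<delta> * s)) \<longlongrightarrow> 0) at_top"
proof (induction p arbitrary: k)
  case (pCons a p)
  have "filterlim (\<lambda>s. \<delta> * s) at_top at_top"
    by (rule filterlim_tendsto_pos_mult_at_top[where f = "\<lambda>_. \<delta>" and c = \<delta>])
      (use assms in \<open>auto intro: filterlim_ident\<close>)
  from filterlim_compose[OF tendsto_power_div_exp_0 this, of k]
  have "((\<lambda>s. a / \<delta> ^ k * ((\<delta> * s) ^ k / exp (\<delta> * s))) \<longlongrightarrow> a / \<delta> ^ k * 0) at_top"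
    by (intro tendsto_mult tendsto_const)
  then have "((\<lambda>s. a * s ^ k * exp (- \<delta> * s)) \<longlongrightarrow> 0) at_top"
    using assms by (simp add: power_mult_distrib exp_minus field_simps)
  from tendsto_add[OF this pCons.IH[of "Suc k"]] show ?case
    by (simp add: algebra_simps)
qed simp

lemma soft_pos_poly_deriv:
  assumes \<delta>: "\<delta> > 0"
  shows "(soft_pos_poly \<delta> p has_real_derivative
    soft_pos_poly \<delta> (pCons 0 (p - pCons 0 (pderiv p) + smult \<delta> (pCons 0 p))) t) (at t)"
proof -
  let ?q = "pCons 0 (p - pCons 0 (pderiv p) + smult \<delta> (pCons 0 p))"
  consider "t > 0" | "t < 0" | "t = 0" by linarith
  then show ?thesis
  proof cases
    case 1
    have "((\<lambda>t. t * poly p (1 / t) * exp (- \<delta> / t)) has_real_derivative soft_pos_poly \<delta> ?q t) (at t)"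
      using 1 by (auto intro!: derivative_eq_intros poly_DERIV[THEN DERIV_chain2] simp: soft_pos_poly_def power2_eq_square field_simps)
    then show ?thesis
      by (rule has_field_derivative_transform_within_open[of _ _ _ "{0<..}"]) (use 1 in \<open>auto simp: soft_pos_poly_def\<close>)
  next
    case 2
    have "((\<lambda>t. 0) has_real_derivative soft_pos_poly \<delta> ?q t) (at t)"
      using 2 by (simp add: soft_pos_poly_def)
    then show ?thesis
      by (rule has_field_derivative_transform_within_open[of _ _ _ "{..<0}"]) (use 2 in \<open>auto simp: soft_pos_poly_def\<close>)
  next
    case 3
    have "((\<lambda>h. (soft_pos_poly \<delta> p (0 + h) - soft_pos_poly \<delta> p 0) / h) \<longlongrightarrow> 0) (at 0)"
    proof (rule filterlim_split_at)
      show "((\<lambda>h. (soft_pos_poly \<delta> p (0 + h) - soft_pos_poly \<delta> p 0) / h) \<longlongrightarrow> 0) (at_left 0)"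
        by (rule Lim_transform_eventually[OF tendsto_const])
          (auto simp: soft_pos_poly_def eventually_at_left_field intro: exI[of _ "-1"])
      have "((\<lambda>h. (1/h) ^ 0 * poly p (1/h) * exp (- \<delta> * (1/h))) \<longlongrightarrow> 0) (at_right 0)"
        using filterlim_compose[OF poly_times_exp_tendsto_0[OF \<delta>, of 0 p] filterlim_inverse_at_top_right]
        by (simp add: inverse_eq_divide)
      then show "((\<lambda>h. (soft_pos_poly \<delta> p (0 + h) - soft_pos_poly \<delta> p 0) / h) \<longlongrightarrow> 0) (at_right 0)"
        by (rule Lim_transform_eventually)
          (auto simp: soft_pos_poly_def eventually_at_right_field intro: exI[of _ "1"])
    qed
    then show ?thesis unfolding 3 DERIV_def by (simp add: soft_pos_poly_def)
  qed
qed

lemma smooth1_soft_pos: "\<delta> > 0 \<Longrightarrow> smooth1 (soft_pos \<delta>)"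
proof -
  assume \<delta>: "\<delta> > 0"
  define P where "P n = ((\<lambda>p. pCons 0 (p - pCons 0 (pderiv p) + smult \<delta> (pCons 0 p))) ^^ n) 1" for n
  have "soft_pos_poly \<delta> (P 0) = soft_pos \<delta>"
    by (auto simp: P_def soft_pos_def soft_pos_poly_def)
  moreover have "(soft_pos_poly \<delta> (P n) has_real_derivative soft_pos_poly \<delta> (P (Suc n)) t) (at t)" for n t
    using soft_pos_poly_deriv[OF \<delta>, of "P n" t] by (simp add: P_def)
  ultimately show ?thesis unfolding smooth1_def by (intro exI[of _ "\<lambda>n. soft_pos_poly \<delta> (P n)"]) auto
qed

definition soft_pos' :: "real \<Rightarrow> real \<Rightarrow> real" where
  "soft_pos' \<delta> t = (if t > 0 then (1 + \<delta> / t) * exp (- \<delta> / t) else 0)"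

lemma soft_pos_deriv: "\<delta> > 0 \<Longrightarrow> (soft_pos \<delta> has_real_derivative soft_pos' \<delta> t) (at t)"
proof -
  assume \<delta>: "\<delta> > 0"
  have "soft_pos_poly \<delta> 1 = soft_pos \<delta>"
    by (auto simp: soft_pos_def soft_pos_poly_def)
  moreover have "soft_pos_poly \<delta> (pCons 0 (1 - pCons 0 (pderiv 1) + smult \<delta> (pCons 0 1))) t = soft_pos' \<delta> t"
    by (auto simp: soft_pos'_def soft_pos_poly_def field_simps)
  ultimately show ?thesis using soft_pos_poly_deriv[OF \<delta>, of 1 t] by simp
qed

lemma soft_pos'_bounds:
  assumes "\<delta> > 0"
  shows "0 \<le> soft_pos' \<delta> t" "soft_pos' \<delta> t \<le> 1"
proof -
  show "0 \<le> soft_pos' \<delta> t" using assms by (simp add: soft_pos'_def)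
  have "(1 + \<delta> / t) * exp (- \<delta> / t) \<le> exp (\<delta> / t) * exp (- \<delta> / t)"
    by (intro mult_right_mono exp_ge_add_one_self) simp
  then show "soft_pos' \<delta> t \<le> 1" by (simp add: soft_pos'_def exp_add[symmetric])
qed

lemma soft_pos_nonneg: "0 \<le> soft_pos \<delta> t" 
  by (simp add: soft_pos_def)

lemma soft_pos_pos: "0 < soft_pos \<delta> t \<longleftrightarrow> 0 < t"
  by (simp add: soft_pos_def)

lemma soft_pos_ge: "\<delta> > 0 \<Longrightarrow> soft_pos \<delta> t \<ge> t - \<delta>"
proof (cases "t > 0")
  case True
  have le: "t * (1 + - \<delta> / t) \<le> t * exp (- \<delta> / t)"
    using True by (intro mult_left_mono exp_ge_add_one_self) simp
  have eq: "t * (1 + - \<delta> / t) = t - \<delta>" using True by (simp add: field_simps)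
  show ?thesis using le unfolding eq using True by (simp add: soft_pos_def)
qed (simp add: soft_pos_def)

section \<open>Sine-like test functions\<close>

text \<open>
  Smooth functions supported in \<open>(0, w)\<close> which approximate \<open>sin (\<pi> t / w)\<close> in the energy norm.
\<close>

definition sine_bump :: "real \<Rightarrow> real \<Rightarrow> real \<Rightarrow> real" where
  "sine_bump \<epsilon> w t = (if 0 < t \<and> t < w then soft_pos \<epsilon> (sin (pi * t / w) - \<epsilon>) else 0)"

definition sine_bump' :: "real \<Rightarrow> real \<Rightarrow> real \<Rightarrow> real" where
  "sine_bump' \<epsilon> w t = (if 0 < t \<and> t < w then soft_pos' \<epsilon> (sin (pi * t / w) - \<epsilon>) * (pi / w * cos (pi * t / w)) else 0)"

text \<open>An open set on which the bump vanishes identically. It contains the end points 0 and w,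
  because the sine is below \<epsilon> near them, and so covers the line together with (0, w).
  Differentiability, smoothness and support are checked on these two open sets.\<close>

definition bump_gap :: "real \<Rightarrow> real \<Rightarrow> real set" where
  "bump_gap \<epsilon> w = {..<0} \<union> {w<..} \<union> {t. sin (pi * t / w) < \<epsilon>}"

lemma open_bump_gap: "open (bump_gap \<epsilon> w)"
proof -
  have "open {t. sin (pi * t / w) < \<epsilon>}"
  proof (cases "w = 0")
    case False
    then show ?thesis by (intro open_Collect_less continuous_intros) auto
  qed (cases "\<epsilon> > 0", auto)
  then show ?thesis unfolding bump_gap_def by (intro open_Un open_lessThan open_greaterThan)
qed

lemma sine_bump_gap: "\<epsilon> > 0 \<Longrightarrow> t \<in> bump_gap \<epsilon> w \<Longrightarrow> sine_bump \<epsilon> w t = 0"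
  by (auto simp: bump_gap_def sine_bump_def soft_pos_def)

lemma bump_gap_cover: "\<epsilon> > 0 \<Longrightarrow> w > 0 \<Longrightarrow> t \<in> bump_gap \<epsilon> w \<or> 0 < t \<and> t < w"
  by (cases "t = 0"; cases "t = w") (auto simp: bump_gap_def)

lemma sine_bump_deriv:
  assumes \<epsilon>: "\<epsilon> > 0" and w: "w > 0"
  shows "(sine_bump \<epsilon> w has_real_derivative sine_bump' \<epsilon> w t) (at t)"
proof (cases "0 < t \<and> t < w")
  case True
  have "((\<lambda>t. sin (pi * t / w) - \<epsilon>) has_real_derivative pi / w * cos (pi * t / w)) (at t)"
    using w by (auto intro!: derivative_eq_intros)
  from DERIV_chain2[OF soft_pos_deriv[OF \<epsilon>] this]
  have "((\<lambda>t. soft_pos \<epsilon> (sin (pi * t / w) - \<epsilon>)) has_real_derivative sine_bump' \<epsilon> w t) (at t)"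
    using True by (simp add: sine_bump'_def)
  then show ?thesis
    by (rule has_field_derivative_transform_within_open[of _ _ _ "{0<..<w}"]) (use True in \<open>auto simp: sine_bump_def\<close>)
next
  case False
  then have t: "t \<in> bump_gap \<epsilon> w" using bump_gap_cover[OF \<epsilon> w, of t] by auto
  have "((\<lambda>t. 0) has_real_derivative sine_bump' \<epsilon> w t) (at t)"
    using False by (auto simp: sine_bump'_def)
  then show ?thesis
    by (rule has_field_derivative_transform_within_open[OF _ open_bump_gap t]) (simp add: sine_bump_gap[OF \<epsilon>])
qed

lemma smooth_continuous: "smooth f \<Longrightarrow> continuous_on S f"
  using has_grad_cont(1)[OF smooth_has_grad] .

lemma smooth_sine_bump:
  assumes \<epsilon>: "\<epsilon> > 0" and w: "w > 0" and \<xi>: "smooth \<xi>"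
  shows "smooth (\<lambda>p. sine_bump \<epsilon> w (\<xi> p))"
proof (rule smooth_local)
  fix p
  have opn: "open (\<xi> -` U)" if "open U" for U
    using that smooth_continuous[OF \<xi>, of UNIV] by (simp add: open_vimage)
  show "\<exists>U g. open U \<and> p \<in> U \<and> smooth g \<and> (\<forall>q\<in>U. sine_bump \<epsilon> w (\<xi> q) = g q)"
  proof (cases "0 < \<xi> p \<and> \<xi> p < w")
    case True
    have "smooth (\<lambda>p. (pi / w) * \<xi> p)"
      by (intro smooth_mult smooth_const \<xi>)
    then have "smooth (\<lambda>p. soft_pos \<epsilon> (sin ((pi / w) * \<xi> p) + - \<epsilon>))"
      by (intro smooth_compose[OF smooth1_soft_pos[OF \<epsilon>]] smooth_add smooth_const smooth_compose[OF smooth1_sin])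
    then show ?thesis
      using True opn[of "{0<..<w}"]
      by (intro exI[of _ "\<xi> -` {0<..<w}"] exI conjI) (auto simp: sine_bump_def)
  next
    case False
    then have "\<xi> p \<in> bump_gap \<epsilon> w" using bump_gap_cover[OF \<epsilon> w, of "\<xi> p"] by auto
    then show ?thesis
      using opn[OF open_bump_gap[of \<epsilon> w]] smooth_const[of 0]
      by (intro exI[of _ "\<xi> -` bump_gap \<epsilon> w"] exI[of _ "\<lambda>p. 0"]) (auto simp: sine_bump_gap[OF \<epsilon>])
  qed
qed

lemma not_in_closureI: "open U \<Longrightarrow> p \<in> U \<Longrightarrow> U \<inter> S = {} \<Longrightarrow> p \<notin> closure S"
  using open_Int_closure_eq_empty by blast

lemma sine_bump_support:
  assumes \<epsilon>: "\<epsilon> > 0" and w: "w > 0" and \<xi>: "smooth \<xi>" and p: "p \<in> closure {p. sine_bump \<epsilon> w (\<xi> p) \<noteq> 0}"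
  shows "0 < \<xi> p \<and> \<xi> p < w"
proof (rule ccontr)
  assume "\<not> ?thesis"
  then have "\<xi> p \<in> bump_gap \<epsilon> w" using bump_gap_cover[OF \<epsilon> w, of "\<xi> p"] by auto
  moreover have "open (\<xi> -` bump_gap \<epsilon> w)"
    using open_bump_gap smooth_continuous[OF \<xi>, of UNIV] by (simp add: open_vimage)
  ultimately show False
    using p not_in_closureI[of "\<xi> -` bump_gap \<epsilon> w" p "{p. sine_bump \<epsilon> w (\<xi> p) \<noteq> 0}"]
      sine_bump_gap[OF \<epsilon>] by auto
qed

lemma sine_bump_cont: "\<epsilon> > 0 \<Longrightarrow> w > 0 \<Longrightarrow> continuous_on S (sine_bump \<epsilon> w)"
  by (meson sine_bump_deriv DERIV_continuous continuous_at_imp_continuous_on)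

text \<open>Obtained from the smoothness of the bump as a function of the first plane coordinate,
  whose partial derivative is continuous.\<close>

lemma sine_bump'_cont:
  assumes \<epsilon>: "\<epsilon> > 0" and w: "w > 0"
  shows "continuous_on S (sine_bump' \<epsilon> w)"
proof -
  note g = smooth_has_grad[OF smooth_sine_bump[OF \<epsilon> w smooth_fst]]
  have "sine_bump' \<epsilon> w t = fst (grad (\<lambda>p. sine_bump \<epsilon> w (fst p)) (t, 0))" for t
    using DERIV_unique[OF sine_bump_deriv[OF \<epsilon> w, of t]] has_grad_slice(1)[OF g, of 0 t] by simp
  then show ?thesis
    using continuous_slice(1)[OF has_grad_cont(2)[OF g], of S 0] by (simp cong: continuous_on_cong)
qed

lemma sine_bump_at_mid: "0 < \<epsilon> \<Longrightarrow> \<epsilon> < 1 \<Longrightarrow> w > 0 \<Longrightarrow> sine_bump \<epsilon> w (w / 2) > 0"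
  by (simp add: sine_bump_def soft_pos_pos)

lemma integral_sin_cos_sq:
  assumes w: "w > 0"
  shows "((\<lambda>t. (sin (pi * t / w))\<^sup>2) has_integral w / 2) {0..w}"
    and "((\<lambda>t. (cos (pi * t / w))\<^sup>2) has_integral w / 2) {0..w}"
proof -
  define F where "F t = t / 2 - w / (2 * pi) * (sin (pi * t / w) * cos (pi * t / w))" for t
  have "((\<lambda>t. (sin (pi * t / w))\<^sup>2) has_integral F w - F 0) {0..w}"
  proof (rule fundamental_theorem_of_calculus)
    fix t
    let ?c = "cos (pi * t / w)" and ?s = "sin (pi * t / w)"
    have eq: "1 / 2 - w / (2 * pi) * (pi / w * c * c + - (pi / w * s) * s) = 1 / 2 - (c\<^sup>2 - s\<^sup>2) / 2" for c s :: real
    proof -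
      have h: "w / (2 * pi) * (pi / w) = 1 / 2" using w by simp
      have "w / (2 * pi) * (pi / w * c * c + - (pi / w * s) * s) = (w / (2 * pi) * (pi / w)) * (c\<^sup>2 - s\<^sup>2)"
        by (simp add: power2_eq_square right_diff_distrib mult.assoc)
      then show ?thesis unfolding h by simp
    qed
    have ds: "((\<lambda>t. sin (pi * t / w)) has_real_derivative pi / w * ?c) (at t within {0..w})"
      and dc: "((\<lambda>t. cos (pi * t / w)) has_real_derivative - (pi / w * ?s)) (at t within {0..w})"
      using w by (auto intro!: derivative_eq_intros)
    have "(F has_real_derivative 1 / 2 - w / (2 * pi) * (pi / w * ?c * ?c + - (pi / w * ?s) * ?s)) (at t within {0..w})"
      unfolding F_def by (intro DERIV_diff DERIV_cmult DERIV_mult DERIV_cdivide DERIV_ident ds dc)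
    then have "(F has_real_derivative ?s\<^sup>2) (at t within {0..w})"
      unfolding eq by (simp add: cos_squared_eq diff_divide_distrib)
    then show "(F has_vector_derivative (sin (pi * t / w))\<^sup>2) (at t within {0..w})"
      by (simp add: has_real_derivative_iff_has_vector_derivative)
  qed (use w in simp)
  then show 1: "((\<lambda>t. (sin (pi * t / w))\<^sup>2) has_integral w / 2) {0..w}"
    using w by (simp add: F_def)
  have "((\<lambda>t. 1 - (sin (pi * t / w))\<^sup>2) has_integral w - w / 2) {0..w}"
    using w has_integral_const_real[of "1::real" 0 w] by (intro has_integral_diff 1) auto
  then show "((\<lambda>t. (cos (pi * t / w))\<^sup>2) has_integral w / 2) {0..w}"
    by (simp add: cos_squared_eq)
qed

text \<open>The truncation has slope at most 1, so the derivative is dominated by that of the sine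
  itself.\<close>

lemma integral_sine_bump'_sq:
  assumes \<epsilon>: "\<epsilon> > 0" and w: "w > 0"
  shows "integral {0..w} (\<lambda>t. (sine_bump' \<epsilon> w t)\<^sup>2) \<le> pi\<^sup>2 / (2 * w)"
proof -
  have 1: "((\<lambda>t. (pi / w)\<^sup>2 * (cos (pi * t / w))\<^sup>2) has_integral (pi / w)\<^sup>2 * (w / 2)) {0..w}"
    by (intro has_integral_mult_right integral_sin_cos_sq w)
  have 2: "((\<lambda>t. (sine_bump' \<epsilon> w t)\<^sup>2) has_integral integral {0..w} (\<lambda>t. (sine_bump' \<epsilon> w t)\<^sup>2)) {0..w}"
    by (intro integrable_integral integrable_continuous_interval continuous_intros sine_bump'_cont \<epsilon> w)
  have "integral {0..w} (\<lambda>t. (sine_bump' \<epsilon> w t)\<^sup>2) \<le> (pi / w)\<^sup>2 * (w / 2)"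
  proof (rule has_integral_le[OF 2 1])
    fix t
    have "(soft_pos' \<epsilon> s)\<^sup>2 \<le> 1" for s
      using power_mono[OF soft_pos'_bounds(2,1)[OF \<epsilon>], of s 2] by simp
    from mult_right_mono[OF this, of "(pi / w * cos (pi * t / w))\<^sup>2"]
    show "(sine_bump' \<epsilon> w t)\<^sup>2 \<le> (pi / w)\<^sup>2 * (cos (pi * t / w))\<^sup>2"
      by (auto simp: sine_bump'_def power_mult_distrib power_divide)
  qed
  then show ?thesis using w by (simp add: power2_eq_square field_simps)
qed

text \<open>Relative to the mass w/2 of the sine, the loss is the factor 1 - 8 \<epsilon>, later
  removed by \<open>le_of_le_scaled\<close>.\<close>

lemma integral_sine_bump_sq:
  assumes \<epsilon>: "\<epsilon> > 0" and w: "w > 0"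
  shows "w / 2 - 4 * \<epsilon> * w \<le> integral {0..w} (\<lambda>t. (sine_bump \<epsilon> w t)\<^sup>2)"
proof -
  have "((\<lambda>t. (sin (pi * t / w))\<^sup>2 - 4 * \<epsilon>) has_integral w / 2 - 4 * \<epsilon> * w) {0..w}"
    using w has_integral_const_real[of "4 * \<epsilon>" 0 w] by (intro has_integral_diff integral_sin_cos_sq w) (simp add: mult.commute)
  moreover have "((\<lambda>t. (sine_bump \<epsilon> w t)\<^sup>2) has_integral integral {0..w} (\<lambda>t. (sine_bump \<epsilon> w t)\<^sup>2)) {0..w}"
    by (intro integrable_integral integrable_continuous_interval continuous_intros sine_bump_cont \<epsilon> w)
  ultimately show ?thesis
  proof (rule has_integral_le)
    fix t assume t: "t \<in> {0..w}"
    let ?s = "sin (pi * t / w)"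
    have s0: "?s \<ge> 0" using t w by (intro sin_ge_zero) (auto simp: field_simps)
    \<comment> \<open>One \<epsilon> is lost by the shift inside the truncation, another by
      \<open>soft_pos_ge\<close>.\<close>
    have le: "?s - 2 * \<epsilon> \<le> sine_bump \<epsilon> w t"
    proof (cases "0 < t \<and> t < w")
      case True
      then show ?thesis using soft_pos_ge[OF \<epsilon>, of "?s - \<epsilon>"] by (simp add: sine_bump_def)
    next
      case False
      then have "t = 0 \<or> t = w" using t by auto
      then show ?thesis using \<epsilon> w by (auto simp: sine_bump_def)
    qed
    have nn: "sine_bump \<epsilon> w t \<ge> 0" by (simp add: sine_bump_def soft_pos_nonneg)
    show "?s\<^sup>2 - 4 * \<epsilon> \<le> (sine_bump \<epsilon> w t)\<^sup>2"
    proof (cases "?s \<ge> 2 * \<epsilon>")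
      case True
      then have "(?s - 2 * \<epsilon>)\<^sup>2 \<le> (sine_bump \<epsilon> w t)\<^sup>2" using le by (intro power_mono) auto
      moreover have "?s\<^sup>2 - 4 * \<epsilon> \<le> (?s - 2 * \<epsilon>)\<^sup>2"
      proof -
        have "?s * \<epsilon> \<le> 1 * \<epsilon>" using \<epsilon> by (intro mult_right_mono) auto
        moreover have "(?s - 2 * \<epsilon>)\<^sup>2 = ?s\<^sup>2 - 4 * (?s * \<epsilon>) + 4 * \<epsilon>\<^sup>2"
          by (simp add: power2_eq_square algebra_simps)
        ultimately show ?thesis using zero_le_power2[of \<epsilon>] by linarith
      qed
      ultimately show ?thesis by linarith
    next
      case False
      have "?s\<^sup>2 \<le> ?s" using s0 by (simp add: power2_eq_square mult_left_le)
      then show ?thesis using False \<epsilon> zero_le_power2[of "sine_bump \<epsilon> w t"] by linarith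
    qed
  qed
qed

section \<open>Periodic bumps\<close>

definition periodic_bump :: "real \<Rightarrow> real \<Rightarrow> real \<Rightarrow> real \<Rightarrow> real" where
  "periodic_bump \<epsilon> w L t = sine_bump \<epsilon> w (L * frac (t / L))"

lemma periodic_bump_periodic: "L > 0 \<Longrightarrow> periodic_bump \<epsilon> w L (t + of_int m * L) = periodic_bump \<epsilon> w L t"
  by (simp add: periodic_bump_def add_divide_distrib frac_def)

lemma periodic_bump_base:
  assumes "L > 0" "of_int n * L \<le> s" "s < (of_int n + 1) * L"
  shows "periodic_bump \<epsilon> w L s = sine_bump \<epsilon> w (s - of_int n * L)"
proof -
  have "\<lfloor>s / L\<rfloor> = n" using assms by (intro floor_unique) (auto simp: field_simps)
  then show ?thesis using assms by (simp add: periodic_bump_def frac_def right_diff_distrib mult.commute)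
qed

text \<open>Around a seam n L the periodic bump is a sum of two translates of the original one, of
  which at most one is nonzero at each point. Smoothness and support across the seam are thus
  inherited, even for w = L.\<close>

lemma periodic_bump_local:
  assumes "L > 0" "w \<le> L" "(of_int n - 1) * L < s" "s < (of_int n + 1) * L"
  shows "periodic_bump \<epsilon> w L s = sine_bump \<epsilon> w (s + - of_int n * L) + sine_bump \<epsilon> w (s + - (of_int n - 1) * L)"
proof (cases "of_int n * L \<le> s")
  case True
  moreover have "s + - (of_int n - 1) * L \<ge> w" using True assms by (simp add: algebra_simps)
  then have "sine_bump \<epsilon> w (s + - (of_int n - 1) * L) = 0" by (simp add: sine_bump_def)
  ultimately show ?thesis using periodic_bump_base[OF assms(1) True assms(4)] by simp
next
  case False
  then have "sine_bump \<epsilon> w (s + - of_int n * L) = 0" by (simp add: sine_bump_def)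
  moreover have "periodic_bump \<epsilon> w L s = sine_bump \<epsilon> w (s - of_int (n - 1) * L)"
    using False assms by (intro periodic_bump_base) (auto simp: algebra_simps)
  ultimately show ?thesis by (simp add: algebra_simps)
qed

lemma
  assumes \<epsilon>: "\<epsilon> > 0" and w: "w > 0" "w \<le> L" and \<xi>: "smooth \<xi>"
  shows smooth_periodic_bump: "smooth (\<lambda>p. periodic_bump \<epsilon> w L (\<xi> p))"
    and periodic_bump_support:
      "p \<in> closure {p. periodic_bump \<epsilon> w L (\<xi> p) \<noteq> 0} \<Longrightarrow> \<exists>m::int. 0 < \<xi> p - of_int m * L \<and> \<xi> p - of_int m * L < w"
proof -
  have L: "L > 0" using w by simp
  define U where "U n = \<xi> -` {(of_int n - 1) * L <..< (of_int n + 1) * L}" for n :: int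
  have U: "open (U n)" for n
    unfolding U_def using smooth_continuous[OF \<xi>, of UNIV] by (simp add: open_vimage)
  have pU: "p \<in> U \<lfloor>\<xi> p / L\<rfloor>" for p
  proof -
    have "of_int \<lfloor>\<xi> p / L\<rfloor> * L \<le> \<xi> p" "\<xi> p < (of_int \<lfloor>\<xi> p / L\<rfloor> + 1) * L"
      using L by (simp_all add: pos_le_divide_eq[symmetric] pos_divide_less_eq[symmetric])
    moreover have "(of_int \<lfloor>\<xi> p / L\<rfloor> - 1) * L < of_int \<lfloor>\<xi> p / L\<rfloor> * L" using L by (simp add: algebra_simps)
    ultimately show ?thesis unfolding U_def by auto
  qed
  have loc: "periodic_bump \<epsilon> w L (\<xi> q) = sine_bump \<epsilon> w (\<xi> q + - of_int n * L) + sine_bump \<epsilon> w (\<xi> q + - (of_int n - 1) * L)"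
    if "q \<in> U n" for q n
    by (rule periodic_bump_local[OF L w(2)]) (use that in \<open>auto simp: U_def\<close>)
  have sm: "smooth (\<lambda>q. \<xi> q + c)" for c by (intro smooth_add \<xi> smooth_const)
  show "smooth (\<lambda>p. periodic_bump \<epsilon> w L (\<xi> p))"
  proof (rule smooth_local)
    fix p
    let ?n = "\<lfloor>\<xi> p / L\<rfloor>"
    have "smooth (\<lambda>q. sine_bump \<epsilon> w (\<xi> q + - of_int ?n * L) + sine_bump \<epsilon> w (\<xi> q + - (of_int ?n - 1) * L))"
      by (intro smooth_add[OF smooth_sine_bump[OF \<epsilon> w(1) sm] smooth_sine_bump[OF \<epsilon> w(1) sm]])
    then show "\<exists>U g. open U \<and> p \<in> U \<and> smooth g \<and> (\<forall>q\<in>U. periodic_bump \<epsilon> w L (\<xi> q) = g q)"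
      using U[of ?n] pU[of p] loc[of _ ?n] by blast
  qed
  assume p: "p \<in> closure {p. periodic_bump \<epsilon> w L (\<xi> p) \<noteq> 0}"
  let ?n = "\<lfloor>\<xi> p / L\<rfloor>"
  let ?A = "closure {q. sine_bump \<epsilon> w (\<xi> q + - of_int ?n * L) \<noteq> 0}"
  let ?B = "closure {q. sine_bump \<epsilon> w (\<xi> q + - (of_int ?n - 1) * L) \<noteq> 0}"
  have "p \<in> ?A \<or> p \<in> ?B"
  proof (rule ccontr)
    assume n: "\<not> ?thesis"
    have "p \<notin> closure {p. periodic_bump \<epsilon> w L (\<xi> p) \<noteq> 0}"
    proof (rule not_in_closureI[of "U ?n \<inter> - ?A \<inter> - ?B"])
      show "U ?n \<inter> - ?A \<inter> - ?B \<inter> {p. periodic_bump \<epsilon> w L (\<xi> p) \<noteq> 0} = {}"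
      proof (rule equals0I)
        fix q assume q: "q \<in> U ?n \<inter> - ?A \<inter> - ?B \<inter> {p. periodic_bump \<epsilon> w L (\<xi> p) \<noteq> 0}"
        then have "sine_bump \<epsilon> w (\<xi> q + - of_int ?n * L) = 0" "sine_bump \<epsilon> w (\<xi> q + - (of_int ?n - 1) * L) = 0"
          using closure_subset[of "{q. sine_bump \<epsilon> w (\<xi> q + - of_int ?n * L) \<noteq> 0}"]
            closure_subset[of "{q. sine_bump \<epsilon> w (\<xi> q + - (of_int ?n - 1) * L) \<noteq> 0}"] by blast+
        then show False using loc[of q ?n] q by simp
      qed
    qed (use n U[of ?n] pU[of p] in \<open>auto intro!: open_Int\<close>)
    with p show False by simp
  qed
  then show "\<exists>m::int. 0 < \<xi> p - of_int m * L \<and> \<xi> p - of_int m * L < w"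
  proof
    assume "p \<in> ?A"
    from sine_bump_support[OF \<epsilon> w(1) sm this] show ?thesis by (intro exI[of _ ?n]) auto
  next
    assume "p \<in> ?B"
    from sine_bump_support[OF \<epsilon> w(1) sm this] show ?thesis by (intro exI[of _ "?n - 1"]) (auto simp: algebra_simps)
  qed
qed

section \<open>Compactness for plane domains\<close>

text \<open>Half-open rectangles tile the plane without overlap and suit Lebesgue integrals; closed
  ones suit the iterated integrals above. They differ by a null set.\<close>

lemma rect_lebesgue:
  fixes F :: "plane \<Rightarrow> real"
  assumes F: "continuous_on UNIV F"
  shows "integrable lborel (\<lambda>p. indicator ({a..<b} \<times> {c..<d}) p * F p)"
    and "(\<integral>p. indicator ({a..<b} \<times> {c..<d}) p * F p \<partial>lborel) = integral (cbox (a, c) (b, d)) F"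
proof -
  let ?Q = "{a..<b} \<times> {c..<d}" and ?R = "cbox (a, c) (b, d)"
  have [measurable]: "F \<in> borel_measurable borel" by (rule borel_measurable_continuous_onI[OF F])
  have [measurable]: "?Q \<in> sets borel" by (intro borel_Times) auto
  have sub: "box (a, c) (b, d) \<subseteq> ?Q" "?Q \<subseteq> ?R"
    by (auto simp: box_def cbox_Pair_eq Basis_prod_def ball_Un)
  have int: "set_integrable lborel ?R F"
    unfolding set_integrable_def
    by (intro borel_integrable_compact compact_cbox continuous_on_subset[OF F]) auto
  have "?R - box (a, c) (b, d) \<in> null_sets lborel"
    using negligible_frontier_interval[of "(a, c)" "(b, d)"]
    by (simp add: negligible_iff_null_sets null_sets_completion_iff)
  from AE_not_in[OF this] have ae: "AE p in lborel. indicator ?R p * F p = indicator ?Q p * F p"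
    by eventually_elim (use sub in \<open>auto simp: indicator_def\<close>)
  have "integrable lborel (\<lambda>p. indicator ?R p * F p)"
    using int by (simp add: set_integrable_def)
  then show "integrable lborel (\<lambda>p. indicator ?Q p * F p)"
    by (subst integrable_cong_AE[OF _ _ ae, symmetric]) measurable
  have "(\<integral>p. indicator ?Q p * F p \<partial>lborel) = (\<integral>p. indicator ?R p * F p \<partial>lborel)"
    by (rule integral_cong_AE[OF _ _ AE_symmetric[OF ae]]) measurable
  also have "\<dots> = integral ?R F"
    using set_borel_integral_eq_integral(2)[OF int] by (simp add: set_lebesgue_integral_def)
  finally show "(\<integral>p. indicator ?Q p * F p \<partial>lborel) = integral ?R F" .
qed

definition grid_cell :: "real \<Rightarrow> real \<Rightarrow> int \<times> int \<Rightarrow> plane set" where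
  "grid_cell h\<^sub>1 h\<^sub>2 z = {of_int (fst z) * h\<^sub>1..<(of_int (fst z) + 1) * h\<^sub>1} \<times> {of_int (snd z) * h\<^sub>2..<(of_int (snd z) + 1) * h\<^sub>2}"

lemma cell_floor: "h > 0 \<Longrightarrow> x \<in> {of_int i * h..<(of_int i + 1) * h} \<longleftrightarrow> \<lfloor>x / h\<rfloor> = (i::int)"
  for x h :: real
  by (auto simp: floor_eq_iff field_simps)

lemma cells_floor: "h > 0 \<Longrightarrow> x \<in> {of_int m * h..<of_int n * h} \<longleftrightarrow> \<lfloor>x / h\<rfloor> \<in> {m..<n}"
  for x h :: real
  by (auto simp: le_floor_iff floor_less_iff field_simps)

lemma grid_cell_iff:
  "h\<^sub>1 > 0 \<Longrightarrow> h\<^sub>2 > 0 \<Longrightarrow> p \<in> grid_cell h\<^sub>1 h\<^sub>2 z \<longleftrightarrow> (\<lfloor>fst p / h\<^sub>1\<rfloor>, \<lfloor>snd p / h\<^sub>2\<rfloor>) = z"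
  unfolding grid_cell_def mem_Times_iff by (auto simp: cell_floor simp del: atLeastLessThan_iff)

lemma grid_split:
  assumes h: "h\<^sub>1 > 0" "h\<^sub>2 > 0" and F: "continuous_on UNIV (F :: plane \<Rightarrow> real)"
  shows "(\<integral>p. indicator ({of_int m * h\<^sub>1..<of_int n * h\<^sub>1} \<times> {of_int m * h\<^sub>2..<of_int n * h\<^sub>2}) p * F p \<partial>lborel)
    = (\<Sum>z\<in>{m..<n} \<times> {m..<n}. \<integral>p. indicator (grid_cell h\<^sub>1 h\<^sub>2 z) p * F p \<partial>lborel)"
proof -
  have "indicator ({of_int m * h\<^sub>1..<of_int n * h\<^sub>1} \<times> {of_int m * h\<^sub>2..<of_int n * h\<^sub>2}) p
     = (\<Sum>z\<in>{m..<n} \<times> {m..<n}. indicator (grid_cell h\<^sub>1 h\<^sub>2 z) p :: real)" for p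
  proof -
    have "(\<Sum>z\<in>{m..<n} \<times> {m..<n}. indicator (grid_cell h\<^sub>1 h\<^sub>2 z) p :: real)
       = (\<Sum>z\<in>{m..<n} \<times> {m..<n}. if (\<lfloor>fst p / h\<^sub>1\<rfloor>, \<lfloor>snd p / h\<^sub>2\<rfloor>) = z then 1 else 0)"
      using h by (intro sum.cong) (auto simp: indicator_def grid_cell_iff)
    also have "\<dots> = (if (\<lfloor>fst p / h\<^sub>1\<rfloor>, \<lfloor>snd p / h\<^sub>2\<rfloor>) \<in> {m..<n} \<times> {m..<n} then 1 else 0)"
      by (subst sum.delta') auto
    also have "\<dots> = indicator ({of_int m * h\<^sub>1..<of_int n * h\<^sub>1} \<times> {of_int m * h\<^sub>2..<of_int n * h\<^sub>2}) p"
      unfolding indicator_def mem_Times_iff cells_floor[OF h(1)] cells_floor[OF h(2)] by simp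
    finally show ?thesis by simp
  qed
  then have "(\<integral>p. indicator ({of_int m * h\<^sub>1..<of_int n * h\<^sub>1} \<times> {of_int m * h\<^sub>2..<of_int n * h\<^sub>2}) p * F p \<partial>lborel)
    = (\<integral>p. (\<Sum>z\<in>{m..<n} \<times> {m..<n}. indicator (grid_cell h\<^sub>1 h\<^sub>2 z) p * F p) \<partial>lborel)"
    by (simp add: sum_distrib_right)
  also have "\<dots> = (\<Sum>z\<in>{m..<n} \<times> {m..<n}. \<integral>p. indicator (grid_cell h\<^sub>1 h\<^sub>2 z) p * F p \<partial>lborel)"
    by (intro Bochner_Integration.integral_sum) (auto simp: grid_cell_def intro!: rect_lebesgue F)
  finally show ?thesis .
qed

lemma norm_plane_sq: "(norm (v :: plane))\<^sup>2 = (fst v)\<^sup>2 + (snd v)\<^sup>2"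
  by (simp add: norm_prod_def)

lemma Poincare_cell:
  assumes h: "0 < h\<^sub>1" "h\<^sub>1 \<le> h" "0 < h\<^sub>2" "h\<^sub>2 \<le> h" and \<phi>: "smooth \<phi>"
  shows "(\<integral>p. indicator (grid_cell h\<^sub>1 h\<^sub>2 z) p * (\<phi> p)\<^sup>2 \<partial>lborel)
    \<le> h\<^sup>2 * (\<integral>p. indicator (grid_cell h\<^sub>1 h\<^sub>2 z) p * (norm (grad \<phi> p))\<^sup>2 \<partial>lborel)
      + (\<integral>p. indicator (grid_cell h\<^sub>1 h\<^sub>2 z) p * \<phi> p \<partial>lborel)\<^sup>2 / (h\<^sub>1 * h\<^sub>2)"
proof -
  note g = smooth_has_grad[OF \<phi>]
  note cf = has_grad_cont[OF g]
  have c2: "continuous_on UNIV (\<lambda>p. (\<phi> p)\<^sup>2)" "continuous_on UNIV (\<lambda>p. (fst (grad \<phi> p))\<^sup>2)"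
    "continuous_on UNIV (\<lambda>p. (snd (grad \<phi> p))\<^sup>2)" "continuous_on UNIV (\<lambda>p. (norm (grad \<phi> p))\<^sup>2)"
    unfolding norm_plane_sq by (intro continuous_intros cf)+
  define a where "a = of_int (fst z) * h\<^sub>1"
  define c where "c = of_int (snd z) * h\<^sub>2"
  have cell: "grid_cell h\<^sub>1 h\<^sub>2 z = {a..<a + h\<^sub>1} \<times> {c..<c + h\<^sub>2}"
    by (simp add: grid_cell_def a_def c_def distrib_right)
  let ?R = "cbox (a, c) (a + h\<^sub>1, c + h\<^sub>2)"
  have "integral ?R (\<lambda>p. (\<phi> p)\<^sup>2) \<le> h\<^sub>1\<^sup>2 * integral ?R (\<lambda>p. (fst (grad \<phi> p))\<^sup>2)
      + h\<^sub>2\<^sup>2 * integral ?R (\<lambda>p. (snd (grad \<phi> p))\<^sup>2) + (integral ?R \<phi>)\<^sup>2 / (h\<^sub>1 * h\<^sub>2)"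
    using Poincare_rect[OF _ _ g, of a "a + h\<^sub>1" c "c + h\<^sub>2"] h by simp
  also have "h\<^sub>1\<^sup>2 * integral ?R (\<lambda>p. (fst (grad \<phi> p))\<^sup>2) \<le> h\<^sup>2 * integral ?R (\<lambda>p. (fst (grad \<phi> p))\<^sup>2)"
    using h by (intro mult_right_mono power_mono integral_nonneg integrable_on_rect c2) auto
  also have "h\<^sub>2\<^sup>2 * integral ?R (\<lambda>p. (snd (grad \<phi> p))\<^sup>2) \<le> h\<^sup>2 * integral ?R (\<lambda>p. (snd (grad \<phi> p))\<^sup>2)"
    using h by (intro mult_right_mono power_mono integral_nonneg integrable_on_rect c2) auto
  also have "h\<^sup>2 * integral ?R (\<lambda>p. (fst (grad \<phi> p))\<^sup>2) + h\<^sup>2 * integral ?R (\<lambda>p. (snd (grad \<phi> p))\<^sup>2)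
     = h\<^sup>2 * integral ?R (\<lambda>p. (norm (grad \<phi> p))\<^sup>2)"
    unfolding norm_plane_sq distrib_left[symmetric]
    by (subst integral_add) (auto intro: integrable_on_rect c2)
  finally show ?thesis
    unfolding cell rect_lebesgue(2)[OF c2(1)] rect_lebesgue(2)[OF c2(4)] rect_lebesgue(2)[OF cf(1)]
    by simp
qed

lemma integral_pos_of_continuous:
  fixes \<phi> :: "plane \<Rightarrow> real"
  assumes c: "continuous_on UNIV \<phi>" and S: "open S" "S \<subseteq> A" "p \<in> S" "\<phi> p \<noteq> 0" and A: "A \<in> sets borel"
    and int: "integrable lborel (\<lambda>p. indicator A p * (\<phi> p)\<^sup>2)"
  shows "(\<integral>p. indicator A p * (\<phi> p)\<^sup>2 \<partial>lborel) > 0"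
proof -
  let ?U = "S \<inter> {p. \<phi> p \<noteq> 0}"
  have U: "open ?U" using S(1) c by (intro open_Int open_Collect_neq) auto
  have "(\<integral>p. indicator A p * (\<phi> p)\<^sup>2 \<partial>lborel) \<noteq> 0"
  proof
    assume "(\<integral>p. indicator A p * (\<phi> p)\<^sup>2 \<partial>lborel) = 0"
    then have "AE p in lborel. indicator A p * (\<phi> p)\<^sup>2 = 0"
      using integral_nonneg_eq_0_iff_AE[OF int] by simp
    then have "AE p in lborel. p \<notin> ?U"
      by eventually_elim (use S in \<open>auto simp: indicator_def\<close>)
    then have "?U \<in> null_sets lborel"
      using U by (subst (asm) AE_iff_null_sets[symmetric]) auto
    then have "negligible ?U"
      using negligible_iff_null_sets null_sets_completionI by blast
    then show False using open_not_negligible[OF U] S by auto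
  qed
  moreover have "(\<integral>p. indicator A p * (\<phi> p)\<^sup>2 \<partial>lborel) \<ge> 0" by simp
  ultimately show ?thesis by linarith
qed

lemma zero_outside: "p \<notin> closure {p. \<phi> p \<noteq> 0} \<Longrightarrow> \<phi> p = 0"
  using subsetD[OF closure_subset, of p "{p. \<phi> p \<noteq> 0}"] by blast

lemma smooth_GDERIV: "smooth \<phi> \<Longrightarrow> GDERIV \<phi> p :> grad \<phi> p"
  using smooth_has_grad[of \<phi>] unfolding has_grad_def prod.collapse by blast

lemma grad_zero_outside:
  assumes "p \<notin> closure {p. \<phi> p \<noteq> 0}"
  shows "grad \<phi> p = 0"
proof (rule grad_eq)
  have "((\<lambda>p. 0) has_derivative (\<lambda>h. h \<bullet> 0)) (at p)" by simp
  then show "GDERIV \<phi> p :> 0"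
    unfolding gderiv_def
  proof (rule has_derivative_transform_within_open)
    show "open (- closure {p. \<phi> p \<noteq> 0})" "p \<in> - closure {p. \<phi> p \<noteq> 0}" using assms by auto
    show "0 = \<phi> q" if "q \<in> - closure {p. \<phi> p \<noteq> 0}" for q
      using zero_outside[of q \<phi>] that by simp
  qed
qed

lemma smooth_grad_add:
  assumes "smooth \<phi>" "smooth \<psi>"
  shows "grad (\<lambda>p. \<phi> p + c * \<psi> p) p = grad \<phi> p + c *\<^sub>R grad \<psi> p"
proof (rule grad_eq)
  note smooth_GDERIV[OF assms(1), of p] smooth_GDERIV[OF assms(2), of p]
  then show "GDERIV (\<lambda>p. \<phi> p + c * \<psi> p) p :> grad \<phi> p + c *\<^sub>R grad \<psi> p"
    unfolding gderiv_def by (auto intro!: derivative_eq_intros simp: inner_add_right)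
qed

lemma smooth_grad_cont: "smooth \<phi> \<Longrightarrow> continuous_on S (grad \<phi>)"
  using continuous_on_Pair[OF has_grad_cont(2)[OF smooth_has_grad[of \<phi>]] has_grad_cont(3)[OF smooth_has_grad[of \<phi>]]]
  by simp

lemma support_add: "closure {p. \<phi> p + c * \<psi> p \<noteq> (0::real)} \<subseteq> closure {p. \<phi> p \<noteq> 0} \<union> closure {p. \<psi> p \<noteq> 0}"
  unfolding closure_Un[symmetric] by (rule closure_mono) auto

lemma
  assumes "smooth \<phi>" "compact (closure {p. \<phi> p \<noteq> 0})"
  shows compact_support_sq: "sq_int lborel \<phi>" and compact_support_grad_sq: "sq_int lborel (grad \<phi>)"
proof -
  let ?K = "closure {p. \<phi> p \<noteq> 0}"
  note c = smooth_continuous[OF assms(1)] smooth_grad_cont[OF assms(1)]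
  have "integrable lborel (\<lambda>p. indicator ?K p *\<^sub>R (norm (\<phi> p))\<^sup>2)"
    by (intro borel_integrable_compact assms continuous_intros c)
  also have "(\<lambda>p. indicator ?K p *\<^sub>R (norm (\<phi> p))\<^sup>2) = (\<lambda>p. (norm (\<phi> p))\<^sup>2)"
    by (auto simp: indicator_def fun_eq_iff intro: zero_outside)
  finally show "sq_int lborel \<phi>"
    unfolding sq_int_def using borel_measurable_continuous_onI[OF c(1)] by simp
  have "integrable lborel (\<lambda>p. indicator ?K p *\<^sub>R (norm (grad \<phi> p))\<^sup>2)"
    by (intro borel_integrable_compact assms continuous_intros c)
  also have "(\<lambda>p. indicator ?K p *\<^sub>R (norm (grad \<phi> p))\<^sup>2) = (\<lambda>p. (norm (grad \<phi> p))\<^sup>2)"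
    by (auto simp: indicator_def fun_eq_iff grad_zero_outside)
  finally show "sq_int lborel (grad \<phi>)"
    unfolding sq_int_def using borel_measurable_continuous_onI[OF c(2)] by simp
qed

text \<open>
  On the squares of a fine grid which the set fills by less than half, the Poincare inequality
  needs no mean value term, and only finitely many squares are left.
\<close>

lemma plane_test_compactness:
  assumes \<Omega>: "open \<Omega>" "emeasure lborel \<Omega> < \<infinity>" and \<epsilon>: "\<epsilon> > 0"
  shows "\<exists>F C. finite F \<and> (\<forall>A\<in>F. A \<in> sets lborel \<and> emeasure lborel A < \<infinity>) \<and> 0 \<le> C \<and>
    (\<forall>\<phi>\<in>plane_test \<Omega>. (\<integral>p. (\<phi> p)\<^sup>2 \<partial>lborel) \<le> \<epsilon> * (\<integral>p. (norm (grad \<phi> p))\<^sup>2 \<partial>lborel)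
      + C * (\<Sum>A\<in>F. (\<integral>p. indicator A p * \<phi> p \<partial>lborel)\<^sup>2))"
proof -
  \<comment> \<open>Chosen so that the constant 2 h^2 obtained on the cells filled at most halfway
    is exactly \<epsilon>.\<close>
  define h where "h = sqrt (\<epsilon> / 2)"
  have h: "h > 0" "2 * h\<^sup>2 = \<epsilon>" using \<epsilon> by (auto simp: h_def)
  define Q where "Q = grid_cell h h"
  \<comment> \<open>The cells of which \<Omega> occupies more than half. They are disjoint and each
    takes more than h^2/2 of the finite area of \<Omega>, so there are only finitely many.\<close>
  define X where "X = {z. measure lborel (\<Omega> \<inter> Q z) > h\<^sup>2 / 2}"
  have [measurable]: "Q z \<in> sets borel" for z by (auto simp: Q_def grid_cell_def intro!: borel_Times)
  have [measurable]: "\<Omega> \<in> sets borel" using \<Omega> by auto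
  have fin: "emeasure lborel (\<Omega> \<inter> Q z) < \<infinity>" for z
    by (rule le_less_trans[OF emeasure_mono \<Omega>(2)]) auto
  have Qdisj: "Q z \<inter> Q z' = {}" if "z \<noteq> z'" for z z'
    using that h by (auto simp: Q_def grid_cell_iff)
  have Qfin: "emeasure lborel (Q z) < \<infinity>" for z
  proof -
    have "bounded (Q z)" unfolding Q_def grid_cell_def by (intro bounded_Times) auto
    then show ?thesis by (rule emeasure_bounded_finite)
  qed
  have "finite X"
  proof (rule finite_if_finite_subsets_card_bdd[THEN conjunct1])
    fix Y assume Y: "Y \<subseteq> X" "finite Y"
    have "card Y * (h\<^sup>2 / 2) \<le> (\<Sum>z\<in>Y. measure lborel (\<Omega> \<inter> Q z))"
    proof -
      have "(\<Sum>z\<in>Y. h\<^sup>2 / 2) \<le> (\<Sum>z\<in>Y. measure lborel (\<Omega> \<inter> Q z))"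
        using Y(1) by (intro sum_mono) (auto simp: X_def)
      then show ?thesis by simp
    qed
    also have "\<dots> = measure lborel (\<Union>z\<in>Y. \<Omega> \<inter> Q z)"
    proof (rule measure_finite_Union[symmetric])
      show "disjoint_family_on (\<lambda>z. \<Omega> \<inter> Q z) Y"
        unfolding disjoint_family_on_def using Qdisj by blast
      show "emeasure lborel (\<Omega> \<inter> Q z) \<noteq> \<infinity>" for z using fin[of z] by simp
    qed (use Y in auto)
    also have "\<dots> \<le> measure lborel \<Omega>"
      using \<Omega>(2) Y by (intro measure_mono_fmeasurable fmeasurableI) auto
    finally have "card Y \<le> measure lborel \<Omega> / (h\<^sup>2 / 2)" using h by (simp add: field_simps)
    then show "card Y \<le> nat \<lceil>measure lborel \<Omega> / (h\<^sup>2 / 2)\<rceil>" by linarith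
  qed
  have inj: "inj_on Q X"
  proof (rule inj_onI)
    fix z z' assume "Q z = Q z'"
    moreover have "(of_int (fst z) * h, of_int (snd z) * h) \<in> Q z" using h by (simp add: Q_def grid_cell_iff)
    ultimately show "z = z'" using Qdisj[of z z'] by auto
  qed
  have main: "(\<integral>p. (\<phi> p)\<^sup>2 \<partial>lborel) \<le> \<epsilon> * (\<integral>p. (norm (grad \<phi> p))\<^sup>2 \<partial>lborel)
      + 1 / h\<^sup>2 * (\<Sum>A\<in>Q ` X. (\<integral>p. indicator A p * \<phi> p \<partial>lborel)\<^sup>2)" if \<phi>: "\<phi> \<in> plane_test \<Omega>" for \<phi>
  proof -
    have sm: "smooth \<phi>" and K: "compact (closure {p. \<phi> p \<noteq> 0})" "closure {p. \<phi> p \<noteq> 0} \<subseteq> \<Omega>"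
      using \<phi> by (auto simp: plane_test_def)
    note c = smooth_continuous[OF sm] smooth_grad_cont[OF sm]
    have c2: "continuous_on UNIV (\<lambda>p. (\<phi> p)\<^sup>2)" "continuous_on UNIV (\<lambda>p. (norm (grad \<phi> p))\<^sup>2)"
      by (intro continuous_intros c)+
    obtain B where B: "\<And>p. p \<in> closure {p. \<phi> p \<noteq> 0} \<Longrightarrow> norm p \<le> B"
      using compact_imp_bounded[OF K(1)] unfolding bounded_iff by blast
    obtain n :: nat where n: "B / h < real n" using reals_Archimedean2 by blast
    let ?I = "{- int n..<int n} \<times> {- int n..<int n}"
    let ?S = "{of_int (- int n) * h..<of_int (int n) * h} \<times> {of_int (- int n) * h..<of_int (int n) * h}"
    have sup: "p \<in> ?S" if "p \<in> closure {p. \<phi> p \<noteq> 0}" for p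
    proof -
      have "norm p < real n * h" using B[OF that] n h by (simp add: field_simps)
      moreover have "\<bar>fst p\<bar> \<le> norm p" "\<bar>snd p\<bar> \<le> norm p"
        using norm_fst_le[of "fst p" "snd p"] norm_snd_le[of "snd p" "fst p"] by auto
      ultimately show ?thesis by (auto simp: mem_Times_iff)
    qed
    have S1: "indicator ?S p * (\<phi> p)\<^sup>2 = (\<phi> p)\<^sup>2" for p
      using sup[of p] closure_subset[of "{p. \<phi> p \<noteq> 0}"] by (cases "\<phi> p = 0") (auto simp: indicator_def)
    have S2: "indicator ?S p * (norm (grad \<phi> p))\<^sup>2 = (norm (grad \<phi> p))\<^sup>2" for p
      using sup[of p] grad_zero_outside[of p \<phi>] by (cases "p \<in> closure {p. \<phi> p \<noteq> 0}") (auto simp: indicator_def)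
    have cell: "(\<integral>p. indicator (Q z) p * (\<phi> p)\<^sup>2 \<partial>lborel) \<le> 2 * h\<^sup>2 * (\<integral>p. indicator (Q z) p * (norm (grad \<phi> p))\<^sup>2 \<partial>lborel)
       + (if z \<in> X then 1 / h\<^sup>2 * (\<integral>p. indicator (Q z) p * \<phi> p \<partial>lborel)\<^sup>2 else 0)" for z
    proof -
      let ?N = "\<integral>p. indicator (Q z) p * (\<phi> p)\<^sup>2 \<partial>lborel"
      let ?E = "\<integral>p. indicator (Q z) p * (norm (grad \<phi> p))\<^sup>2 \<partial>lborel"
      let ?A = "\<integral>p. indicator (Q z) p * \<phi> p \<partial>lborel"
      have P: "?N \<le> h\<^sup>2 * ?E + 1 / h\<^sup>2 * ?A\<^sup>2"
        using Poincare_cell[OF h(1) order_refl h(1) order_refl sm, of z] by (simp add: Q_def power2_eq_square)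
      have E0: "h\<^sup>2 * ?E \<ge> 0" by simp
      show ?thesis
      proof (cases "z \<in> X")
        case True
        have "?N \<le> 2 * h\<^sup>2 * ?E + 1 / h\<^sup>2 * ?A\<^sup>2" using P E0 by linarith
        then show ?thesis using True by simp
      next
        case False
        have sq: "(norm (indicator A p :: real))\<^sup>2 = indicator A p" for A :: "plane set" and p
          by (auto simp: indicator_def)
        have "sq_int lborel (\<lambda>p. indicator (\<Omega> \<inter> Q z) p :: real)"
          unfolding sq_int_def sq using fin[of z] by (auto intro!: integrable_real_indicator)
        moreover have "sq_int lborel (\<lambda>p. indicator (Q z) p * \<phi> p)"
        proof -
          have eq: "(norm (indicator (Q z) p * \<phi> p))\<^sup>2 = indicator (Q z) p * (\<phi> p)\<^sup>2" for p
            by (auto simp: indicator_def)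
          have [measurable]: "\<phi> \<in> borel_measurable borel" by (rule borel_measurable_continuous_onI[OF c(1)])
          have "integrable lborel (\<lambda>p. indicator (Q z) p * (\<phi> p)\<^sup>2)"
            unfolding Q_def grid_cell_def by (rule rect_lebesgue(1)[OF c2(1)])
          then show ?thesis unfolding sq_int_def eq by simp
        qed
        \<comment> \<open>Since \<phi> lives on \<Omega>, its squared integral over the cell is at
          most the area of \<Omega> in the cell times the mass there. For a cell outside X this
          makes the mean value term at most half of the mass, and it is absorbed by the left-hand
          side.\<close>
        ultimately have CS: "(\<integral>p. indicator (\<Omega> \<inter> Q z) p \<bullet> (indicator (Q z) p * \<phi> p) \<partial>lborel)\<^sup>2
            \<le> (\<integral>p. (norm (indicator (\<Omega> \<inter> Q z) p :: real))\<^sup>2 \<partial>lborel) * (\<integral>p. (norm (indicator (Q z) p * \<phi> p))\<^sup>2 \<partial>lborel)"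
          by (rule sq_int_Cauchy_Schwarz)
        have e1: "indicator (\<Omega> \<inter> Q z) p \<bullet> (indicator (Q z) p * \<phi> p) = indicator (Q z) p * \<phi> p" for p
          using K(2) closure_subset[of "{p. \<phi> p \<noteq> 0}"] by (auto simp: indicator_def)
        have e2: "(norm (indicator (Q z) p * \<phi> p))\<^sup>2 = indicator (Q z) p * (\<phi> p)\<^sup>2" for p
          by (auto simp: indicator_def)
        have "?A\<^sup>2 \<le> measure lborel (\<Omega> \<inter> Q z) * ?N"
          using CS unfolding e1 e2 sq by simp
        also have "\<dots> \<le> h\<^sup>2 / 2 * ?N"
          using False by (intro mult_right_mono) (auto simp: X_def)
        finally have "1 / h\<^sup>2 * ?A\<^sup>2 \<le> ?N / 2" using h by (simp add: field_simps)
        then have "?N \<le> 2 * h\<^sup>2 * ?E" using P by linarith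
        then show ?thesis using False by simp
      qed
    qed
    have "(\<integral>p. (\<phi> p)\<^sup>2 \<partial>lborel) = (\<Sum>z\<in>?I. \<integral>p. indicator (Q z) p * (\<phi> p)\<^sup>2 \<partial>lborel)"
      using grid_split[OF h(1) h(1) c2(1), of "- int n" "int n"] unfolding S1 Q_def .
    also have "\<dots> \<le> (\<Sum>z\<in>?I. 2 * h\<^sup>2 * (\<integral>p. indicator (Q z) p * (norm (grad \<phi> p))\<^sup>2 \<partial>lborel)
       + (if z \<in> X then 1 / h\<^sup>2 * (\<integral>p. indicator (Q z) p * \<phi> p \<partial>lborel)\<^sup>2 else 0))"
      by (intro sum_mono cell)
    also have "\<dots> = 2 * h\<^sup>2 * (\<Sum>z\<in>?I. \<integral>p. indicator (Q z) p * (norm (grad \<phi> p))\<^sup>2 \<partial>lborel)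
       + (\<Sum>z\<in>?I \<inter> X. 1 / h\<^sup>2 * (\<integral>p. indicator (Q z) p * \<phi> p \<partial>lborel)\<^sup>2)"
      by (simp add: sum.distrib sum_distrib_left sum.inter_restrict cong: if_cong)
    also have "(\<Sum>z\<in>?I. \<integral>p. indicator (Q z) p * (norm (grad \<phi> p))\<^sup>2 \<partial>lborel) = (\<integral>p. (norm (grad \<phi> p))\<^sup>2 \<partial>lborel)"
      using grid_split[OF h(1) h(1) c2(2), of "- int n" "int n"] unfolding S2 Q_def by (rule sym)
    also have "(\<Sum>z\<in>?I \<inter> X. 1 / h\<^sup>2 * (\<integral>p. indicator (Q z) p * \<phi> p \<partial>lborel)\<^sup>2)
       \<le> (\<Sum>z\<in>X. 1 / h\<^sup>2 * (\<integral>p. indicator (Q z) p * \<phi> p \<partial>lborel)\<^sup>2)"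
      using \<open>finite X\<close> by (intro sum_mono2) auto
    also have "\<dots> = 1 / h\<^sup>2 * (\<Sum>A\<in>Q ` X. (\<integral>p. indicator A p * \<phi> p \<partial>lborel)\<^sup>2)"
      by (simp add: sum.reindex[OF inj] sum_distrib_left)
    finally show ?thesis unfolding h(2) by simp
  qed
  show ?thesis
    using main Qfin \<open>finite X\<close> by (intro exI[of _ "Q ` X"] exI[of _ "1 / h\<^sup>2"]) auto
qed

lemma plane_test_bump:
  assumes \<epsilon>: "0 < \<epsilon>" and w: "w\<^sub>1 > 0" "w\<^sub>2 > 0" and sub: "{x\<^sub>0<..<x\<^sub>0 + w\<^sub>1} \<times> {y\<^sub>0<..<y\<^sub>0 + w\<^sub>2} \<subseteq> \<Omega>"
  shows "(\<lambda>p. sine_bump \<epsilon> w\<^sub>1 (fst p + - x\<^sub>0) * sine_bump \<epsilon> w\<^sub>2 (snd p + - y\<^sub>0)) \<in> plane_test \<Omega>"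
proof -
  let ?\<phi> = "\<lambda>p. sine_bump \<epsilon> w\<^sub>1 (fst p + - x\<^sub>0) * sine_bump \<epsilon> w\<^sub>2 (snd p + - y\<^sub>0)"
  have sx: "smooth (\<lambda>p. fst p + - x\<^sub>0)" and sy: "smooth (\<lambda>p. snd p + - y\<^sub>0)"
    by (intro smooth_add smooth_const smooth_fst smooth_snd)+
  have sm: "smooth ?\<phi>"
    by (intro smooth_mult smooth_sine_bump[OF \<epsilon> w(1) sx] smooth_sine_bump[OF \<epsilon> w(2) sy])
  have cl: "closure {p. ?\<phi> p \<noteq> 0} \<subseteq> {x\<^sub>0<..<x\<^sub>0 + w\<^sub>1} \<times> {y\<^sub>0<..<y\<^sub>0 + w\<^sub>2}"
  proof
    fix p assume p: "p \<in> closure {p. ?\<phi> p \<noteq> 0}"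
    have "p \<in> closure {p. sine_bump \<epsilon> w\<^sub>1 (fst p + - x\<^sub>0) \<noteq> 0}"
      by (rule subsetD[OF closure_mono p]) auto
    note 1 = sine_bump_support[OF \<epsilon> w(1) sx this]
    have "p \<in> closure {p. sine_bump \<epsilon> w\<^sub>2 (snd p + - y\<^sub>0) \<noteq> 0}"
      by (rule subsetD[OF closure_mono p]) auto
    note 2 = sine_bump_support[OF \<epsilon> w(2) sy this]
    show "p \<in> {x\<^sub>0<..<x\<^sub>0 + w\<^sub>1} \<times> {y\<^sub>0<..<y\<^sub>0 + w\<^sub>2}"
      using 1 2 by (simp add: mem_Times_iff)
  qed
  have "bounded ({x\<^sub>0<..<x\<^sub>0 + w\<^sub>1} \<times> {y\<^sub>0<..<y\<^sub>0 + w\<^sub>2})"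
    by (intro bounded_Times) auto
  then have "compact (closure {p. ?\<phi> p \<noteq> 0})"
    using cl bounded_subset by (auto simp: compact_eq_bounded_closed)
  with sm cl sub show ?thesis unfolding plane_test_def by blast
qed

lemma open_contains_rect:
  assumes "open (\<Omega> :: plane set)" "p \<in> \<Omega>"
  obtains w where "w > 0" "{fst p - w / 2<..<fst p - w / 2 + w} \<times> {snd p - w / 2<..<snd p - w / 2 + w} \<subseteq> \<Omega>"
proof -
  obtain A B where AB: "open A" "open B" "p \<in> A \<times> B" "A \<times> B \<subseteq> \<Omega>"
    using open_prod_elim[OF assms] by blast
  obtain d where d: "d > 0" "ball (fst p) d \<subseteq> A" using AB by (auto simp: open_contains_ball)
  obtain e where e: "e > 0" "ball (snd p) e \<subseteq> B" using AB by (auto simp: open_contains_ball)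
  define w where "w = min d e"
  have "{fst p - w / 2<..<fst p - w / 2 + w} \<subseteq> ball (fst p) d"
    by (auto simp: w_def dist_real_def)
  moreover have "{snd p - w / 2<..<snd p - w / 2 + w} \<subseteq> ball (snd p) e"
    by (auto simp: w_def dist_real_def)
  ultimately have "{fst p - w / 2<..<fst p - w / 2 + w} \<times> {snd p - w / 2<..<snd p - w / 2 + w} \<subseteq> \<Omega>"
    using d e AB(4) by blast
  moreover have "w > 0" using d e by (simp add: w_def)
  ultimately show ?thesis using that by blast
qed

lemma plane_dirichlet_space:
  assumes \<Omega>: "open \<Omega>" "\<Omega> \<noteq> {}" "emeasure lborel \<Omega> < \<infinity>"
  shows "dirichlet_space lborel (plane_test \<Omega>)"
proof
  fix \<phi> \<psi> c assume \<phi>: "\<phi> \<in> plane_test \<Omega>" and \<psi>: "\<psi> \<in> plane_test \<Omega>"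
  then have s: "smooth \<phi>" "smooth \<psi>" by (auto simp: plane_test_def)
  have cU: "compact (closure {p. \<phi> p \<noteq> 0} \<union> closure {p. \<psi> p \<noteq> 0})"
    using \<phi> \<psi> by (intro compact_Un) (auto simp: plane_test_def)
  have "compact (closure {p. \<phi> p + c * \<psi> p \<noteq> 0})"
    using bounded_subset[OF compact_imp_bounded[OF cU] support_add] by (simp add: compact_eq_bounded_closed)
  moreover have "closure {p. \<phi> p + c * \<psi> p \<noteq> 0} \<subseteq> \<Omega>"
    using support_add[of \<phi> c \<psi>] \<phi> \<psi> by (auto simp: plane_test_def)
  moreover have "smooth (\<lambda>p. \<phi> p + c * \<psi> p)"
    by (intro smooth_add smooth_mult smooth_const s)
  ultimately show "(\<lambda>p. \<phi> p + c * \<psi> p) \<in> plane_test \<Omega>" by (simp add: plane_test_def)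
  show "grad (\<lambda>p. \<phi> p + c * \<psi> p) p = grad \<phi> p + c *\<^sub>R grad \<psi> p" for p
    by (rule smooth_grad_add[OF s])
next
  fix \<phi> assume "\<phi> \<in> plane_test \<Omega>"
  then show "sq_int lborel \<phi>" "sq_int lborel (grad \<phi>)"
    by (auto simp: plane_test_def intro: compact_support_sq compact_support_grad_sq)
next
  fix \<epsilon> :: real assume "\<epsilon> > 0"
  from plane_test_compactness[OF \<Omega>(1,3) this]
  show "\<exists>F C. finite F \<and> (\<forall>A\<in>F. A \<in> sets lborel \<and> emeasure lborel A < \<infinity>) \<and> 0 \<le> C \<and>
      (\<forall>\<phi>\<in>plane_test \<Omega>. (\<integral>p. (\<phi> p)\<^sup>2 \<partial>lborel) \<le> \<epsilon> * (\<integral>p. (norm (grad \<phi> p))\<^sup>2 \<partial>lborel)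
        + C * (\<Sum>A\<in>F. (\<integral>p. indicator A p * \<phi> p \<partial>lborel)\<^sup>2))" .
next
  obtain p where p: "p \<in> \<Omega>" using \<Omega> by blast
  obtain w where w: "w > 0" "{fst p - w / 2<..<fst p - w / 2 + w} \<times> {snd p - w / 2<..<snd p - w / 2 + w} \<subseteq> \<Omega>"
    by (rule open_contains_rect[OF \<Omega>(1) p])
  let ?\<phi> = "\<lambda>q. sine_bump (1/2) w (fst q + - (fst p - w / 2)) * sine_bump (1/2) w (snd q + - (snd p - w / 2))"
  have \<phi>: "?\<phi> \<in> plane_test \<Omega>" by (rule plane_test_bump) (use w in auto)
  then have sm: "smooth ?\<phi>" and K: "compact (closure {p. ?\<phi> p \<noteq> 0})" by (auto simp: plane_test_def)
  have "?\<phi> p \<noteq> 0" using sine_bump_at_mid[of "1/2" w] w(1) by simp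
  moreover have "integrable lborel (\<lambda>p. indicator UNIV p * (?\<phi> p)\<^sup>2)"
    using sq_int_integrable[OF compact_support_sq[OF sm K]] by simp
  ultimately have "(\<integral>p. indicator UNIV p * (?\<phi> p)\<^sup>2 \<partial>lborel) > 0"
    by (intro integral_pos_of_continuous[of _ UNIV UNIV p] smooth_continuous sm) auto
  then show "\<exists>\<phi>\<in>plane_test \<Omega>. (\<integral>p. (\<phi> p)\<^sup>2 \<partial>lborel) > 0"
    using \<phi> by (intro bexI[of _ ?\<phi>]) auto
qed

section \<open>First eigenvalues of plane domains as Rayleigh infima\<close>

lemma plane_lambda1_eq:
  assumes "open \<Omega>" "\<Omega> \<noteq> {}" "emeasure lborel \<Omega> < \<infinity>"
  shows "plane_lambda1 \<Omega> = dirichlet_space.rayleigh_inf lborel (plane_test \<Omega>)"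
  unfolding plane_lambda1_def by (rule dirichlet_space.least_eigenvalue[OF plane_dirichlet_space[OF assms]])

lemma plane_lambda1_le:
  assumes "open \<Omega>" "\<Omega> \<noteq> {}" "emeasure lborel \<Omega> < \<infinity>" "\<phi> \<in> plane_test \<Omega>"
  shows "plane_lambda1 \<Omega> * (\<integral>p. (\<phi> p)\<^sup>2 \<partial>lborel) \<le> (\<integral>p. (norm (grad \<phi> p))\<^sup>2 \<partial>lborel)"
proof -
  interpret dirichlet_space lborel "plane_test \<Omega>" by (rule plane_dirichlet_space[OF assms(1-3)])
  show ?thesis using rayleigh_inf_le[OF assms(4)] by (simp add: N_def E_def plane_lambda1_eq[OF assms(1-3)])
qed

lemma plane_lambda1_ge:
  assumes "open \<Omega>" "\<Omega> \<noteq> {}" "emeasure lborel \<Omega> < \<infinity>"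
    and le: "\<And>\<phi>. \<phi> \<in> plane_test \<Omega> \<Longrightarrow> c * (\<integral>p. (\<phi> p)\<^sup>2 \<partial>lborel) \<le> (\<integral>p. (norm (grad \<phi> p))\<^sup>2 \<partial>lborel)"
  shows "c \<le> plane_lambda1 \<Omega>"
proof (rule ccontr)
  interpret dirichlet_space lborel "plane_test \<Omega>" by (rule plane_dirichlet_space[OF assms(1-3)])
  assume "\<not> ?thesis"
  then have "c - rayleigh_inf > 0" by (simp add: plane_lambda1_eq[OF assms(1-3)])
  from rayleigh_inf_approx[OF this] obtain \<phi> where "\<phi> \<in> plane_test \<Omega>" "E \<phi> < c * N \<phi>" by auto
  with le[of \<phi>] show False by (simp add: N_def E_def)
qed

section \<open>One-variable bounds starting from a zero of the function\<close>

lemma endpoint_bound: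
  fixes v v' :: "real \<Rightarrow> real"
  assumes ab: "a \<le> b" and dv: "\<And>x. x \<in> {a..b} \<Longrightarrow> (v has_real_derivative v' x) (at x)"
    and cont: "continuous_on {a..b} v'" and va: "v a = 0"
  shows "(v b)\<^sup>2 \<le> (b - a) * integral {a..b} (\<lambda>x. (v' x)\<^sup>2)"
proof (cases "a = b")
  case False
  with ab have ab: "a < b" by simp
  have "(v' has_integral v b - v a) {a..b}"
    using ab by (intro fundamental_theorem_of_calculus)
      (auto simp: has_real_derivative_iff_has_vector_derivative[symmetric] intro: DERIV_subset[OF dv])
  then have i: "integral {a..b} v' = v b" using va by (simp add: integral_unique)
  have "(integral {a..b} v')\<^sup>2 / (b - a) \<le> integral {a..b} (\<lambda>x. (v' x)\<^sup>2)"
    unfolding variance_decomposition[OF ab cont]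
    using ab by (auto intro!: integral_nonneg integrable_continuous_interval continuous_intros cont)
  then show ?thesis using ab i by (simp add: field_simps)
qed (use va in simp)

lemma nn_integral_Icc:
  fixes f :: "real \<Rightarrow> real"
  assumes "continuous_on UNIV f" "\<And>x. 0 \<le> f x" "\<And>x. x \<notin> {a..b} \<Longrightarrow> f x = 0"
  shows "(\<integral>\<^sup>+x. ennreal (f x) \<partial>lborel) = ennreal (integral {a..b} f)"
proof -
  have "(f has_integral integral {a..b} f) {a..b}"
    by (intro integrable_integral integrable_continuous_interval continuous_on_subset[OF assms(1)]) auto
  then have "(f has_integral integral {a..b} f) UNIV"
    by (rule has_integral_on_superset) (use assms(3) in auto)
  then show ?thesis
    using assms(2) borel_measurable_continuous_onI[OF assms(1)] by (intro nn_integral_has_integral_lborel) auto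
qed

lemma nn_integral_Icc_le:
  fixes f :: "real \<Rightarrow> real"
  assumes "continuous_on UNIV f" "\<And>x. 0 \<le> f x"
  shows "ennreal (integral {a..b} f) \<le> (\<integral>\<^sup>+x. ennreal (f x) \<partial>lborel)"
proof -
  have "(f has_integral integral {a..b} f) {a..b}"
    by (intro integrable_integral integrable_continuous_interval continuous_on_subset[OF assms(1)]) auto
  then have "((\<lambda>x. if x \<in> {a..b} then f x else 0) has_integral integral {a..b} f) UNIV"
    by (simp only: has_integral_restrict_UNIV)
  moreover have [measurable]: "f \<in> borel_measurable borel" by (rule borel_measurable_continuous_onI[OF assms(1)])
  ultimately have "(\<integral>\<^sup>+x. ennreal (if x \<in> {a..b} then f x else 0) \<partial>lborel) = ennreal (integral {a..b} f)"
    using assms(2) by (intro nn_integral_has_integral_lborel) auto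
  then show ?thesis
    by (simp only: flip: \<open>_ = ennreal (integral {a..b} f)\<close>) (intro nn_integral_mono, use assms(2) in auto)
qed

text \<open>A function supported in a set of length at most \<open>L\<close>: its value at a point is controlled from the
  nearest zero to the left, which is at distance at most \<open>L\<close>.\<close>

lemma thin_support_bound:
  fixes v v' :: "real \<Rightarrow> real"
  assumes dv: "\<And>x. (v has_real_derivative v' x) (at x)" and cont: "continuous_on UNIV v'"
    and S: "S \<in> sets borel" "emeasure lborel S \<le> ennreal L" "L > 0" "\<And>x. v x \<noteq> 0 \<Longrightarrow> x \<in> S"
    and R: "\<And>x. R < \<bar>x\<bar> \<Longrightarrow> v x = 0"
  shows "(\<integral>\<^sup>+x. ennreal ((v x)\<^sup>2) \<partial>lborel) \<le> ennreal (L\<^sup>2) * (\<integral>\<^sup>+x. ennreal ((v' x)\<^sup>2) \<partial>lborel)"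
proof -
  let ?I = "\<integral>\<^sup>+x. ennreal ((v' x)\<^sup>2) \<partial>lborel"
  have cv: "continuous_on A v" for A
    using dv by (meson DERIV_continuous continuous_at_imp_continuous_on)
  have bound: "ennreal ((v x)\<^sup>2) \<le> ennreal L * ?I" if nz: "v x \<noteq> 0" for x
  proof -
    \<comment> \<open>Zeros to the left of x. The left end point lies beyond the support, so this
      compact set is nonempty, and its maximum is the zero closest to x.\<close>
    define Z where "Z = {- \<bar>R\<bar> - 1..x} \<inter> v -` {0}"
    have xR: "- \<bar>R\<bar> \<le> x" using R[of x] nz by (cases "R < \<bar>x\<bar>") auto
    have "closed Z" unfolding Z_def using cv by (intro continuous_closed_preimage) auto
    then have "compact Z" unfolding Z_def by (auto intro: compact_Int_closed simp: compact_eq_bounded_closed bounded_Int)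
    moreover have "- \<bar>R\<bar> - 1 \<in> Z" using R[of "- \<bar>R\<bar> - 1"] xR by (auto simp: Z_def)
    ultimately obtain a where a: "a \<in> Z" "\<And>t. t \<in> Z \<Longrightarrow> t \<le> a"
      using compact_attains_sup[of Z] by blast
    have ax: "a < x" "v a = 0" using a(1) nz by (auto simp: Z_def order_le_less)
    have "{a<..<x} \<subseteq> S"
    proof
      fix t assume t: "t \<in> {a<..<x}"
      have "t \<notin> Z" using a(2)[of t] t by auto
      then have "v t \<noteq> 0" using t a(1) by (auto simp: Z_def)
      then show "t \<in> S" by (rule S(4))
    qed
    then have "emeasure lborel {a<..<x} \<le> ennreal L"
      using S(1,2) by (intro order_trans[OF emeasure_mono S(2)]) auto
    then have xa: "x - a \<le> L" using ax S(3) by simp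
    have "(v x)\<^sup>2 \<le> (x - a) * integral {a..x} (\<lambda>x. (v' x)\<^sup>2)"
      using ax by (intro endpoint_bound dv continuous_on_subset[OF cont]) auto
    also have "\<dots> \<le> L * integral {a..x} (\<lambda>x. (v' x)\<^sup>2)"
      by (intro mult_right_mono xa integral_nonneg integrable_continuous_interval continuous_intros
          continuous_on_subset[OF cont]) auto
    finally have "ennreal ((v x)\<^sup>2) \<le> ennreal (L * integral {a..x} (\<lambda>x. (v' x)\<^sup>2))" by (rule ennreal_leI)
    also have "\<dots> = ennreal L * ennreal (integral {a..x} (\<lambda>x. (v' x)\<^sup>2))"
      using S(3) by (intro ennreal_mult integral_nonneg integrable_continuous_interval continuous_intros
          continuous_on_subset[OF cont]) auto
    also have "\<dots> \<le> ennreal L * ?I"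
      by (intro mult_left_mono nn_integral_Icc_le continuous_intros cont) auto
    finally show ?thesis .
  qed
  have "(\<integral>\<^sup>+x. ennreal ((v x)\<^sup>2) \<partial>lborel) \<le> (\<integral>\<^sup>+x. (ennreal L * ?I) * indicator S x \<partial>lborel)"
  proof (rule nn_integral_mono)
    fix x show "ennreal ((v x)\<^sup>2) \<le> (ennreal L * ?I) * indicator S x"
      using bound[of x] S(4)[of x] by (cases "v x = 0") auto
  qed
  also have "\<dots> = (ennreal L * ?I) * emeasure lborel S" using S(1) by (subst nn_integral_cmult_indicator) auto
  also have "\<dots> \<le> (ennreal L * ?I) * ennreal L" by (intro mult_left_mono S) auto
  also have "\<dots> = ennreal (L\<^sup>2) * ?I" using S(3) by (simp add: power2_eq_square ennreal_mult mult_ac)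
  finally show ?thesis .
qed

section \<open>Domains in a strip\<close>

lemma nn_integral_plane:
  fixes f :: "plane \<Rightarrow> ennreal"
  assumes "f \<in> borel_measurable borel"
  shows "(\<integral>\<^sup>+p. f p \<partial>lborel) = (\<integral>\<^sup>+x. \<integral>\<^sup>+y. f (x, y) \<partial>lborel \<partial>lborel)"
    and "(\<integral>\<^sup>+p. f p \<partial>lborel) = (\<integral>\<^sup>+y. \<integral>\<^sup>+x. f (x, y) \<partial>lborel \<partial>lborel)"
proof -
  have f: "f \<in> borel_measurable (lborel \<Otimes>\<^sub>M lborel)" using assms by (simp add: lborel_prod)
  show "(\<integral>\<^sup>+p. f p \<partial>lborel) = (\<integral>\<^sup>+x. \<integral>\<^sup>+y. f (x, y) \<partial>lborel \<partial>lborel)"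
    using lborel.nn_integral_fst[OF f] by (simp add: lborel_prod)
  show "(\<integral>\<^sup>+p. f p \<partial>lborel) = (\<integral>\<^sup>+y. \<integral>\<^sup>+x. f (x, y) \<partial>lborel \<partial>lborel)"
    using lborel_pair.nn_integral_snd[OF f] by (simp add: lborel_prod)
qed

text \<open>The arithmetic behind the gain. If Y is close to its minimum pi^2 N/b^2, then b^2 Y is
  close to pi^2 N, which is at most 16 N and leaves 4 of the 20 N in the second assumption to be
  paid by X. An excess of Y over the minimum helps directly, whence 4/8000 = 1/2000.\<close>

lemma strip_energy_bound_real:
  fixes N X Y b :: real
  assumes b: "0 < b" "b \<le> 1" and N: "N \<ge> 0" and 1: "pi\<^sup>2 * N \<le> b\<^sup>2 * Y" and 2: "20 * N \<le> 8000 * X + b\<^sup>2 * Y"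
  shows "(pi\<^sup>2 / b\<^sup>2 + 1 / 2000) * N \<le> X + Y"
proof -
  have b2: "0 < b\<^sup>2" "b\<^sup>2 \<le> 1" using b by (auto simp: power_le_one)
  have "pi\<^sup>2 \<le> 4\<^sup>2" using pi_less_4 by (intro power_mono) auto
  then have p: "pi\<^sup>2 * N \<le> 16 * N" using N by (intro mult_right_mono) auto
  define P where "P = pi\<^sup>2 * N / b\<^sup>2"
  have Y: "P \<le> Y" using 1 b2 by (simp add: P_def field_simps)
  have "b\<^sup>2 * P = pi\<^sup>2 * N" using b2 by (simp add: P_def)
  then have "b\<^sup>2 * P \<le> 16 * N" using p by simp
  moreover have "b\<^sup>2 * (Y - P) \<le> 1 * (Y - P)" using Y b2 by (intro mult_right_mono) auto
  ultimately have "b\<^sup>2 * Y \<le> (Y - P) + 16 * N" by (simp add: algebra_simps)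
  with 2 have "4 * N \<le> 8000 * X + (Y - P)" by linarith
  then have "1 / 2000 * N + P \<le> X + Y" using Y by linarith
  then show ?thesis by (simp add: P_def distrib_right)
qed

text \<open>
  The vertical Wirtinger inequality gives \<open>\<pi>\<^sup>2/b\<^sup>2\<close>. The gain comes from the horizontal slices: all
  but a small set of them have length at most \<open>20\<close>, since the area is at most \<open>b\<close>, and the small set
  carries little mass.
\<close>

lemma strip_energy_bound:
  assumes b: "0 < b" "b \<le> 1" and \<Omega>: "open \<Omega>" "\<Omega> \<subseteq> strip b" "emeasure lborel \<Omega> \<le> ennreal b"
    and \<phi>: "\<phi> \<in> plane_test \<Omega>"
  shows "(pi\<^sup>2 / b\<^sup>2 + 1 / 2000) * (\<integral>p. (\<phi> p)\<^sup>2 \<partial>lborel) \<le> (\<integral>p. (norm (grad \<phi> p))\<^sup>2 \<partial>lborel)"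
proof -
  have sm: "smooth \<phi>" and K: "compact (closure {p. \<phi> p \<noteq> 0})" "closure {p. \<phi> p \<noteq> 0} \<subseteq> \<Omega>"
    using \<phi> by (auto simp: plane_test_def)
  define fx where "fx p = fst (grad \<phi> p)" for p
  define fy where "fy p = snd (grad \<phi> p)" for p
  have g: "has_grad \<phi> fx fy" unfolding fx_def fy_def by (rule smooth_has_grad[OF sm])
  note cf = has_grad_cont[OF g]
  have [measurable]: "\<phi> \<in> borel_measurable borel" "fx \<in> borel_measurable borel" "fy \<in> borel_measurable borel"
    by (intro borel_measurable_continuous_onI cf)+
  have zero: "\<phi> p = 0" if "p \<notin> \<Omega>" for p
    using that K(2) zero_outside[of p \<phi>] by auto
  have zero_y: "\<phi> (x, y) = 0" if "y \<notin> {0<..<b}" for x y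
    using that \<Omega>(2) by (intro zero) (auto simp: strip_def)
  obtain R where R: "\<And>p. p \<in> closure {p. \<phi> p \<noteq> 0} \<Longrightarrow> norm p \<le> R"
    using compact_imp_bounded[OF K(1)] unfolding bounded_iff by blast
  have zero_x: "\<phi> (x, y) = 0" if "R < \<bar>x\<bar>" for x y
  proof (rule zero_outside[of "(x, y)" \<phi>])
    have "\<bar>x\<bar> \<le> norm (x, y)" using norm_fst_le[of x y] by simp
    then show "(x, y) \<notin> closure {p. \<phi> p \<noteq> 0}" using R[of "(x, y)"] that by linarith
  qed
  have sq: "integrable lborel (\<lambda>p. (\<phi> p)\<^sup>2)" "integrable lborel (\<lambda>p. (norm (grad \<phi> p))\<^sup>2)"
    using sq_int_integrable[OF compact_support_sq[OF sm K(1)]] sq_int_integrable[OF compact_support_grad_sq[OF sm K(1)]] by auto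
  have isq: "integrable lborel (\<lambda>p. (fx p)\<^sup>2)" "integrable lborel (\<lambda>p. (fy p)\<^sup>2)"
    by (rule Bochner_Integration.integrable_bound[OF sq(2)]; simp add: norm_plane_sq fx_def[symmetric] fy_def[symmetric])+
  let ?N = "\<integral>p. (\<phi> p)\<^sup>2 \<partial>lborel" and ?X = "\<integral>p. (fx p)\<^sup>2 \<partial>lborel" and ?Y = "\<integral>p. (fy p)\<^sup>2 \<partial>lborel"
  have NN: "(\<integral>\<^sup>+p. ennreal ((\<phi> p)\<^sup>2) \<partial>lborel) = ennreal ?N" by (intro nn_integral_eq_integral sq) auto
  have XX: "(\<integral>\<^sup>+p. ennreal ((fx p)\<^sup>2) \<partial>lborel) = ennreal ?X" by (intro nn_integral_eq_integral isq) auto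
  have YY: "(\<integral>\<^sup>+p. ennreal ((fy p)\<^sup>2) \<partial>lborel) = ennreal ?Y" by (intro nn_integral_eq_integral isq) auto
  have nonneg: "?N \<ge> 0" "?X \<ge> 0" "?Y \<ge> 0" by simp_all
  define W where "W x = (\<integral>\<^sup>+y. ennreal ((fy (x, y))\<^sup>2) \<partial>lborel)" for x
  have [measurable]: "W \<in> borel_measurable borel" unfolding W_def by measurable
  have WY: "(\<integral>\<^sup>+x. W x \<partial>lborel) = ennreal ?Y"
    unfolding W_def YY[symmetric] by (rule nn_integral_plane(1)[symmetric]) measurable
  have c2: "continuous_on UNIV (\<lambda>p. (\<phi> p)\<^sup>2)" "continuous_on UNIV (\<lambda>p. (fy p)\<^sup>2)" "continuous_on UNIV (\<lambda>p. (fx p)\<^sup>2)"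
    by (intro continuous_intros cf)+
  have "ennreal (pi\<^sup>2) * ennreal ?N = (\<integral>\<^sup>+x. ennreal (pi\<^sup>2) * (\<integral>\<^sup>+y. ennreal ((\<phi> (x, y))\<^sup>2) \<partial>lborel) \<partial>lborel)"
    unfolding NN[symmetric] by (subst nn_integral_plane(1)) (auto intro!: nn_integral_cmult[symmetric])
  also have "\<dots> \<le> (\<integral>\<^sup>+x. ennreal (b\<^sup>2) * W x \<partial>lborel)"
  proof (rule nn_integral_mono)
    fix x
    have "pi\<^sup>2 * integral {0..b} (\<lambda>y. (\<phi> (x, y))\<^sup>2) \<le> (b - 0)\<^sup>2 * integral {0..b} (\<lambda>y. (fy (x, y))\<^sup>2)"
      using b zero_y[of 0 x] zero_y[of b x]
      by (intro Wirtinger_Dirichlet continuous_slice(2)[OF cf(3)] DERIV_subset[OF has_grad_slice(2)[OF g]]) auto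
    then have "ennreal (pi\<^sup>2 * integral {0..b} (\<lambda>y. (\<phi> (x, y))\<^sup>2)) \<le> ennreal (b\<^sup>2 * integral {0..b} (\<lambda>y. (fy (x, y))\<^sup>2))"
      by (intro ennreal_leI) simp
    moreover have "(\<integral>\<^sup>+y. ennreal ((\<phi> (x, y))\<^sup>2) \<partial>lborel) = ennreal (integral {0..b} (\<lambda>y. (\<phi> (x, y))\<^sup>2))"
      by (rule nn_integral_Icc[OF continuous_slice(2)[OF c2(1)]]) (auto intro!: zero_y)
    moreover have "ennreal (integral {0..b} (\<lambda>y. (fy (x, y))\<^sup>2)) \<le> W x"
      unfolding W_def by (rule nn_integral_Icc_le[OF continuous_slice(2)[OF c2(2)]]) auto
    ultimately show "ennreal (pi\<^sup>2) * (\<integral>\<^sup>+y. ennreal ((\<phi> (x, y))\<^sup>2) \<partial>lborel) \<le> ennreal (b\<^sup>2) * W x"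
      by (simp add: ennreal_mult' ) (meson mult_left_mono order_trans zero_le)
  qed
  also have "\<dots> = ennreal (b\<^sup>2) * ennreal ?Y"
    unfolding WY[symmetric] by (rule nn_integral_cmult) measurable
  finally have 1: "pi\<^sup>2 * ?N \<le> b\<^sup>2 * ?Y"
    using nonneg by (simp add: ennreal_mult'[symmetric])
  define slice where "slice y = (\<lambda>x. (x, y)) -` \<Omega>" for y :: real
  have \<Omega>m: "\<Omega> \<in> sets (lborel \<Otimes>\<^sub>M lborel)" unfolding lborel_prod using \<Omega>(1) by simp
  have [measurable]: "(\<lambda>y. emeasure lborel (slice y)) \<in> borel_measurable borel"
    using lborel_pair.measurable_emeasure_Pair2[OF \<Omega>m] by (simp add: slice_def)
  have slice_open: "open (slice y)" for y
    unfolding slice_def using \<Omega>(1) by (intro open_vimage continuous_intros)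
  have slices: "(\<integral>\<^sup>+y. emeasure lborel (slice y) \<partial>lborel) \<le> ennreal b"
    using lborel_pair.emeasure_pair_measure_alt2[OF \<Omega>m] \<Omega>(3) by (simp add: lborel_prod slice_def)
  \<comment> \<open>Heights of the long slices. The bound 20 only has to exceed pi^2 with room to
    spare; the slices have total length at most b, so 20 times the measure of this set is at most
    b.\<close>
  define Bd where "Bd = {y. emeasure lborel (slice y) > ennreal 20}"
  have [measurable]: "Bd \<in> sets borel" unfolding Bd_def by measurable
  have "ennreal 20 * emeasure lborel Bd = (\<integral>\<^sup>+y. ennreal 20 * indicator Bd y \<partial>lborel)"
    by (subst nn_integral_cmult_indicator) auto
  also have "\<dots> \<le> (\<integral>\<^sup>+y. emeasure lborel (slice y) \<partial>lborel)"
    by (intro nn_integral_mono) (auto simp: Bd_def indicator_def less_imp_le)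
  finally have Bd: "ennreal 20 * emeasure lborel Bd \<le> ennreal b" using slices by (rule order_trans)
  define A where "A y = (\<integral>\<^sup>+x. ennreal ((\<phi> (x, y))\<^sup>2) \<partial>lborel)" for y
  define X' where "X' y = (\<integral>\<^sup>+x. ennreal ((fx (x, y))\<^sup>2) \<partial>lborel)" for y
  have [measurable]: "A \<in> borel_measurable borel" "X' \<in> borel_measurable borel" unfolding A_def X'_def by measurable
  have AX: "A y \<le> ennreal 400 * X' y + indicator Bd y * A y" for y
  proof (cases "y \<in> Bd")
    case False
    then have "emeasure lborel (slice y) \<le> ennreal 20" by (simp add: Bd_def not_less)
    then have "A y \<le> ennreal (20\<^sup>2) * X' y"
      unfolding A_def X'_def using slice_open
      by (intro thin_support_bound[where S = "slice y" and R = R] has_grad_slice(1)[OF g] continuous_slice(1)[OF cf(2)])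
        (auto simp: slice_def zero_x intro: ccontr zero)
    then show ?thesis using False by simp
  qed (simp add: add_increasing)
  \<comment> \<open>Pointwise bound through the zero at the bottom of the strip. Integrated over the
    long slices, it bounds their mass by b times the measure of \<open>Bd\<close> times the vertical
    energy.\<close>
  have pt: "ennreal ((\<phi> (x, y))\<^sup>2) \<le> ennreal b * W x" for x y
  proof (cases "y \<in> {0<..<b}")
    case True
    have "(\<phi> (x, y))\<^sup>2 \<le> (y - 0) * integral {0..y} (\<lambda>y. (fy (x, y))\<^sup>2)"
      using True zero_y[of 0 x] by (intro endpoint_bound has_grad_slice(2)[OF g] continuous_slice(2)[OF cf(3)]) auto
    also have "\<dots> \<le> b * integral {0..y} (\<lambda>y. (fy (x, y))\<^sup>2)"
      using True by (intro mult_right_mono integral_nonneg integrable_continuous_interval continuous_slice(2)[OF c2(2)]) auto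
    finally have "ennreal ((\<phi> (x, y))\<^sup>2) \<le> ennreal (b * integral {0..y} (\<lambda>y. (fy (x, y))\<^sup>2))" by (rule ennreal_leI)
    also have "\<dots> = ennreal b * ennreal (integral {0..y} (\<lambda>y. (fy (x, y))\<^sup>2))"
      using b by (intro ennreal_mult') auto
    also have "\<dots> \<le> ennreal b * W x"
      unfolding W_def by (intro mult_left_mono nn_integral_Icc_le continuous_slice(2)[OF c2(2)]) auto
    finally show ?thesis .
  qed (simp add: zero_y)
  have [measurable]: "(snd :: plane \<Rightarrow> real) \<in> borel_measurable borel"
    by (intro borel_measurable_continuous_onI continuous_intros)
  have Bd_meas: "(\<lambda>p. indicator Bd (snd p) * ennreal ((\<phi> p)\<^sup>2)) \<in> borel_measurable borel"
    by measurable
  have "(\<integral>\<^sup>+y. indicator Bd y * A y \<partial>lborel) = (\<integral>\<^sup>+y. \<integral>\<^sup>+x. indicator Bd y * ennreal ((\<phi> (x, y))\<^sup>2) \<partial>lborel \<partial>lborel)"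
    unfolding A_def by (intro nn_integral_cong nn_integral_cmult[symmetric]) measurable
  also have "\<dots> = (\<integral>\<^sup>+p. indicator Bd (snd p) * ennreal ((\<phi> p)\<^sup>2) \<partial>lborel)"
    by (simp add: nn_integral_plane(2)[OF Bd_meas])
  also have "\<dots> = (\<integral>\<^sup>+x. \<integral>\<^sup>+y. indicator Bd y * ennreal ((\<phi> (x, y))\<^sup>2) \<partial>lborel \<partial>lborel)"
    by (simp add: nn_integral_plane(1)[OF Bd_meas])
  also have "\<dots> \<le> (\<integral>\<^sup>+x. \<integral>\<^sup>+y. (ennreal b * W x) * indicator Bd y \<partial>lborel \<partial>lborel)"
    by (intro nn_integral_mono) (auto simp: indicator_def pt)
  also have "\<dots> = (\<integral>\<^sup>+x. (ennreal b * emeasure lborel Bd) * W x \<partial>lborel)"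
    by (subst nn_integral_cmult_indicator) (auto simp: mult_ac)
  also have "\<dots> = (ennreal b * emeasure lborel Bd) * ennreal ?Y"
    unfolding WY[symmetric] by (rule nn_integral_cmult) measurable
  finally have ABd: "(\<integral>\<^sup>+y. indicator Bd y * A y \<partial>lborel) \<le> (ennreal b * emeasure lborel Bd) * ennreal ?Y" .
  have "ennreal ?N = (\<integral>\<^sup>+y. A y \<partial>lborel)"
    unfolding NN[symmetric] A_def by (rule nn_integral_plane(2)) measurable
  also have "\<dots> \<le> (\<integral>\<^sup>+y. ennreal 400 * X' y + indicator Bd y * A y \<partial>lborel)"
    by (intro nn_integral_mono AX)
  also have "\<dots> = (\<integral>\<^sup>+y. ennreal 400 * X' y \<partial>lborel) + (\<integral>\<^sup>+y. indicator Bd y * A y \<partial>lborel)"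
    by (rule nn_integral_add) measurable
  also have "(\<integral>\<^sup>+y. ennreal 400 * X' y \<partial>lborel) = ennreal 400 * ennreal ?X"
    unfolding XX[symmetric] X'_def by (subst nn_integral_plane(2)) (auto intro!: nn_integral_cmult)
  finally have "ennreal ?N \<le> ennreal 400 * ennreal ?X + (ennreal b * emeasure lborel Bd) * ennreal ?Y"
    using ABd by (meson add_left_mono order_trans)
  from mult_left_mono[OF this, of "ennreal 20"]
  have "ennreal 20 * ennreal ?N \<le> ennreal 20 * (ennreal 400 * ennreal ?X)
      + (ennreal 20 * emeasure lborel Bd) * (ennreal b * ennreal ?Y)"
    by (simp add: distrib_left mult_ac)
  also have "\<dots> \<le> ennreal 20 * (ennreal 400 * ennreal ?X) + ennreal b * (ennreal b * ennreal ?Y)"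
    by (intro add_left_mono mult_right_mono Bd) auto
  also have "\<dots> = ennreal (8000 * ?X + b\<^sup>2 * ?Y)"
  proof -
    have b0: "0 \<le> b" using b by simp
    have e1: "ennreal 20 * (ennreal 400 * ennreal x) = ennreal (20 * (400 * x))" for x
      by (simp only: ennreal_mult' zero_le_numeral)
    have e2: "ennreal b * (ennreal b * ennreal y) = ennreal (b * (b * y))" for y
      by (simp only: ennreal_mult' b0)
    have e3: "ennreal (20 * (400 * ?X)) + ennreal (b * (b * ?Y)) = ennreal (20 * (400 * ?X) + b * (b * ?Y))"
      using b0 nonneg by (intro ennreal_plus[symmetric]) auto
    have e4: "20 * (400 * ?X) + b * (b * ?Y) = 8000 * ?X + b\<^sup>2 * ?Y" by (simp add: power2_eq_square)
    show ?thesis unfolding e1 e2 e3 e4 ..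
  qed
  finally have "ennreal (20 * ?N) \<le> ennreal (8000 * ?X + b\<^sup>2 * ?Y)"
    using nonneg by (simp add: ennreal_mult')
  then have 2: "20 * ?N \<le> 8000 * ?X + b\<^sup>2 * ?Y"
    using nonneg b by (subst (asm) ennreal_le_iff) auto
  have "(\<integral>p. (norm (grad \<phi> p))\<^sup>2 \<partial>lborel) = ?X + ?Y"
    unfolding norm_plane_sq fx_def[symmetric] fy_def[symmetric] using isq by simp
  then show ?thesis using strip_energy_bound_real[OF b nonneg(1) 1 2] by simp
qed

section \<open>Upper bound by the rectangle, and the strip transition value\<close>

lemma integral_product:
  fixes f g :: "real \<Rightarrow> real"
  assumes "continuous_on UNIV f" "continuous_on UNIV g"
  shows "integral (cbox (a, c) (b, d)) (\<lambda>p. f (fst p) * g (snd p)) = integral {a..b} f * integral {c..d} g"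
proof -
  have "continuous_on UNIV (\<lambda>p::plane. f (fst p) * g (snd p))"
    by (intro continuous_intros continuous_on_compose2[OF assms(1)] continuous_on_compose2[OF assms(2)]) auto
  from rect_fubini(1)[OF this, of a c b d] show ?thesis by simp
qed

text \<open>Removes the loss factor that the truncated sine functions leave in every Rayleigh
  quotient computed with them.\<close>

lemma le_of_le_scaled:
  fixes x K :: real
  assumes K: "0 \<le> K" and le: "\<And>e. 0 < e \<Longrightarrow> e < 1 / 8 \<Longrightarrow> x * (1 - 8 * e) \<le> K"
  shows "x \<le> K"
proof (rule ccontr)
  assume "\<not> ?thesis"
  then have x: "x > K" "x > 0" using K by auto
  define e where "e = min (1 / 16) ((x - K) / (16 * x))"
  have e: "e > 0" "e < 1 / 8" "e \<le> (x - K) / (16 * x)" using x by (auto simp: e_def)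
  from mult_left_mono[OF e(3), of "16 * x"] have "16 * x * e \<le> x - K" using x by simp
  moreover have "x * (1 - 8 * e) \<le> K" using e by (intro le) auto
  ultimately show False using x by (simp add: algebra_simps)
qed

lemma rect_lambda1_le:
  assumes b: "b > 0"
  shows "plane_lambda1 ({0<..<1} \<times> {0<..<b}) \<le> pi\<^sup>2 + pi\<^sup>2 / b\<^sup>2"
proof (rule le_of_le_scaled)
  fix e :: real assume e: "0 < e" "e < 1 / 8"
  let ?Om = "{0<..<1::real} \<times> {0<..<b}"
  define \<phi> where "\<phi> = (\<lambda>p. sine_bump e 1 (fst p + - 0) * sine_bump e b (snd p + - 0))"
  have \<phi>: "\<phi> \<in> plane_test ?Om"
    unfolding \<phi>_def by (rule plane_test_bump) (use e b in auto)
  then have sm: "smooth \<phi>" and cl: "closure {p. \<phi> p \<noteq> 0} \<subseteq> ?Om" by (auto simp: plane_test_def)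
  have op: "open ?Om" "?Om \<noteq> {}" using b by (auto intro: open_Times)
  have fin: "emeasure lborel ?Om < \<infinity>"
    by (rule emeasure_bounded_finite) (intro bounded_Times, auto)
  let ?s = "sine_bump e 1" and ?t = "sine_bump e b" and ?s' = "sine_bump' e 1" and ?t' = "sine_bump' e b"
  note cs = sine_bump_cont[OF e(1), of 1 UNIV] sine_bump_cont[OF e(1) b, of UNIV]
    sine_bump'_cont[OF e(1), of 1 UNIV] sine_bump'_cont[OF e(1) b, of UNIV]
  have gr: "grad \<phi> p = (?s' (fst p) * ?t (snd p), ?s (fst p) * ?t' (snd p))" for p
  proof -
    note g = smooth_has_grad[OF sm]
    have "((\<lambda>x. \<phi> (x, snd p)) has_real_derivative ?s' (fst p) * ?t (snd p)) (at (fst p))"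
      unfolding \<phi>_def using sine_bump_deriv[OF e(1), of 1 "fst p"] by (auto intro!: derivative_eq_intros)
    from DERIV_unique[OF this has_grad_slice(1)[OF g]] have 1: "fst (grad \<phi> p) = ?s' (fst p) * ?t (snd p)" by simp
    have "((\<lambda>y. \<phi> (fst p, y)) has_real_derivative ?s (fst p) * ?t' (snd p)) (at (snd p))"
      unfolding \<phi>_def using sine_bump_deriv[OF e(1) b, of "snd p"] by (auto intro!: derivative_eq_intros)
    from DERIV_unique[OF this has_grad_slice(2)[OF g]] have 2: "snd (grad \<phi> p) = ?s (fst p) * ?t' (snd p)" by simp
    show ?thesis using 1 2 by (simp add: prod_eq_iff)
  qed
  define A where "A = integral {0..1} (\<lambda>x. (?s x)\<^sup>2)"
  define A' where "A' = integral {0..1} (\<lambda>x. (?s' x)\<^sup>2)"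
  define B where "B = integral {0..b} (\<lambda>x. (?t x)\<^sup>2)"
  define B' where "B' = integral {0..b} (\<lambda>x. (?t' x)\<^sup>2)"
  \<comment> \<open>The support lies inside the rectangle, so integrals over the plane are integrals
    over the half-open cell, to which \<open>rect_lebesgue\<close> applies.\<close>
  have ind: "indicator ({0..<1} \<times> {0..<b}) p * (\<phi> p)\<^sup>2 = (\<phi> p)\<^sup>2"
    "indicator ({0..<1} \<times> {0..<b}) p * (norm (grad \<phi> p))\<^sup>2 = (norm (grad \<phi> p))\<^sup>2" for p
    using cl zero_outside[of p \<phi>] grad_zero_outside[of p \<phi>]
    by (cases "p \<in> closure {p. \<phi> p \<noteq> 0}"; auto simp: indicator_def mem_Times_iff dest!: subsetD)+
  have cg: "continuous_on UNIV (\<lambda>p. (\<phi> p)\<^sup>2)" "continuous_on UNIV (\<lambda>p. (norm (grad \<phi> p))\<^sup>2)"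
    by (intro continuous_intros smooth_continuous sm smooth_grad_cont)+
  have N: "(\<integral>p. (\<phi> p)\<^sup>2 \<partial>lborel) = A * B"
    using rect_lebesgue(2)[OF cg(1), of 0 1 0 b] integral_product[of "\<lambda>x. (?s x)\<^sup>2" "\<lambda>x. (?t x)\<^sup>2" 0 0 1 b] cs
    unfolding ind A_def B_def by (simp add: \<phi>_def power_mult_distrib continuous_on_power)
  have "integral (cbox (0, 0) (1, b)) (\<lambda>p. (norm (grad \<phi> p))\<^sup>2)
      = integral (cbox (0, 0) (1, b)) (\<lambda>p. (?s' (fst p))\<^sup>2 * (?t (snd p))\<^sup>2 + (?s (fst p))\<^sup>2 * (?t' (snd p))\<^sup>2)"
    unfolding norm_plane_sq gr by (simp add: power_mult_distrib)
  also have "\<dots> = integral (cbox (0, 0) (1, b)) (\<lambda>p. (?s' (fst p))\<^sup>2 * (?t (snd p))\<^sup>2)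
      + integral (cbox (0, 0) (1, b)) (\<lambda>p. (?s (fst p))\<^sup>2 * (?t' (snd p))\<^sup>2)"
    by (intro integral_add integrable_on_rect continuous_intros continuous_on_compose2[OF cs(1)]
        continuous_on_compose2[OF cs(2)] continuous_on_compose2[OF cs(3)] continuous_on_compose2[OF cs(4)]) auto
  also have "\<dots> = A' * B + A * B'"
    unfolding A_def B_def A'_def B'_def using cs
    by (subst (1 2) integral_product) (auto intro!: continuous_intros)
  finally have E: "(\<integral>p. (norm (grad \<phi> p))\<^sup>2 \<partial>lborel) = A' * B + A * B'"
    using rect_lebesgue(2)[OF cg(2), of 0 1 0 b] unfolding ind by simp
  have A: "A \<ge> (1 - 8 * e) / 2" using integral_sine_bump_sq[OF e(1), of 1] by (simp add: A_def)
  have B: "B \<ge> b * (1 - 8 * e) / 2" using integral_sine_bump_sq[OF e(1) b] by (simp add: B_def algebra_simps)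
  have A': "A' \<le> pi\<^sup>2 / 2" using integral_sine_bump'_sq[OF e(1), of 1] by (simp add: A'_def)
  have B': "B' \<le> pi\<^sup>2 / (2 * b)" using integral_sine_bump'_sq[OF e(1) b] by (simp add: B'_def)
  have pos: "1 - 8 * e > 0" using e by simp
  have Apos: "A > 0" by (rule less_le_trans[OF _ A]) (use pos in simp)
  have Bpos: "B > 0" by (rule less_le_trans[OF _ B]) (use pos b in simp)
  have "plane_lambda1 ?Om * (A * B) \<le> A' * B + A * B'"
    using plane_lambda1_le[OF op fin \<phi>] unfolding N E .
  then have "plane_lambda1 ?Om \<le> (A' * B + A * B') / (A * B)"
    using Apos Bpos by (simp add: pos_le_divide_eq)
  also have "\<dots> = A' / A + B' / B" using Apos Bpos by (simp add: add_divide_distrib)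
  finally have "plane_lambda1 ?Om * (1 - 8 * e) \<le> (A' / A + B' / B) * (1 - 8 * e)"
    using pos by (intro mult_right_mono) auto
  also have "\<dots> = A' * ((1 - 8 * e) / A) + B' * ((1 - 8 * e) / B)"
    by (simp only: distrib_right times_divide_eq_left times_divide_eq_right)
  also have "\<dots> \<le> pi\<^sup>2 / 2 * 2 + pi\<^sup>2 / (2 * b) * (2 / b)"
  proof (intro add_mono mult_mono A' B')
    show "(1 - 8 * e) / A \<le> 2" using A Apos by (simp add: field_simps)
    show "(1 - 8 * e) / B \<le> 2 / b" using B Bpos b by (simp add: field_simps)
  qed (use pos Apos Bpos b in auto)
  also have "\<dots> = pi\<^sup>2 + pi\<^sup>2 / b\<^sup>2" by (simp add: power2_eq_square)
  finally show "plane_lambda1 ?Om * (1 - 8 * e) \<le> pi\<^sup>2 + pi\<^sup>2 / b\<^sup>2" .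
qed simp

lemma strip_infimum_bounds:
  assumes b: "0 < b" "b \<le> 1"
  shows "pi\<^sup>2 / b\<^sup>2 + 1 / 2000 \<le> strip_infimum b" and "strip_infimum b \<le> pi\<^sup>2 + pi\<^sup>2 / b\<^sup>2"
proof -
  let ?S = "{plane_lambda1 \<Omega> | \<Omega>. \<Omega> \<subseteq> strip b \<and> open \<Omega> \<and> \<Omega> \<noteq> {} \<and> emeasure lborel \<Omega> \<le> ennreal b}"
  have lower: "pi\<^sup>2 / b\<^sup>2 + 1 / 2000 \<le> x" if "x \<in> ?S" for x
  proof -
    obtain \<Omega> where x: "x = plane_lambda1 \<Omega>" and \<Omega>: "\<Omega> \<subseteq> strip b" "open \<Omega>" "\<Omega> \<noteq> {}" "emeasure lborel \<Omega> \<le> ennreal b"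
      using \<open>x \<in> ?S\<close> by blast
    have "emeasure lborel \<Omega> < \<infinity>" using \<Omega>(4) by (rule le_less_trans) simp
    from plane_lambda1_ge[OF \<Omega>(2,3) this strip_energy_bound[OF b \<Omega>(2,1,4)]] show ?thesis unfolding x .
  qed
  have "emeasure lborel ({0<..<1::real} \<times> {0<..<b}) = ennreal b"
    using b lborel.emeasure_pair_measure_Times[of "{0<..<1::real}" lborel "{0<..<b}"] by (simp add: lborel_prod)
  then have mem: "plane_lambda1 ({0<..<1::real} \<times> {0<..<b}) \<in> ?S"
    using b by (intro CollectI exI[of _ "{0<..<1::real} \<times> {0<..<b}"]) (auto simp: strip_def open_Times)
  show "pi\<^sup>2 / b\<^sup>2 + 1 / 2000 \<le> strip_infimum b"
    unfolding strip_infimum_def using mem lower by (intro cInf_greatest) blast+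
  \<comment> \<open>A real infimum lies below the members of its set only if that set is bounded
    below, so the lower estimate is needed for the upper one as well.\<close>
  have "bdd_below ?S" using lower by (rule bdd_belowI)
  then have "strip_infimum b \<le> plane_lambda1 ({0<..<1::real} \<times> {0<..<b})"
    unfolding strip_infimum_def using mem by (intro cInf_lower)
  also have "\<dots> \<le> pi\<^sup>2 + pi\<^sup>2 / b\<^sup>2" by (rule rect_lambda1_le[OF b(1)])
  finally show "strip_infimum b \<le> pi\<^sup>2 + pi\<^sup>2 / b\<^sup>2" .
qed

lemma strip_transition_witness:
  assumes k: "k \<ge> 2"
  shows "\<exists>b. 1 / real k < b \<and> b \<in> {b. 0 < b \<and> b \<le> 1 \<and> strip_infimum b > (real k)\<^sup>2 * pi\<^sup>2}"
proof -
  \<comment> \<open>Makes 1/b^2 fall short of k^2 by 1/40000. The deficit pi^2/40000 is at most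
    16/40000, which is less than the gain 1/2000.\<close>
  define b where "b = 1 / sqrt ((real k)\<^sup>2 - 1 / 40000)"
  have k2: "(real k)\<^sup>2 \<ge> 4" using k power_mono[of 2 "real k" 2] by simp
  have s: "sqrt ((real k)\<^sup>2 - 1 / 40000) \<ge> 1" using k2 by simp
  have b: "0 < b" "b \<le> 1" using s k2 by (auto simp: b_def)
  have b2: "1 / b\<^sup>2 = (real k)\<^sup>2 - 1 / 40000" using k2 by (simp add: b_def power_divide)
  have lt: "1 / real k < b"
  proof -
    have "sqrt ((real k)\<^sup>2 - 1 / 40000) < sqrt ((real k)\<^sup>2)" by (intro real_sqrt_less_mono) simp
    then show ?thesis using s k unfolding b_def by (intro divide_strict_left_mono) auto
  qed
  have "pi\<^sup>2 \<le> 4\<^sup>2" using pi_less_4 by (intro power_mono) auto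
  then have "(real k)\<^sup>2 * pi\<^sup>2 < pi\<^sup>2 * (1 / b\<^sup>2) + 1 / 2000" unfolding b2 by (simp add: algebra_simps)
  also have "\<dots> \<le> strip_infimum b" using strip_infimum_bounds(1)[OF b] by simp
  finally have "b \<in> {b. 0 < b \<and> b \<le> 1 \<and> strip_infimum b > (real k)\<^sup>2 * pi\<^sup>2}" using b by simp
  with lt show ?thesis by blast
qed

section \<open>Test functions on the torus\<close>

definition lattice_vec :: "real \<Rightarrow> int \<Rightarrow> int \<Rightarrow> plane" where
  "lattice_vec b m n = (of_int m, of_int n * b)"

lemma lattice_vec_add: "lattice_vec b m n + lattice_vec b m' n' = lattice_vec b (m + m') (n + n')"
  and lattice_vec_zero: "lattice_vec b 0 0 = 0"
  by (simp_all add: lattice_vec_def distrib_right zero_prod_def)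

lemma circle_proj_eq_iff: "circle_proj L x = circle_proj L y \<longleftrightarrow> (\<exists>n::int. y = x + of_int n * L)"
proof
  assume eq: "circle_proj L x = circle_proj L y"
  have "y \<in> circle_proj L y" unfolding circle_proj_def by (rule range_eqI[of _ _ 0]) simp
  then show "\<exists>n::int. y = x + of_int n * L" unfolding eq[symmetric] by (auto simp: circle_proj_def)
next
  assume "\<exists>n::int. y = x + of_int n * L"
  then obtain n :: int where n: "y = x + of_int n * L" by blast
  show "circle_proj L x = circle_proj L y"
  proof
    show "circle_proj L x \<subseteq> circle_proj L y"
      unfolding circle_proj_def n by (auto simp: image_iff intro!: exI[of _ "_ - n"] simp: algebra_simps)
    show "circle_proj L y \<subseteq> circle_proj L x"
      unfolding circle_proj_def n by (auto simp: image_iff intro!: exI[of _ "_ + n"] simp: algebra_simps)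
  qed
qed

lemma torus_proj_eq_iff: "torus_proj b p = torus_proj b q \<longleftrightarrow> (\<exists>m n. q = p + lattice_vec b m n)"
  unfolding torus_proj_def lattice_vec_def by (auto simp: circle_proj_eq_iff prod_eq_iff)

lemma torus_proj_shift: "torus_proj b (p + lattice_vec b m n) = torus_proj b p"
  using torus_proj_eq_iff[of b p "p + lattice_vec b m n"] by auto

lemma topspace_torus: "topspace (torus b) = range (torus_proj b)"
  unfolding torus_def topspace_prod_topology topspace_circle torus_proj_def
  by (auto simp: image_iff)

lemma continuous_map_torus_proj: "continuous_map euclidean (torus b) (torus_proj b)"
proof -
  have c: "continuous_map euclidean (circle L) (circle_proj L)" for L
    by (rule quotient_imp_continuous_map[OF quotient_map_circle_proj])
  have "continuous_map euclidean (circle 1) (circle_proj 1 \<circ> (fst :: plane \<Rightarrow> real))"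
    "continuous_map euclidean (circle b) (circle_proj b \<circ> (snd :: plane \<Rightarrow> real))"
    by (rule continuous_map_compose[OF _ c]; auto intro: continuous_intros)+
  then show ?thesis
    unfolding torus_def continuous_map_pairwise by (simp add: torus_proj_def o_def)
qed

lemma open_torus_vimage: "openin (torus b) D \<Longrightarrow> open (torus_proj b -` D)"
  using openin_continuous_map_preimage[OF continuous_map_torus_proj] by (simp add: vimage_def)

lemma openin_circle_image: "open A \<Longrightarrow> openin (circle L) (circle_proj L ` A)"
proof -
  assume A: "open A"
  have "circle_proj L -` (circle_proj L ` A) = (\<Union>n::int. (\<lambda>x. of_int n * L + x) ` A)"
  proof (intro equalityI subsetI)
    fix x assume "x \<in> circle_proj L -` (circle_proj L ` A)"
    then obtain a where a: "a \<in> A" "circle_proj L a = circle_proj L x" by force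
    then obtain n :: int where "x = a + of_int n * L" by (auto simp only: circle_proj_eq_iff)
    then have "x = of_int n * L + a" by simp
    then have "x \<in> (\<lambda>x. of_int n * L + x) ` A" using a(1) by (rule image_eqI)
    then show "x \<in> (\<Union>n::int. (\<lambda>x. of_int n * L + x) ` A)" by blast
  next
    fix x assume "x \<in> (\<Union>n::int. (\<lambda>x. of_int n * L + x) ` A)"
    then obtain n :: int and a where "a \<in> A" "x = of_int n * L + a" by auto
    then have a: "a \<in> A" "x = a + of_int n * L" by simp_all
    then have "circle_proj L a = circle_proj L x" by (auto simp: circle_proj_eq_iff)
    with a(1) show "x \<in> circle_proj L -` (circle_proj L ` A)" by auto
  qed
  then show ?thesis
    unfolding openin_circle using A by (auto intro: open_translation)
qed

lemma openin_torus_image: "open U \<Longrightarrow> openin (torus b) (torus_proj b ` U)"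
  unfolding torus_def openin_prod_topology_alt
proof (intro allI impI)
  fix x y assume U: "open U" and "(x, y) \<in> torus_proj b ` U"
  then obtain p where p: "p \<in> U" "x = circle_proj 1 (fst p)" "y = circle_proj b (snd p)"
    by (auto simp: torus_proj_def)
  obtain A B where AB: "open A" "open B" "p \<in> A \<times> B" "A \<times> B \<subseteq> U"
    using open_prod_elim[OF U p(1)] by blast
  have "circle_proj 1 ` A \<times> circle_proj b ` B \<subseteq> torus_proj b ` U"
  proof clarsimp
    fix s t assume "s \<in> A" "t \<in> B"
    then have "(s, t) \<in> U" using AB by auto
    then have "torus_proj b (s, t) \<in> torus_proj b ` U" by (rule imageI)
    then show "(circle_proj 1 s, circle_proj b t) \<in> torus_proj b ` U" by (simp add: torus_proj_def)
  qed
  then show "\<exists>U' V. openin (circle 1) U' \<and> openin (circle b) V \<and> x \<in> U' \<and> y \<in> V \<and> U' \<times> V \<subseteq> torus_proj b ` U"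
    using AB p by (intro exI[of _ "circle_proj 1 ` A"] exI[of _ "circle_proj b ` B"])
      (auto simp: openin_circle_image mem_Times_iff)
qed

text \<open>Passage to doubly periodic functions on the plane, where all later work takes place. The
  support condition transfers in one direction because the projection is continuous, in the other
  because it is open.\<close>

lemma mem_torus_test:
  "\<phi> \<in> torus_test b \<omega> \<longleftrightarrow> smooth \<phi> \<and> (\<forall>p m n. \<phi> (p + lattice_vec b m n) = \<phi> p)
     \<and> closure {p. \<phi> p \<noteq> 0} \<subseteq> torus_proj b -` \<omega>"
proof
  assume "\<phi> \<in> torus_test b \<omega>"
  then obtain f where f: "\<phi> = f \<circ> torus_proj b" "smooth (f \<circ> torus_proj b)"
    "torus b closure_of {t \<in> topspace (torus b). f t \<noteq> 0} \<subseteq> \<omega>"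
    unfolding torus_test_def by blast
  have "torus_proj b p \<in> torus b closure_of {t \<in> topspace (torus b). f t \<noteq> 0}" if "p \<in> closure {p. \<phi> p \<noteq> 0}" for p
    unfolding in_closure_of
  proof (intro conjI allI impI)
    show "torus_proj b p \<in> topspace (torus b)" by (simp add: topspace_torus)
    fix T assume T: "torus_proj b p \<in> T \<and> openin (torus b) T"
    then have "torus_proj b -` T \<inter> {p. \<phi> p \<noteq> 0} \<noteq> {}"
      using not_in_closureI[OF open_torus_vimage[of b T], of p "{p. \<phi> p \<noteq> 0}"] that by auto
    then obtain q where "torus_proj b q \<in> T" "\<phi> q \<noteq> 0" by blast
    then show "\<exists>y. y \<in> {t \<in> topspace (torus b). f t \<noteq> 0} \<and> y \<in> T"
      unfolding f(1) topspace_torus by (intro exI[of _ "torus_proj b q"]) auto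
  qed
  with f show "smooth \<phi> \<and> (\<forall>p m n. \<phi> (p + lattice_vec b m n) = \<phi> p) \<and> closure {p. \<phi> p \<noteq> 0} \<subseteq> torus_proj b -` \<omega>"
    by (auto simp: torus_proj_shift)
next
  assume \<phi>: "smooth \<phi> \<and> (\<forall>p m n. \<phi> (p + lattice_vec b m n) = \<phi> p) \<and> closure {p. \<phi> p \<noteq> 0} \<subseteq> torus_proj b -` \<omega>"
  define f where "f t = \<phi> (SOME p. torus_proj b p = t)" for t
  have f: "f (torus_proj b p) = \<phi> p" for p
  proof -
    have "torus_proj b (SOME q. torus_proj b q = torus_proj b p) = torus_proj b p" by (rule someI[of _ p]) simp
    then obtain m n where "p = (SOME q. torus_proj b q = torus_proj b p) + lattice_vec b m n"
      unfolding torus_proj_eq_iff by blast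
    then show ?thesis unfolding f_def using \<phi> by metis
  qed
  have "torus b closure_of {t \<in> topspace (torus b). f t \<noteq> 0} \<subseteq> \<omega>"
  proof
    fix t assume t: "t \<in> torus b closure_of {t \<in> topspace (torus b). f t \<noteq> 0}"
    then obtain p where p: "t = torus_proj b p"
      unfolding in_closure_of topspace_torus by auto
    have "p \<in> closure {p. \<phi> p \<noteq> 0}"
      unfolding closure_iff_nhds_not_empty
    proof (intro allI impI)
      fix A V assume AV: "V \<subseteq> A" "open V" "p \<in> V"
      then have "openin (torus b) (torus_proj b ` V)" "t \<in> torus_proj b ` V" using p by (auto simp: openin_torus_image)
      then obtain s where "f s \<noteq> 0" "s \<in> torus_proj b ` V" using t unfolding in_closure_of by blast
      then obtain q where "q \<in> V" "\<phi> q \<noteq> 0" using f by auto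
      then show "{p. \<phi> p \<noteq> 0} \<inter> A \<noteq> {}" using AV by blast
    qed
    then show "t \<in> \<omega>" using \<phi> p by auto
  qed
  moreover have "\<phi> = f \<circ> torus_proj b" using f by (auto simp: fun_eq_iff)
  ultimately show "\<phi> \<in> torus_test b \<omega>" unfolding torus_test_def using \<phi> by blast
qed

abbreviation cell_measure :: "real \<Rightarrow> plane measure" where
  "cell_measure b \<equiv> restrict_space lborel ({0..<1} \<times> {0..<b})"

lemma cell_sets: "{0..<1} \<times> {0..<b} \<in> sets (borel :: plane measure)"
  by (intro borel_Times) auto

lemma
  fixes F :: "plane \<Rightarrow> real"
  assumes F: "continuous_on UNIV F"
  shows cell_integrable: "integrable (cell_measure b) F"
    and cell_integral: "(\<integral>p. F p \<partial>cell_measure b) = integral (cbox (0, 0) (1, b)) F"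
  using rect_lebesgue[OF F, of 0 1 0 b] cell_sets[of b]
  by (simp_all add: integrable_restrict_space integral_restrict_space)

text \<open>The period cell is tiled by finitely many grid cells, so the mean value terms of all of
  them can be kept.\<close>

lemma torus_compactness:
  assumes b: "b > 0" and \<epsilon>: "\<epsilon> > 0"
  shows "\<exists>F C. finite F \<and> (\<forall>A\<in>F. A \<in> sets (cell_measure b) \<and> emeasure (cell_measure b) A < \<infinity>) \<and> 0 \<le> C \<and>
    (\<forall>\<phi>\<in>torus_test b \<omega>. (\<integral>p. (\<phi> p)\<^sup>2 \<partial>cell_measure b) \<le> \<epsilon> * (\<integral>p. (norm (grad \<phi> p))\<^sup>2 \<partial>cell_measure b)
      + C * (\<Sum>A\<in>F. (\<integral>p. indicator A p * \<phi> p \<partial>cell_measure b)\<^sup>2))"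
proof -
  obtain n :: nat where n: "(1 + b) / sqrt \<epsilon> < real n" using reals_Archimedean2 by blast
  have n0: "n > 0" using n b \<epsilon> by (cases n) (auto simp: divide_less_0_iff)
  \<comment> \<open>A single number dominating both side lengths 1/n and b/n.\<close>
  define h where "h = (1 + b) / real n"
  define h\<^sub>1 where "h\<^sub>1 = 1 / real n"
  define h\<^sub>2 where "h\<^sub>2 = b / real n"
  have h: "0 < h\<^sub>1" "h\<^sub>1 \<le> h" "0 < h\<^sub>2" "h\<^sub>2 \<le> h" using n0 b by (auto simp: h\<^sub>1_def h\<^sub>2_def h_def divide_right_mono)
  have "h \<le> sqrt \<epsilon>" using n n0 \<epsilon> by (simp add: h_def field_simps)
  then have h\<epsilon>: "h\<^sup>2 \<le> \<epsilon>" using h \<epsilon> by (metis less_imp_le order_trans power_mono real_sqrt_pow2)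
  define Q where "Q = grid_cell h\<^sub>1 h\<^sub>2"
  let ?I = "{0..<int n} \<times> {0..<int n}"
  let ?S = "{0..<1} \<times> {0..<b} :: plane set"
  have big: "{of_int 0 * h\<^sub>1..<of_int (int n) * h\<^sub>1} \<times> {of_int 0 * h\<^sub>2..<of_int (int n) * h\<^sub>2} = ?S"
    using n0 by (simp add: h\<^sub>1_def h\<^sub>2_def)
  have QS: "Q z \<subseteq> ?S" if "z \<in> ?I" for z
  proof
    fix p assume "p \<in> Q z"
    then have z: "(\<lfloor>fst p / h\<^sub>1\<rfloor>, \<lfloor>snd p / h\<^sub>2\<rfloor>) = z" using h by (simp add: Q_def grid_cell_iff)
    have "\<lfloor>fst p / h\<^sub>1\<rfloor> \<in> {0..<int n}" "\<lfloor>snd p / h\<^sub>2\<rfloor> \<in> {0..<int n}" using that z by auto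
    then show "p \<in> ?S"
      unfolding big[symmetric] mem_Times_iff cells_floor[OF h(1)] cells_floor[OF h(3)] by simp
  qed
  have Qm: "Q z \<in> sets borel" for z unfolding Q_def grid_cell_def by (intro borel_Times) auto
  have inj: "inj_on Q ?I"
  proof (rule inj_onI)
    fix z z' assume eq: "Q z = Q z'"
    have "(of_int (fst z) * h\<^sub>1, of_int (snd z) * h\<^sub>2) \<in> Q z" using h by (simp add: Q_def grid_cell_iff)
    moreover from this have "(of_int (fst z) * h\<^sub>1, of_int (snd z) * h\<^sub>2) \<in> Q z'" unfolding eq .
    ultimately show "z = z'" using h unfolding Q_def by (simp add: grid_cell_iff)
  qed
  have fin: "emeasure (cell_measure b) (Q z) < \<infinity>" if "z \<in> ?I" for z
  proof -
    have "bounded (Q z)" unfolding Q_def grid_cell_def by (intro bounded_Times) auto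
    then have "emeasure lborel (Q z) < \<infinity>" by (rule emeasure_bounded_finite)
    then show ?thesis using QS[OF that] cell_sets[of b] by (simp add: emeasure_restrict_space)
  qed
  have Qint: "(\<integral>p. indicator (Q z) p * F p \<partial>cell_measure b) = (\<integral>p. indicator (Q z) p * F p \<partial>lborel)"
    if "z \<in> ?I" for z and F :: "plane \<Rightarrow> real"
  proof -
    have e: "indicator ?S p *\<^sub>R (indicator (Q z) p * F p) = indicator (Q z) p * F p" for p
      using QS[OF that] by (auto simp: indicator_def)
    have "(\<integral>p. indicator (Q z) p * F p \<partial>cell_measure b) = (\<integral>p. indicator ?S p *\<^sub>R (indicator (Q z) p * F p) \<partial>lborel)"
      using cell_sets[of b] by (intro integral_restrict_space) simp
    then show ?thesis unfolding e .
  qed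
  have Sint: "(\<integral>p. F p \<partial>cell_measure b) = (\<Sum>z\<in>?I. \<integral>p. indicator (Q z) p * F p \<partial>lborel)"
    if "continuous_on UNIV F" for F :: "plane \<Rightarrow> real"
    using grid_split[OF h(1,3) that, of 0 "int n"] cell_sets[of b] unfolding big Q_def
    by (simp add: integral_restrict_space)
  have main: "(\<integral>p. (\<phi> p)\<^sup>2 \<partial>cell_measure b) \<le> \<epsilon> * (\<integral>p. (norm (grad \<phi> p))\<^sup>2 \<partial>cell_measure b)
      + 1 / (h\<^sub>1 * h\<^sub>2) * (\<Sum>A\<in>Q ` ?I. (\<integral>p. indicator A p * \<phi> p \<partial>cell_measure b)\<^sup>2)" if "smooth \<phi>" for \<phi>
  proof -
    have c2: "continuous_on UNIV (\<lambda>p. (\<phi> p)\<^sup>2)" "continuous_on UNIV (\<lambda>p. (norm (grad \<phi> p))\<^sup>2)"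
      by (intro continuous_intros smooth_continuous smooth_grad_cont that)+
    have "(\<integral>p. (\<phi> p)\<^sup>2 \<partial>cell_measure b) \<le> (\<Sum>z\<in>?I. h\<^sup>2 * (\<integral>p. indicator (Q z) p * (norm (grad \<phi> p))\<^sup>2 \<partial>lborel)
      + (\<integral>p. indicator (Q z) p * \<phi> p \<partial>lborel)\<^sup>2 / (h\<^sub>1 * h\<^sub>2))"
      unfolding Sint[OF c2(1)] Q_def by (intro sum_mono Poincare_cell h that)
    also have "\<dots> = h\<^sup>2 * (\<integral>p. (norm (grad \<phi> p))\<^sup>2 \<partial>cell_measure b)
      + 1 / (h\<^sub>1 * h\<^sub>2) * (\<Sum>z\<in>?I. (\<integral>p. indicator (Q z) p * \<phi> p \<partial>lborel)\<^sup>2)"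
      unfolding Sint[OF c2(2)] sum.distrib sum_distrib_left by simp
    also have "(\<Sum>z\<in>?I. (\<integral>p. indicator (Q z) p * \<phi> p \<partial>lborel)\<^sup>2) = (\<Sum>A\<in>Q ` ?I. (\<integral>p. indicator A p * \<phi> p \<partial>cell_measure b)\<^sup>2)"
      unfolding sum.reindex[OF inj] o_def by (intro sum.cong refl) (simp only: Qint)
    also have "h\<^sup>2 * (\<integral>p. (norm (grad \<phi> p))\<^sup>2 \<partial>cell_measure b) \<le> \<epsilon> * (\<integral>p. (norm (grad \<phi> p))\<^sup>2 \<partial>cell_measure b)"
      by (intro mult_right_mono h\<epsilon>) simp
    finally show ?thesis by simp
  qed
  have "Q z \<in> sets (cell_measure b)" if "z \<in> ?I" for z
    using QS[OF that] Qm[of z] cell_sets[of b] by (subst sets_restrict_space_iff) auto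
  with main fin h show ?thesis
    by (intro exI[of _ "Q ` ?I"] exI[of _ "1 / (h\<^sub>1 * h\<^sub>2)"]) (auto simp: mem_torus_test)
qed

lemma torus_test_bump:
  assumes \<epsilon>: "0 < \<epsilon>" and w: "0 < w" "w \<le> 1" "w \<le> b"
    and sub: "{x\<^sub>0<..<x\<^sub>0 + w} \<times> {y\<^sub>0<..<y\<^sub>0 + w} \<subseteq> torus_proj b -` \<omega>"
  shows "(\<lambda>p. periodic_bump \<epsilon> w 1 (fst p + - x\<^sub>0) * periodic_bump \<epsilon> w b (snd p + - y\<^sub>0)) \<in> torus_test b \<omega>"
  unfolding mem_torus_test
proof (intro conjI allI subsetI)
  let ?\<phi> = "\<lambda>p. periodic_bump \<epsilon> w 1 (fst p + - x\<^sub>0) * periodic_bump \<epsilon> w b (snd p + - y\<^sub>0)"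
  have sx: "smooth (\<lambda>p. fst p + - x\<^sub>0)" and sy: "smooth (\<lambda>p. snd p + - y\<^sub>0)"
    by (intro smooth_add smooth_const smooth_fst smooth_snd)+
  show "smooth ?\<phi>"
    by (intro smooth_mult smooth_periodic_bump[OF \<epsilon> w(1,2) sx] smooth_periodic_bump[OF \<epsilon> w(1,3) sy])
  show "?\<phi> (p + lattice_vec b m n) = ?\<phi> p" for p m n
    using periodic_bump_periodic[of 1 \<epsilon> w "fst p + - x\<^sub>0" m] periodic_bump_periodic[of b \<epsilon> w "snd p + - y\<^sub>0" n] w
    by (simp add: lattice_vec_def algebra_simps)
  fix p assume p: "p \<in> closure {p. ?\<phi> p \<noteq> 0}"
  have "p \<in> closure {p. periodic_bump \<epsilon> w 1 (fst p + - x\<^sub>0) \<noteq> 0}"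
    by (rule subsetD[OF closure_mono p]) auto
  from periodic_bump_support[OF \<epsilon> w(1,2) sx this] obtain m :: int
    where m: "0 < fst p + - x\<^sub>0 - of_int m * 1" "fst p + - x\<^sub>0 - of_int m * 1 < w" by blast
  have "p \<in> closure {p. periodic_bump \<epsilon> w b (snd p + - y\<^sub>0) \<noteq> 0}"
    by (rule subsetD[OF closure_mono p]) auto
  from periodic_bump_support[OF \<epsilon> w(1,3) sy this] obtain n :: int
    where n: "0 < snd p + - y\<^sub>0 - of_int n * b" "snd p + - y\<^sub>0 - of_int n * b < w" by blast
  have "p + lattice_vec b (- m) (- n) \<in> {x\<^sub>0<..<x\<^sub>0 + w} \<times> {y\<^sub>0<..<y\<^sub>0 + w}"
    using m n by (auto simp: lattice_vec_def mem_Times_iff)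
  from subsetD[OF sub this] show "p \<in> torus_proj b -` \<omega>"
    unfolding vimage_eq torus_proj_shift .
qed

lemma torus_dirichlet_space:
  assumes b: "b > 0" and \<omega>: "openin (torus b) \<omega>" "\<omega> \<noteq> {}"
  shows "dirichlet_space (cell_measure b) (torus_test b \<omega>)"
proof
  fix \<phi> \<psi> c assume \<phi>: "\<phi> \<in> torus_test b \<omega>" and \<psi>: "\<psi> \<in> torus_test b \<omega>"
  then have s: "smooth \<phi>" "smooth \<psi>" by (auto simp: mem_torus_test)
  have "smooth (\<lambda>p. \<phi> p + c * \<psi> p)" by (intro smooth_add smooth_mult smooth_const s)
  then show "(\<lambda>p. \<phi> p + c * \<psi> p) \<in> torus_test b \<omega>"
    using \<phi> \<psi> support_add[of \<phi> c \<psi>] unfolding mem_torus_test by auto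
  show "grad (\<lambda>p. \<phi> p + c * \<psi> p) p = grad \<phi> p + c *\<^sub>R grad \<psi> p" for p
    by (rule smooth_grad_add[OF s])
next
  fix \<phi> assume "\<phi> \<in> torus_test b \<omega>"
  then have s: "smooth \<phi>" by (auto simp: mem_torus_test)
  have c: "continuous_on UNIV (\<lambda>p. (norm (\<phi> p))\<^sup>2)" "continuous_on UNIV (\<lambda>p. (norm (grad \<phi> p))\<^sup>2)"
    by (intro continuous_intros smooth_continuous smooth_grad_cont s)+
  have "\<phi> \<in> borel_measurable (cell_measure b)" "grad \<phi> \<in> borel_measurable (cell_measure b)"
    using borel_measurable_continuous_onI[OF smooth_continuous[OF s]]
      borel_measurable_continuous_onI[OF smooth_grad_cont[OF s]] by (auto intro!: measurable_restrict_space1)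
  then show "sq_int (cell_measure b) \<phi>" "sq_int (cell_measure b) (grad \<phi>)"
    unfolding sq_int_def using cell_integrable[OF c(1)] cell_integrable[OF c(2)] by auto
next
  fix \<epsilon> :: real assume "\<epsilon> > 0"
  from torus_compactness[OF b this]
  show "\<exists>F C. finite F \<and> (\<forall>A\<in>F. A \<in> sets (cell_measure b) \<and> emeasure (cell_measure b) A < \<infinity>) \<and> 0 \<le> C \<and>
    (\<forall>\<phi>\<in>torus_test b \<omega>. (\<integral>p. (\<phi> p)\<^sup>2 \<partial>cell_measure b) \<le> \<epsilon> * (\<integral>p. (norm (grad \<phi> p))\<^sup>2 \<partial>cell_measure b)
      + C * (\<Sum>A\<in>F. (\<integral>p. indicator A p * \<phi> p \<partial>cell_measure b)\<^sup>2))" .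
next
  obtain t where t: "t \<in> \<omega>" using \<omega> by blast
  then obtain p where p: "p \<in> torus_proj b -` \<omega>"
    using openin_subset[OF \<omega>(1)] by (auto simp: topspace_torus)
  define q where "q = p + lattice_vec b (- \<lfloor>fst p\<rfloor>) (- \<lfloor>snd p / b\<rfloor>)"
  have q: "q \<in> torus_proj b -` \<omega>" using p unfolding q_def by (simp only: vimage_eq torus_proj_shift)
  have "of_int \<lfloor>snd p / b\<rfloor> * b \<le> snd p"
    using of_int_floor_le[of "snd p / b"] b by (simp only: pos_le_divide_eq)
  moreover have "snd p < (of_int \<lfloor>snd p / b\<rfloor> + 1) * b"
    using real_of_int_floor_add_one_gt[of "snd p / b"] b by (simp only: pos_divide_less_eq)
  ultimately have qb: "0 \<le> snd q" "snd q < b" by (auto simp: q_def lattice_vec_def algebra_simps)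
  have qa: "0 \<le> fst q" "fst q < 1" unfolding q_def lattice_vec_def by (auto, linarith+)
  obtain w where w: "w > 0" "{fst q - w / 2<..<fst q - w / 2 + w} \<times> {snd q - w / 2<..<snd q - w / 2 + w} \<subseteq> torus_proj b -` \<omega>"
    by (rule open_contains_rect[OF open_torus_vimage[OF \<omega>(1)] q])
  \<comment> \<open>The bump is placed on the square of side d with lower left corner q. That square
    fits both into the lifted domain and into the period cell, so the mass is seen by the cell
    measure without wrapping around.\<close>
  define d where "d = min (w / 2) (min ((1 - fst q) / 2) ((b - snd q) / 2))"
  have d: "d > 0" "d \<le> w / 2" "d \<le> (1 - fst q) / 2" "d \<le> (b - snd q) / 2"
  proof -
    show "d > 0" using w qa qb by (simp add: d_def)
  qed (auto simp only: d_def intro: min.coboundedI1 min.coboundedI2)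
  let ?\<phi> = "\<lambda>p. periodic_bump (1/2) d 1 (fst p + - fst q) * periodic_bump (1/2) d b (snd p + - snd q)"
  have \<phi>: "?\<phi> \<in> torus_test b \<omega>"
  proof (rule torus_test_bump)
    have "{fst q<..<fst q + d} \<times> {snd q<..<snd q + d}
        \<subseteq> {fst q - w / 2<..<fst q - w / 2 + w} \<times> {snd q - w / 2<..<snd q - w / 2 + w}"
      using d by (intro Sigma_mono) auto
    then show "{fst q<..<fst q + d} \<times> {snd q<..<snd q + d} \<subseteq> torus_proj b -` \<omega>" using w(2) by (rule order_trans)
  qed (use d qa qb in auto)
  then have sm: "smooth ?\<phi>" by (auto simp: mem_torus_test)
  let ?r = "q + (d / 2, d / 2)"
  have "periodic_bump (1/2) d 1 (d / 2) = sine_bump (1/2) d (d / 2)" "periodic_bump (1/2) d b (d / 2) = sine_bump (1/2) d (d / 2)"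
    using periodic_bump_base[of 1 0 "d / 2" "1/2" d] periodic_bump_base[of b 0 "d / 2" "1/2" d] d qa qb b by auto
  then have "?\<phi> ?r \<noteq> 0" using sine_bump_at_mid[of "1/2" d] d(1) by simp
  moreover have "?r \<in> {0<..<1} \<times> {0<..<b}" using d qa qb by (auto simp: mem_Times_iff)
  moreover have "integrable lborel (\<lambda>p. indicator ({0..<1} \<times> {0..<b}) p * (?\<phi> p)\<^sup>2)"
    by (intro rect_lebesgue continuous_on_power smooth_continuous sm)
  ultimately have "(\<integral>p. indicator ({0..<1} \<times> {0..<b}) p * (?\<phi> p)\<^sup>2 \<partial>lborel) > 0"
    by (intro integral_pos_of_continuous[of _ "{0<..<1} \<times> {0<..<b}" _ ?r] smooth_continuous sm cell_sets)
      (auto intro: open_Times)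
  then show "\<exists>\<phi>\<in>torus_test b \<omega>. (\<integral>p. (\<phi> p)\<^sup>2 \<partial>cell_measure b) > 0"
    using \<phi> cell_sets[of b] by (intro bexI[of _ ?\<phi>]) (auto simp: integral_restrict_space)
qed

text \<open>After this point the weak equation is no longer needed: torus eigenvalues enter only
  through these two statements on Rayleigh quotients over the closed period cell.\<close>

lemma
  assumes b: "b > 0" and \<omega>: "openin (torus b) \<omega>" "\<omega> \<noteq> {}"
  shows torus_lambda1_le: "\<phi> \<in> torus_test b \<omega> \<Longrightarrow> torus_lambda1 b \<omega> * integral (cbox (0, 0) (1, b)) (\<lambda>p. (\<phi> p)\<^sup>2)
      \<le> integral (cbox (0, 0) (1, b)) (\<lambda>p. (norm (grad \<phi> p))\<^sup>2)"
    and torus_lambda1_approx: "torus_lambda1 b \<omega> < c \<Longrightarrow> \<exists>\<phi>\<in>torus_test b \<omega>. integral (cbox (0, 0) (1, b)) (\<lambda>p. (\<phi> p)\<^sup>2) > 0 \<and>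
      integral (cbox (0, 0) (1, b)) (\<lambda>p. (norm (grad \<phi> p))\<^sup>2) < c * integral (cbox (0, 0) (1, b)) (\<lambda>p. (\<phi> p)\<^sup>2)"
proof -
  interpret dirichlet_space "cell_measure b" "torus_test b \<omega>" by (rule torus_dirichlet_space[OF assms])
  have l: "torus_lambda1 b \<omega> = rayleigh_inf" unfolding torus_lambda1_def by (rule least_eigenvalue)
  have NE: "N \<phi> = integral (cbox (0, 0) (1, b)) (\<lambda>p. (\<phi> p)\<^sup>2)" "E \<phi> = integral (cbox (0, 0) (1, b)) (\<lambda>p. (norm (grad \<phi> p))\<^sup>2)"
    if "\<phi> \<in> torus_test b \<omega>" for \<phi>
  proof -
    have s: "smooth \<phi>" using that by (simp add: mem_torus_test)
    show "N \<phi> = integral (cbox (0, 0) (1, b)) (\<lambda>p. (\<phi> p)\<^sup>2)"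
      unfolding N_def by (intro cell_integral continuous_on_power smooth_continuous s)
    show "E \<phi> = integral (cbox (0, 0) (1, b)) (\<lambda>p. (norm (grad \<phi> p))\<^sup>2)"
      unfolding E_def by (intro cell_integral continuous_on_power continuous_on_norm smooth_grad_cont s)
  qed
  show "torus_lambda1 b \<omega> * integral (cbox (0, 0) (1, b)) (\<lambda>p. (\<phi> p)\<^sup>2)
      \<le> integral (cbox (0, 0) (1, b)) (\<lambda>p. (norm (grad \<phi> p))\<^sup>2)" if "\<phi> \<in> torus_test b \<omega>"
    using rayleigh_inf_le[OF that] unfolding l NE[OF that] .
  assume "torus_lambda1 b \<omega> < c"
  then have "c - rayleigh_inf > 0" by (simp add: l)
  from rayleigh_inf_approx[OF this] obtain \<phi> where \<phi>: "\<phi> \<in> torus_test b \<omega>" "N \<phi> > 0" "E \<phi> < c * N \<phi>" by auto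
  then show "\<exists>\<phi>\<in>torus_test b \<omega>. integral (cbox (0, 0) (1, b)) (\<lambda>p. (\<phi> p)\<^sup>2) > 0 \<and>
      integral (cbox (0, 0) (1, b)) (\<lambda>p. (norm (grad \<phi> p))\<^sup>2) < c * integral (cbox (0, 0) (1, b)) (\<lambda>p. (\<phi> p)\<^sup>2)"
    by (intro bexI[of _ \<phi>]) (simp_all add: NE)
qed

section \<open>Twisted lifts and loops\<close>

lemma connected_component_translate:
  fixes W :: "plane set"
  assumes W: "\<And>p. p \<in> W \<Longrightarrow> p + v \<in> W" and c: "connected_component W p q"
  shows "connected_component W (p + v) (q + v)"
proof -
  obtain T where T: "connected T" "T \<subseteq> W" "p \<in> T" "q \<in> T" using c unfolding connected_component_def by blast
  have "connected ((\<lambda>p. p + v) ` T)" by (intro connected_continuous_image continuous_intros T(1))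
  moreover have "(\<lambda>p. p + v) ` T \<subseteq> W" using T W by auto
  ultimately show ?thesis unfolding connected_component_def using T by blast
qed

lemma lift_shift: "p \<in> torus_proj b -` D \<longleftrightarrow> p + lattice_vec b m n \<in> torus_proj b -` D"
  by (simp add: torus_proj_shift)

text \<open>Otherwise the translates of the component of p, and the union of all remaining
  components, would be disjoint open sets. The former is invariant under the lattice, so their
  images in the torus are disjoint as well, and open since the projection is; this would disconnect
  D.\<close>

lemma lift_components:
  assumes D: "openin (torus b) D" "connectedin (torus b) D" and p: "p \<in> torus_proj b -` D" and q: "q \<in> torus_proj b -` D"
  shows "\<exists>m n. connected_component (torus_proj b -` D) (p + lattice_vec b m n) q"
proof (rule ccontr)
  let ?W = "torus_proj b -` D"
  have W: "open ?W" by (rule open_torus_vimage[OF D(1)])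
  define U where "U = (\<Union>m n. connected_component_set ?W (p + lattice_vec b m n))"
  define V where "V = (\<Union>r\<in>?W - U. connected_component_set ?W r)"
  have oU: "open U" and oV: "open V" unfolding U_def V_def by (intro open_UN ballI open_connected_component W)+
  have U_shift: "r + lattice_vec b m n \<in> U" if r: "r \<in> U" for r m n
  proof -
    obtain m' n' where "connected_component ?W (p + lattice_vec b m' n') r" using r unfolding U_def by blast
    from connected_component_translate[OF _ this, of "lattice_vec b m n"]
    have "connected_component ?W (p + lattice_vec b m' n' + lattice_vec b m n) (r + lattice_vec b m n)"
      using lift_shift by blast
    then show ?thesis unfolding U_def by (auto simp: add.assoc lattice_vec_add)
  qed
  have U_comp: "s \<in> U" if "r \<in> U" "connected_component ?W r s" for r s
    using that connected_component_trans unfolding U_def by blast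
  have UV: "U \<inter> V = {}"
  proof (rule equals0I)
    fix s assume "s \<in> U \<inter> V"
    then obtain r where r: "r \<in> ?W - U" "connected_component ?W r s" "s \<in> U" unfolding V_def by blast
    from U_comp[OF r(3) connected_component_sym[OF r(2)]] r(1) show False by blast
  qed
  assume "\<not> ?thesis"
  then have qU: "q \<notin> U" unfolding U_def by blast
  have pU: "p \<in> U" unfolding U_def
    by (rule UN_I[of 0], simp, rule UN_I[of 0], simp) (use p in \<open>simp add: lattice_vec_zero\<close>)
  have qV: "q \<in> V" unfolding V_def by (rule UN_I[of q]) (use q qU in simp_all)
  have disj: "torus_proj b ` U \<inter> torus_proj b ` V = {}"
  proof (rule equals0I)
    fix t assume "t \<in> torus_proj b ` U \<inter> torus_proj b ` V"
    then obtain u v where uv: "u \<in> U" "v \<in> V" "torus_proj b u = torus_proj b v" by auto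
    then obtain m n where "v = u + lattice_vec b m n" unfolding torus_proj_eq_iff by blast
    then have "v \<in> U" using U_shift[OF uv(1)] by simp
    with UV uv(2) show False by blast
  qed
  have cover: "D \<subseteq> torus_proj b ` U \<union> torus_proj b ` V"
  proof
    fix t assume t: "t \<in> D"
    then obtain r where r: "t = torus_proj b r" using openin_subset[OF D(1)] by (auto simp: topspace_torus)
    then have "r \<in> ?W" using t by simp
    then have "r \<in> V" if "r \<notin> U" unfolding V_def using that by (intro UN_I[of r]) simp_all
    then show "t \<in> torus_proj b ` U \<union> torus_proj b ` V" using r by blast
  qed
  have "torus_proj b p \<in> torus_proj b ` U \<inter> D" "torus_proj b q \<in> torus_proj b ` V \<inter> D" using pU qV p q by auto
  then show False
    using D(2) cover disj openin_torus_image[OF oU, of b] openin_torus_image[OF oV, of b]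
    unfolding connectedin by blast
qed

text \<open>
  The sign is constant on each component of the lift, which is consistent because the lattice vectors
  preserving a component are those realized by loops in \<open>D\<close>.
\<close>

lemma twisted_lift:
  assumes D: "openin (torus b) D" "connectedin (torus b) D" and p: "p \<in> torus_proj b -` D"
    and \<sigma>1: "\<And>m n. \<sigma> m n = 1 \<or> \<sigma> m n = (-1::real)"
    and \<sigma>2: "\<And>m n m' n'. \<sigma> (m + m') (n + n') = \<sigma> m n * \<sigma> m' n'"
    and loops: "\<And>m n. connected_component (torus_proj b -` D) p (p + lattice_vec b m n) \<Longrightarrow> \<sigma> m n = 1"
    and \<phi>: "\<phi> \<in> torus_test b D"
  shows "\<exists>\<psi>. smooth \<psi> \<and> (\<forall>q m n. \<psi> (q + lattice_vec b m n) = \<sigma> m n * \<psi> q) \<and>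
    (\<forall>q. (\<psi> q)\<^sup>2 = (\<phi> q)\<^sup>2) \<and> (\<forall>q. norm (grad \<psi> q) = norm (grad \<phi> q))"
proof -
  let ?W = "torus_proj b -` D"
  have W: "open ?W" by (rule open_torus_vimage[OF D(1)])
  have sm: "smooth \<phi>" and per: "\<And>q m n. \<phi> (q + lattice_vec b m n) = \<phi> q" and sup: "closure {p. \<phi> p \<noteq> 0} \<subseteq> ?W"
    using \<phi> unfolding mem_torus_test by blast+
  define R where "R q z \<longleftrightarrow> connected_component ?W (p + lattice_vec b (fst z) (snd z)) q" for q z
  \<comment> \<open>The sign of a lattice vector that moves p into the component of q;
    \<open>s_eq\<close> shows that the choice does not matter. Off the lifted domain the value is an
    arbitrary sign, harmless because \<phi> vanishes there.\<close>
  define s where "s q = (let z = (SOME z. R q z) in \<sigma> (fst z) (snd z))" for q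
  have s1: "s q = 1 \<or> s q = -1" for q unfolding s_def Let_def by (rule \<sigma>1)
  have s_eq: "s q = \<sigma> m n" if cc: "connected_component ?W (p + lattice_vec b m n) q" for q m n
  proof -
    define z where "z = (SOME z. R q z)"
    have "R q (m, n)" unfolding R_def using cc by simp
    then have "R q z" unfolding z_def by (rule someI)
    then have "connected_component ?W (p + lattice_vec b (fst z) (snd z)) q" unfolding R_def .
    from connected_component_trans[OF cc connected_component_sym[OF this]]
    have "connected_component ?W (p + lattice_vec b m n) (p + lattice_vec b (fst z) (snd z))" .
    from connected_component_translate[OF _ this, of "lattice_vec b (- m) (- n)"]
    have "connected_component ?W (p + lattice_vec b m n + lattice_vec b (- m) (- n))
        (p + lattice_vec b (fst z) (snd z) + lattice_vec b (- m) (- n))"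
      using lift_shift by blast
    then have "connected_component ?W p (p + lattice_vec b (fst z - m) (snd z - n))"
      by (simp add: add.assoc lattice_vec_add lattice_vec_zero)
    then have "\<sigma> (fst z - m) (snd z - n) = 1" by (rule loops)
    then have "\<sigma> (fst z) (snd z) = \<sigma> m n" using \<sigma>2[of "fst z - m" m "snd z - n" n] by simp
    then show ?thesis unfolding s_def z_def Let_def .
  qed
  have s_comp: "s r = s q" if cc: "connected_component ?W q r" for q r
  proof -
    have "q \<in> ?W" using connected_component_in[OF cc] by simp
    then obtain m n where mn: "connected_component ?W (p + lattice_vec b m n) q"
      using lift_components[OF D p] by blast
    from s_eq[OF connected_component_trans[OF mn cc]] s_eq[OF mn] show ?thesis by simp
  qed
  have s_shift: "s (q + lattice_vec b m n) = \<sigma> m n * s q" if q: "q \<in> ?W" for q m n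
  proof -
    obtain m' n' where mn: "connected_component ?W (p + lattice_vec b m' n') q"
      using lift_components[OF D p q] by blast
    from connected_component_translate[OF _ this, of "lattice_vec b m n"]
    have "connected_component ?W (p + lattice_vec b m' n' + lattice_vec b m n) (q + lattice_vec b m n)"
      using lift_shift by blast
    then have "s (q + lattice_vec b m n) = \<sigma> (m' + m) (n' + n)"
      by (intro s_eq) (simp add: add.assoc lattice_vec_add)
    then show ?thesis using s_eq[OF mn] \<sigma>2[of m' m n' n] by simp
  qed
  define \<psi> where "\<psi> q = s q * \<phi> q" for q
  have loc: "\<exists>U. open U \<and> q \<in> U \<and> (\<forall>r\<in>U. \<psi> r = s q * \<phi> r)" for q
  proof (cases "q \<in> ?W")
    case True
    then show ?thesis
      using open_connected_component[OF W, of q]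
      by (intro exI[of _ "connected_component_set ?W q"]) (auto simp: \<psi>_def s_comp)
  next
    case False
    then have "q \<in> - closure {p. \<phi> p \<noteq> 0}" using sup by blast
    moreover have "\<psi> r = s q * \<phi> r" if "r \<in> - closure {p. \<phi> p \<noteq> 0}" for r
    proof -
      have "\<phi> r = 0" using that by (intro zero_outside) simp
      then show ?thesis by (simp add: \<psi>_def)
    qed
    ultimately show ?thesis by (intro exI[of _ "- closure {p. \<phi> p \<noteq> 0}"]) (simp add: open_Compl)
  qed
  have sms: "smooth (\<lambda>r. c * \<phi> r)" for c by (intro smooth_mult smooth_const sm)
  have "smooth \<psi>"
  proof (rule smooth_local)
    fix q
    obtain U where "open U" "q \<in> U" "\<forall>r\<in>U. \<psi> r = s q * \<phi> r" using loc by blast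
    then show "\<exists>U g. open U \<and> q \<in> U \<and> smooth g \<and> (\<forall>r\<in>U. \<psi> r = g r)" using sms by blast
  qed
  moreover have "\<psi> (q + lattice_vec b m n) = \<sigma> m n * \<psi> q" for q m n
  proof (cases "q \<in> ?W")
    case True
    then show ?thesis using s_shift[OF True] by (simp add: \<psi>_def per)
  next
    case False
    then have "q \<notin> closure {p. \<phi> p \<noteq> 0}" using sup by blast
    then have "\<phi> q = 0" by (rule zero_outside)
    then show ?thesis using per[of q m n] by (simp add: \<psi>_def)
  qed
  moreover have "(\<psi> q)\<^sup>2 = (\<phi> q)\<^sup>2" for q
    using s1[of q] by (auto simp: \<psi>_def power_mult_distrib)
  moreover have "norm (grad \<psi> q) = norm (grad \<phi> q)" for q
  proof -
    obtain U where U: "open U" "q \<in> U" "\<forall>r\<in>U. \<psi> r = s q * \<phi> r" using loc by blast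
    have "((\<lambda>r. s q * \<phi> r) has_derivative (\<lambda>h. h \<bullet> (s q *\<^sub>R grad \<phi> q))) (at q)"
      using smooth_GDERIV[OF sm, of q] unfolding gderiv_def by (auto intro!: derivative_eq_intros)
    then have "(\<psi> has_derivative (\<lambda>h. h \<bullet> (s q *\<^sub>R grad \<phi> q))) (at q)"
      by (rule has_derivative_transform_within_open[OF _ U(1,2)]) (use U(3) in simp)
    then have "grad \<psi> q = s q *\<^sub>R grad \<phi> q" by (intro grad_eq) (simp add: gderiv_def)
    then show ?thesis using s1[of q] by auto
  qed
  ultimately show ?thesis by blast
qed

section \<open>Crossings of lifted loops\<close>

lemma continuous_on_frac_periodic:
  fixes g :: "real \<Rightarrow> 'a::metric_space"
  assumes g: "continuous_on {0..1} g" and e: "g 0 = g 1"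
  shows "continuous_on UNIV (\<lambda>t. g (frac t))"
proof (rule continuous_at_imp_continuous_on, rule ballI)
  fix t :: real
  define n where "n = \<lfloor>t\<rfloor>"
  let ?h = "\<lambda>x. if x \<le> of_int n then g (x - of_int n + 1) else g (x - of_int n)"
  have "continuous_on ({of_int n - 1..of_int n} \<union> {of_int n..of_int n + 1}) ?h"
    by (rule continuous_on_If; (intro continuous_on_compose2[OF g] continuous_intros)?) (use e in auto)
  moreover have "{of_int n - 1<..<of_int n + 1} \<subseteq> {of_int n - 1..of_int n} \<union> {of_int n..of_int n + (1::real)}" by auto
  ultimately have ch: "continuous_on {of_int n - 1<..<of_int n + 1} ?h" by (rule continuous_on_subset)
  have eh: "g (frac x) = ?h x" if x: "x \<in> {of_int n - 1<..<of_int n + 1}" for x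
  proof -
    consider "x < of_int n" | "x = of_int n" | "x > of_int n" by linarith
    then show ?thesis
    proof cases
      case 1
      then have "\<lfloor>x\<rfloor> = n - 1" using x by (intro floor_unique) auto
      then show ?thesis using 1 unfolding frac_def \<open>\<lfloor>x\<rfloor> = n - 1\<close> by (simp add: algebra_simps)
    next
      case 3
      then have "\<lfloor>x\<rfloor> = n" using x by (intro floor_unique) auto
      then show ?thesis using 3 by (simp add: frac_def)
    qed (simp add: e)
  qed
  have "continuous_on {of_int n - 1<..<of_int n + 1} (\<lambda>t. g (frac t))"
    by (rule continuous_on_eq[OF ch eh[symmetric]])
  moreover have "t \<in> {of_int n - 1<..<of_int n + 1}" unfolding n_def by (auto, linarith+)
  ultimately show "isCont (\<lambda>t. g (frac t)) t"
    by (simp add: continuous_on_eq_continuous_at)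
qed

text \<open>
  After splitting off the linear parts, an intersection is a fixed point of a bounded continuous self-map of the plane.
\<close>

lemma periodic_curves_meet:
  fixes \<alpha> \<beta> :: "real \<Rightarrow> plane" and v w :: plane
  assumes c: "continuous_on UNIV \<alpha>" "continuous_on UNIV \<beta>" and bd: "\<And>t. norm (\<alpha> t) \<le> K" "\<And>t. norm (\<beta> t) \<le> K"
    and det: "fst v * snd w - snd v * fst w \<noteq> 0"
  shows "\<exists>t u. \<alpha> t + t *\<^sub>R v = \<beta> u + u *\<^sub>R w"
proof -
  define d where "d = fst v * snd w - snd v * fst w"
  define \<delta> where "\<delta> x = \<beta> (snd x) - \<alpha> (fst x)" for x :: plane
  \<comment> \<open>Cramer's rule: G x solves t v - u w = \<delta>(x) for (t, u). A fixed point x =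
    (t, u) is therefore a pair of parameters at which the curves meet, and G is bounded because
    \<delta> is.\<close>
  define G where "G x = ((fst (\<delta> x) * snd w - snd (\<delta> x) * fst w) / d, - ((fst v * snd (\<delta> x) - snd v * fst (\<delta> x)) / d))" for x
  have d: "d \<noteq> 0" using det by (simp add: d_def)
  have c\<delta>: "continuous_on UNIV \<delta>"
    unfolding \<delta>_def by (intro continuous_intros continuous_on_compose2[OF c(1)] continuous_on_compose2[OF c(2)]) auto
  have cG: "continuous_on UNIV G" unfolding G_def using d by (intro continuous_intros c\<delta>) auto
  have "norm (\<delta> x) \<le> 2 * K" for x
    unfolding \<delta>_def using norm_triangle_ineq4[of "\<beta> (snd x)" "\<alpha> (fst x)"] bd(1)[of "fst x"] bd(2)[of "snd x"] by linarith
  then have "range \<delta> \<subseteq> cball 0 (2 * K)" by auto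
  then have sub: "range G \<subseteq> (\<lambda>y. ((fst y * snd w - snd y * fst w) / d, - ((fst v * snd y - snd v * fst y) / d))) ` cball 0 (2 * K)"
    unfolding G_def by auto
  have "compact ((\<lambda>y::plane. ((fst y * snd w - snd y * fst w) / d, - ((fst v * snd y - snd v * fst y) / d))) ` cball 0 (2 * K))"
    using d by (intro compact_continuous_image continuous_intros compact_cball) auto
  then have "bounded (range G)" using sub compact_imp_bounded bounded_subset by blast
  then obtain B where B: "\<And>x. norm (G x) \<le> B" unfolding bounded_iff by auto
  obtain x where x: "G x = x"
  proof (rule brouwer[of "cball 0 B" G])
    show "cball (0 :: plane) B \<noteq> {}" using order_trans[OF norm_ge_zero B[of 0]] by simp
    show "G \<in> cball 0 B \<rightarrow> cball 0 B" using B by auto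
  qed (use cG in \<open>auto intro: continuous_on_subset\<close>)
  have f: "fst x = (fst (\<delta> x) * snd w - snd (\<delta> x) * fst w) / d" "snd x = - ((fst v * snd (\<delta> x) - snd v * fst (\<delta> x)) / d)"
    using x by (simp_all add: G_def prod_eq_iff)
  have "d * (fst x * fst v - snd x * fst w) = d * fst (\<delta> x)" "d * (fst x * snd v - snd x * snd w) = d * snd (\<delta> x)"
  proof -
    have e: "d * fst x = fst (\<delta> x) * snd w - snd (\<delta> x) * fst w" "d * snd x = - (fst v * snd (\<delta> x) - snd v * fst (\<delta> x))"
      unfolding f using d by simp_all
    have h: "d * (fst x * r - snd x * t) = (d * fst x) * r - (d * snd x) * t" for r t by (simp add: algebra_simps)
    show "d * (fst x * fst v - snd x * fst w) = d * fst (\<delta> x)" "d * (fst x * snd v - snd x * snd w) = d * snd (\<delta> x)"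
      unfolding h e by (simp_all add: d_def algebra_simps)
  qed
  then have "\<delta> x = fst x *\<^sub>R v - snd x *\<^sub>R w" using d by (simp add: prod_eq_iff)
  then have "\<alpha> (fst x) + fst x *\<^sub>R v = \<beta> (snd x) + snd x *\<^sub>R w"
    by (simp add: \<delta>_def algebra_simps)
  then show ?thesis by blast
qed

text \<open>A path from p to p + v, continued by translation, becomes a periodic and hence bounded
  curve once the linear part t v is subtracted. This is the form needed by
  \<open>periodic_curves_meet\<close>.\<close>

lemma loop_periodic_curve:
  fixes W :: "plane set"
  assumes W: "open W" "connected_component W p (p + v)" and per: "\<And>q n. q \<in> W \<Longrightarrow> q + of_int n *\<^sub>R v \<in> W"
  obtains \<alpha> K where "continuous_on UNIV \<alpha>" "\<forall>t. norm (\<alpha> t) \<le> K" "\<forall>t. \<alpha> t + t *\<^sub>R v \<in> W"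
proof -
  have "path_component W p (p + v)" using W by (simp add: open_path_connected_component)
  then obtain \<gamma> where \<gamma>: "path \<gamma>" "path_image \<gamma> \<subseteq> W" "pathstart \<gamma> = p" "pathfinish \<gamma> = p + v"
    unfolding path_component_def by blast
  define g where "g t = \<gamma> t - t *\<^sub>R v" for t
  have cg: "continuous_on {0..1} g" unfolding g_def using \<gamma>(1) by (intro continuous_intros) (simp add: path_def)
  have g01: "g 0 = g 1" using \<gamma>(3,4) by (simp add: g_def pathstart_def pathfinish_def)
  obtain K where K: "\<forall>t\<in>{0..1}. norm (g t) \<le> K"
    using compact_imp_bounded[OF compact_continuous_image[OF cg compact_Icc]] unfolding bounded_iff by auto
  have fr: "frac t \<in> {0..1}" for t :: real using frac_lt_1[of t] by (simp add: less_imp_le)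
  show ?thesis
  proof (rule that[of "\<lambda>t. g (frac t)" K])
    show "continuous_on UNIV (\<lambda>t. g (frac t))" by (rule continuous_on_frac_periodic[OF cg g01])
    show "\<forall>t. norm (g (frac t)) \<le> K" using K fr by blast
    have "g (frac t) + t *\<^sub>R v = \<gamma> (frac t) + of_int \<lfloor>t\<rfloor> *\<^sub>R v" for t
      by (simp add: g_def frac_def algebra_simps)
    moreover have "\<gamma> (frac t) \<in> W" for t using \<gamma>(2) fr by (auto simp: path_image_def)
    ultimately show "\<forall>t. g (frac t) + t *\<^sub>R v \<in> W" using per by simp
  qed
qed

text \<open>Lifted curves in non-parallel lattice directions cross, and the crossing point would lie
  over both domains. The quantity m n' - n m' is the intersection number of the two loop
  classes.\<close>

lemma disjoint_loops_parallel:
  assumes b: "b > 0" and D: "openin (torus b) D" "openin (torus b) D'" "D \<inter> D' = {}"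
    and l: "connected_component (torus_proj b -` D) p (p + lattice_vec b m n)"
    and l': "connected_component (torus_proj b -` D') p' (p' + lattice_vec b m' n')"
  shows "m * n' = n * m'"
proof (rule ccontr)
  assume ne: "m * n' \<noteq> n * m'"
  have per: "q + of_int k *\<^sub>R lattice_vec b i j \<in> torus_proj b -` E" if "q \<in> torus_proj b -` E" for q k i j E
  proof -
    have "of_int k *\<^sub>R lattice_vec b i j = lattice_vec b (k * i) (k * j)" by (simp add: lattice_vec_def)
    then show ?thesis using that lift_shift by simp
  qed
  obtain \<alpha> K where \<alpha>: "continuous_on UNIV \<alpha>" "\<forall>t. norm (\<alpha> t) \<le> K" "\<forall>t. \<alpha> t + t *\<^sub>R lattice_vec b m n \<in> torus_proj b -` D"
    by (rule loop_periodic_curve[OF open_torus_vimage[OF D(1)] l per])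
  obtain \<beta> L where \<beta>: "continuous_on UNIV \<beta>" "\<forall>t. norm (\<beta> t) \<le> L" "\<forall>t. \<beta> t + t *\<^sub>R lattice_vec b m' n' \<in> torus_proj b -` D'"
    by (rule loop_periodic_curve[OF open_torus_vimage[OF D(2)] l' per])
  have "real_of_int (m * n' - n * m') * b \<noteq> 0"
    using ne b by (simp only: mult_eq_0_iff of_int_eq_0_iff right_minus_eq) simp
  then have det: "fst (lattice_vec b m n) * snd (lattice_vec b m' n') - snd (lattice_vec b m n) * fst (lattice_vec b m' n') \<noteq> 0"
    by (simp add: lattice_vec_def algebra_simps)
  have "\<exists>t u. \<alpha> t + t *\<^sub>R lattice_vec b m n = \<beta> u + u *\<^sub>R lattice_vec b m' n'"
  proof (rule periodic_curves_meet[OF \<alpha>(1) \<beta>(1) _ _ det])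
    show "norm (\<alpha> t) \<le> max K L" "norm (\<beta> t) \<le> max K L" for t
      using \<alpha>(2)[rule_format, of t] \<beta>(2)[rule_format, of t] by auto
  qed
  then obtain t u where "\<alpha> t + t *\<^sub>R lattice_vec b m n = \<beta> u + u *\<^sub>R lattice_vec b m' n'" by blast
  with \<alpha>(3)[rule_format, of t] \<beta>(3)[rule_format, of u] D(3) show False by auto
qed

text \<open>Gaussian elimination: an unknown with nonzero coefficient in the last equation is
  expressed through the others and eliminated.\<close>

lemma homogeneous_solution:
  fixes a :: "nat \<Rightarrow> 'i \<Rightarrow> real"
  assumes "finite I" "n < card I"
  shows "\<exists>c. (\<exists>i\<in>I. c i \<noteq> 0) \<and> (\<forall>j<n. (\<Sum>i\<in>I. c i * a j i) = 0)"
  using assms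
proof (induction n arbitrary: I a)
  case 0
  then have "I \<noteq> {}" by auto
  then show ?case by (intro exI[of _ "\<lambda>_. 1"]) auto
next
  case (Suc n)
  show ?case
  proof (cases "\<forall>i\<in>I. a n i = 0")
    case True
    obtain c where c: "\<exists>i\<in>I. c i \<noteq> 0" "\<forall>j<n. (\<Sum>i\<in>I. c i * a j i) = 0"
      using Suc.IH[of I a] Suc.prems by auto
    then show ?thesis using True by (intro exI[of _ c]) (auto simp: less_Suc_eq)
  next
    case False
    then obtain i0 where i0: "i0 \<in> I" "a n i0 \<noteq> 0" by blast
    define I' where "I' = I - {i0}"
    have I': "finite I'" "n < card I'" "i0 \<notin> I'" "I = insert i0 I'" using Suc.prems i0 by (auto simp: I'_def)
    define a' where "a' j i = a j i - a j i0 * a n i / a n i0" for j i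
    obtain c where c: "\<exists>i\<in>I'. c i \<noteq> 0" "\<forall>j<n. (\<Sum>i\<in>I'. c i * a' j i) = 0"
      using Suc.IH[OF I'(1,2), of a'] by blast
    define c0 where "c0 = - (\<Sum>i\<in>I'. c i * a n i) / a n i0"
    define c' where "c' = c(i0 := c0)"
    have sum: "(\<Sum>i\<in>I. c' i * a j i) = c0 * a j i0 + (\<Sum>i\<in>I'. c i * a j i)" for j
    proof -
      have "(\<Sum>i\<in>I'. c' i * a j i) = (\<Sum>i\<in>I'. c i * a j i)"
        using I'(3) by (intro sum.cong) (auto simp: c'_def)
      then show ?thesis unfolding I'(4) using I'(1,3) by (simp add: c'_def)
    qed
    have "(\<Sum>i\<in>I. c' i * a j i) = 0" if j: "j < Suc n" for j
    proof (cases "j = n")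
      case True
      then show ?thesis unfolding sum c0_def using i0(2) by simp
    next
      case False
      have "0 = (\<Sum>i\<in>I'. c i * a' j i)" using c(2) j False by simp
      also have "\<dots> = (\<Sum>i\<in>I'. c i * a j i) - (\<Sum>i\<in>I'. (a j i0 / a n i0) * (c i * a n i))"
        unfolding sum_subtractf[symmetric] by (intro sum.cong) (auto simp: a'_def algebra_simps)
      also have "\<dots> = (\<Sum>i\<in>I'. c i * a j i) + c0 * a j i0"
        unfolding sum_distrib_left[symmetric] c0_def by simp
      finally show ?thesis unfolding sum by simp
    qed
    moreover have "\<exists>i\<in>I. c' i \<noteq> 0" using c(1) I'(3) I'(4) by (auto simp: c'_def)
    ultimately show ?thesis by blast
  qed
qed

section \<open>Minimality of the strip partition\<close>

lemma smooth_sum: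
  assumes "finite I" "\<And>i. i \<in> I \<Longrightarrow> smooth (\<psi> i)"
  shows "smooth (\<lambda>q. \<Sum>i\<in>I. c i * \<psi> i q) \<and> (\<forall>q. grad (\<lambda>q. \<Sum>i\<in>I. c i * \<psi> i q) q = (\<Sum>i\<in>I. c i *\<^sub>R grad (\<psi> i) q))"
  using assms
proof (induction I rule: finite_induct)
  case empty
  have "GDERIV (\<lambda>p::plane. 0::real) q :> 0" for q by (rule GDERIV_const)
  then show ?case by (simp add: smooth_const grad_eq)
next
  case (insert i I)
  let ?S = "\<lambda>q. \<Sum>i\<in>I. c i * \<psi> i q"
  have IH: "smooth ?S" "\<And>q. grad ?S q = (\<Sum>i\<in>I. c i *\<^sub>R grad (\<psi> i) q)" and i: "smooth (\<psi> i)"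
    using insert by auto
  have e: "(\<lambda>q. \<Sum>i\<in>insert i I. c i * \<psi> i q) = (\<lambda>q. ?S q + c i * \<psi> i q)"
    using insert by (simp add: add.commute)
  show ?case
    unfolding e using smooth_grad_add[OF IH(1) i, of "c i"] IH i insert.hyps
    by (auto simp: add.commute intro!: smooth_add smooth_mult smooth_const)
qed

lemma integral_grad_split:
  assumes "smooth \<psi>"
  shows "integral (cbox p q) (\<lambda>p. (norm (grad \<psi> p))\<^sup>2)
    = integral (cbox p q) (\<lambda>p. (fst (grad \<psi> p))\<^sup>2) + integral (cbox p q) (\<lambda>p. (snd (grad \<psi> p))\<^sup>2)"
  unfolding norm_plane_sq
  by (intro integral_add integrable_on_rect continuous_intros smooth_grad_cont assms)

text \<open>Where one function or its gradient is nonzero, that of every other one vanishes. Mass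
  and energy of a combination are therefore sums of squares of the coefficients times those of the
  members, and a strict bound for each member passes to every nonzero combination.\<close>

lemma combination_energy:
  assumes I: "finite I" and sm: "\<And>i. i \<in> I \<Longrightarrow> smooth (\<psi> i)"
    and disj: "\<And>i j q. i \<in> I \<Longrightarrow> j \<in> I \<Longrightarrow> i \<noteq> j \<Longrightarrow> \<psi> i q = 0 \<or> \<psi> j q = 0"
    and disj': "\<And>i j q. i \<in> I \<Longrightarrow> j \<in> I \<Longrightarrow> i \<noteq> j \<Longrightarrow> grad (\<psi> i) q = 0 \<or> grad (\<psi> j) q = 0"
    and E: "\<And>i. i \<in> I \<Longrightarrow> integral (cbox p r) (\<lambda>q. (norm (grad (\<psi> i) q))\<^sup>2) < l * integral (cbox p r) (\<lambda>q. (\<psi> i q)\<^sup>2)"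
    and c: "\<exists>i\<in>I. c i \<noteq> 0"
  shows "integral (cbox p r) (\<lambda>q. (norm (grad (\<lambda>q. \<Sum>i\<in>I. c i * \<psi> i q) q))\<^sup>2)
    < l * integral (cbox p r) (\<lambda>q. (\<Sum>i\<in>I. c i * \<psi> i q)\<^sup>2)"
proof -
  have N: "(\<Sum>i\<in>I. c i * \<psi> i q)\<^sup>2 = (\<Sum>i\<in>I. (c i)\<^sup>2 * (\<psi> i q)\<^sup>2)" for q
  proof -
    have "orthogonal (c i * \<psi> i q) (c j * \<psi> j q)" if "i \<in> I" "j \<in> I" "i \<noteq> j" for i j
      using disj[of i j q] that by (auto simp: orthogonal_def)
    then have "pairwise (\<lambda>i j. orthogonal (c i * \<psi> i q) (c j * \<psi> j q)) I" unfolding pairwise_def by blast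
    from norm_sum_Pythagorean[OF I this] show ?thesis by (simp add: power_mult_distrib)
  qed
  have G: "(norm (grad (\<lambda>q. \<Sum>i\<in>I. c i * \<psi> i q) q))\<^sup>2 = (\<Sum>i\<in>I. (c i)\<^sup>2 * (norm (grad (\<psi> i) q))\<^sup>2)" for q
  proof -
    have "orthogonal (c i *\<^sub>R grad (\<psi> i) q) (c j *\<^sub>R grad (\<psi> j) q)" if "i \<in> I" "j \<in> I" "i \<noteq> j" for i j
      using disj'[of i j q] that by (auto simp: orthogonal_def)
    then have "pairwise (\<lambda>i j. orthogonal (c i *\<^sub>R grad (\<psi> i) q) (c j *\<^sub>R grad (\<psi> j) q)) I"
      unfolding pairwise_def by blast
    note P = norm_sum_Pythagorean[OF I this]
    have g: "grad (\<lambda>q. \<Sum>i\<in>I. c i * \<psi> i q) q = (\<Sum>i\<in>I. c i *\<^sub>R grad (\<psi> i) q)"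
      using smooth_sum[of I \<psi> c] I sm by blast
    show ?thesis unfolding g P by (simp add: power_mult_distrib)
  qed
  have iN: "(\<lambda>q. (c i)\<^sup>2 * (\<psi> i q)\<^sup>2) integrable_on cbox p r" and iG: "(\<lambda>q. (c i)\<^sup>2 * (norm (grad (\<psi> i) q))\<^sup>2) integrable_on cbox p r"
    if "i \<in> I" for i
    by (intro integrable_on_rect continuous_on_mult continuous_on_const continuous_on_power continuous_on_norm
        smooth_continuous smooth_grad_cont sm that)+
  have sN: "integral (cbox p r) (\<lambda>q. \<Sum>i\<in>I. (c i)\<^sup>2 * (\<psi> i q)\<^sup>2) = (\<Sum>i\<in>I. (c i)\<^sup>2 * integral (cbox p r) (\<lambda>q. (\<psi> i q)\<^sup>2))"
    using integral_sum[of I "\<lambda>i q. (c i)\<^sup>2 * (\<psi> i q)\<^sup>2", OF I iN] by simp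
  have sG: "integral (cbox p r) (\<lambda>q. \<Sum>i\<in>I. (c i)\<^sup>2 * (norm (grad (\<psi> i) q))\<^sup>2)
      = (\<Sum>i\<in>I. (c i)\<^sup>2 * integral (cbox p r) (\<lambda>q. (norm (grad (\<psi> i) q))\<^sup>2))"
    using integral_sum[of I "\<lambda>i q. (c i)\<^sup>2 * (norm (grad (\<psi> i) q))\<^sup>2", OF I iG] by simp
  have "(\<Sum>i\<in>I. (c i)\<^sup>2 * integral (cbox p r) (\<lambda>q. (norm (grad (\<psi> i) q))\<^sup>2))
      < (\<Sum>i\<in>I. (c i)\<^sup>2 * (l * integral (cbox p r) (\<lambda>q. (\<psi> i q)\<^sup>2)))"
  proof (rule sum_strict_mono_ex1[OF I])
    show "\<forall>i\<in>I. (c i)\<^sup>2 * integral (cbox p r) (\<lambda>q. (norm (grad (\<psi> i) q))\<^sup>2) \<le> (c i)\<^sup>2 * (l * integral (cbox p r) (\<lambda>q. (\<psi> i q)\<^sup>2))"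
      using E by (intro ballI mult_left_mono) (auto simp: less_imp_le)
    obtain i where "i \<in> I" "c i \<noteq> 0" using c by blast
    then show "\<exists>i\<in>I. (c i)\<^sup>2 * integral (cbox p r) (\<lambda>q. (norm (grad (\<psi> i) q))\<^sup>2) < (c i)\<^sup>2 * (l * integral (cbox p r) (\<lambda>q. (\<psi> i q)\<^sup>2))"
      using E by (intro bexI[of _ i] mult_strict_left_mono) auto
  qed
  also have "\<dots> = l * (\<Sum>i\<in>I. (c i)\<^sup>2 * integral (cbox p r) (\<lambda>q. (\<psi> i q)\<^sup>2))"
    unfolding sum_distrib_left by (intro sum.cong) auto
  finally show ?thesis
    unfolding N G sN sG .
qed

lemma integral_combination:
  assumes "finite I" "\<And>i. i \<in> I \<Longrightarrow> smooth (\<psi> i)"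
  shows "integral (cbox p r) (\<lambda>q. \<Sum>i\<in>I. c i * \<psi> i q) = (\<Sum>i\<in>I. c i * integral (cbox p r) (\<psi> i))"
proof -
  have "(\<lambda>q. c i * \<psi> i q) integrable_on cbox p r" if "i \<in> I" for i
    by (intro integrable_on_rect continuous_on_mult continuous_on_const smooth_continuous assms(2) that)
  from integral_sum[OF assms(1) this] show ?thesis by simp
qed

text \<open>The three twists force three kinds of loops: in every domain one with m + n odd, in some
  domain one with m odd, in some domain one with n odd. Loops in different domains being parallel,
  these cannot coexist.\<close>

lemma partition_energy_bound:
  assumes k: "k \<ge> 3" "odd k" and b: "b > 0" "(real k)\<^sup>2 < 1 + 1 / b\<^sup>2" and part: "is_partition b k D"
  shows "\<exists>i\<in>{1..k}. (real k)\<^sup>2 * pi\<^sup>2 \<le> torus_lambda1 b (D i)"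
proof (rule ccontr)
  assume neg: "\<not> ?thesis"
  let ?l = "(real k)\<^sup>2 * pi\<^sup>2" and ?I = "{1..k}" and ?R = "cbox (0, 0) (1, b) :: plane set"
  have D: "openin (torus b) (D i)" "connectedin (torus b) (D i)" "D i \<noteq> {}" if "i \<in> ?I" for i
    using part that by (auto simp: is_partition_def)
  have Ddisj: "D i \<inter> D j = {}" if "i \<in> ?I" "j \<in> ?I" "i \<noteq> j" for i j
    using part that by (auto simp: is_partition_def disjoint_family_on_def)
  have "\<exists>p. p \<in> torus_proj b -` D i" if "i \<in> ?I" for i
    using D(3)[OF that] openin_subset[OF D(1)[OF that]] by (fastforce simp: topspace_torus)
  then obtain p where p: "\<And>i. i \<in> ?I \<Longrightarrow> p i \<in> torus_proj b -` D i" by metis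
  define ok where "ok i \<phi> \<longleftrightarrow> \<phi> \<in> torus_test b (D i) \<and>
      integral ?R (\<lambda>q. (norm (grad \<phi> q))\<^sup>2) < ?l * integral ?R (\<lambda>q. (\<phi> q)\<^sup>2)" for i \<phi>
  have "\<exists>\<phi>. ok i \<phi>" if "i \<in> ?I" for i
  proof -
    have "torus_lambda1 b (D i) < ?l" using neg that by (simp add: not_le)
    from torus_lambda1_approx[OF b(1) D(1,3)[OF that] this] show ?thesis unfolding ok_def by blast
  qed
  then obtain \<phi> where ok: "\<And>i. i \<in> ?I \<Longrightarrow> ok i (\<phi> i)" by metis
  have \<phi>: "\<phi> i \<in> torus_test b (D i)" if "i \<in> ?I" for i using ok[OF that] by (simp add: ok_def)
  have \<phi>_out: "q \<in> closure {p. \<phi> i p \<noteq> 0} \<Longrightarrow> torus_proj b q \<in> D i" if "i \<in> ?I" for i q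
    using \<phi>[OF that] unfolding mem_torus_test by blast
  define Loop where "Loop i m n \<longleftrightarrow> connected_component (torus_proj b -` D i) (p i) (p i + lattice_vec b m n)" for i m n
  have par: "m * n' = n * m'" if "i \<in> ?I" "j \<in> ?I" "i \<noteq> j" "Loop i m n" "Loop j m' n'" for i j m n m' n'
    using disjoint_loops_parallel[OF b(1) D(1) D(1) Ddisj] that unfolding Loop_def by blast
  define good where "good \<sigma> i \<psi> \<longleftrightarrow> smooth \<psi> \<and> (\<forall>q m n. \<psi> (q + lattice_vec b m n) = \<sigma> m n * \<psi> q) \<and>
    (\<forall>q. (\<psi> q)\<^sup>2 = (\<phi> i q)\<^sup>2) \<and> (\<forall>q. norm (grad \<psi> q) = norm (grad (\<phi> i) q))"
    for \<sigma> :: "int \<Rightarrow> int \<Rightarrow> real" and i \<psi>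
  have lift: "\<exists>\<psi>. good \<sigma> i \<psi>"
    if i: "i \<in> ?I" and s: "\<And>m n. \<sigma> m n = 1 \<or> \<sigma> m n = -1" "\<And>m n m' n'. \<sigma> (m + m') (n + n') = \<sigma> m n * \<sigma> m' n'"
      and loops: "\<And>m n. Loop i m n \<Longrightarrow> \<sigma> m n = 1" for i and \<sigma> :: "int \<Rightarrow> int \<Rightarrow> real"
    unfolding good_def
    using twisted_lift[where \<sigma> = \<sigma>, OF D(1)[OF i] D(2)[OF i] p[OF i] s loops[unfolded Loop_def] \<phi>[OF i]] .
  have goodE: "integral ?R (\<lambda>q. (norm (grad \<psi> q))\<^sup>2) < ?l * integral ?R (\<lambda>q. (\<psi> q)\<^sup>2)" if "i \<in> ?I" "good \<sigma> i \<psi>" for i \<sigma> \<psi>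
  proof -
    have e: "(\<psi> q)\<^sup>2 = (\<phi> i q)\<^sup>2" "norm (grad \<psi> q) = norm (grad (\<phi> i) q)" for q
      using that(2) unfolding good_def by blast+
    show ?thesis using ok[OF that(1)] unfolding ok_def e by blast
  qed
  have good_grad: "has_grad \<psi> (\<lambda>q. fst (grad \<psi> q)) (\<lambda>q. snd (grad \<psi> q))" if "good \<sigma> i \<psi>" for i \<sigma> \<psi>
    using that unfolding good_def by (intro smooth_has_grad) simp
  have combination: "integral ?R (\<lambda>q. (norm (grad (\<lambda>q. \<Sum>i\<in>?I. c i * \<psi> i q) q))\<^sup>2)
    < ?l * integral ?R (\<lambda>q. (\<Sum>i\<in>?I. c i * \<psi> i q)\<^sup>2)"
    if g: "\<And>i. i \<in> ?I \<Longrightarrow> good \<sigma> i (\<psi> i)" and c: "\<exists>i\<in>?I. c i \<noteq> 0" for \<sigma> \<psi> c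
  proof (rule combination_energy)
    show "smooth (\<psi> i)" if "i \<in> ?I" for i using g[OF that] by (simp add: good_def)
    have z: "\<psi> i q = 0 \<and> grad (\<psi> i) q = 0" if "i \<in> ?I" "torus_proj b q \<notin> D i" for i q
    proof -
      have n: "q \<notin> closure {p. \<phi> i p \<noteq> 0}" using \<phi>_out that by blast
      have "(\<psi> i q)\<^sup>2 = (\<phi> i q)\<^sup>2" "norm (grad (\<psi> i) q) = norm (grad (\<phi> i) q)"
        using g[OF that(1)] unfolding good_def by blast+
      then show ?thesis using zero_outside[OF n] grad_zero_outside[OF n] by simp
    qed
    show "\<psi> i q = 0 \<or> \<psi> j q = 0" "grad (\<psi> i) q = 0 \<or> grad (\<psi> j) q = 0" if "i \<in> ?I" "j \<in> ?I" "i \<noteq> j" for i j q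
      using z[of i q] z[of j q] Ddisj[OF that] that by blast+
  qed (use goodE g c in auto)
  have l1: "?l < pi\<^sup>2 + pi\<^sup>2 / b\<^sup>2"
    using mult_strict_right_mono[OF b(2), of "pi\<^sup>2"] by (simp add: distrib_right)
  have shift: "(x, y) + lattice_vec b 1 0 = (x + 1, y)" "(x, y) + lattice_vec b 0 1 = (x, y + b)" for x y
    by (simp_all add: lattice_vec_def)
  \<comment> \<open>Twist by (-1)^(m+n). The doubly antiperiodic inequality already contradicts the
    energy of a single domain, so the conclusion holds for each i.\<close>
  have odd_loop: "\<exists>m n. Loop i m n \<and> odd (m + n)" if i: "i \<in> ?I" for i
  proof (rule ccontr)
    assume "\<not> ?thesis"
    then have ev: "\<And>m n. Loop i m n \<Longrightarrow> even (m + n)" by blast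
    define \<sigma> :: "int \<Rightarrow> int \<Rightarrow> real" where "\<sigma> m n = (if even (m + n) then 1 else -1)" for m n
    have "\<exists>\<psi>. good \<sigma> i \<psi>"
      by (rule lift[OF i]) (use ev in \<open>auto simp: \<sigma>_def\<close>)
    then obtain \<psi> where \<psi>: "good \<sigma> i \<psi>" by blast
    have sm\<psi>: "smooth \<psi>" using \<psi> by (simp add: good_def)
    have "\<psi> ((x, y) + lattice_vec b 1 0) = - \<psi> (x, y)" "\<psi> ((x, y) + lattice_vec b 0 1) = - \<psi> (x, y)" for x y
      using \<psi> unfolding good_def by (auto simp: \<sigma>_def)
    from antiperiodic_both[OF zero_less_one b(1) good_grad[OF \<psi>] this[unfolded shift]]
    have "(pi\<^sup>2 + pi\<^sup>2 / b\<^sup>2) * integral ?R (\<lambda>q. (\<psi> q)\<^sup>2) \<le> integral ?R (\<lambda>q. (norm (grad \<psi> q))\<^sup>2)"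
      by (simp add: integral_grad_split[OF sm\<psi>])
    moreover have "0 \<le> integral ?R (\<lambda>q. (\<psi> q)\<^sup>2)"
      by (intro integral_nonneg integrable_on_rect continuous_on_power smooth_continuous sm\<psi>) auto
    then have "?l * integral ?R (\<lambda>q. (\<psi> q)\<^sup>2) \<le> (pi\<^sup>2 + pi\<^sup>2 / b\<^sup>2) * integral ?R (\<lambda>q. (\<psi> q)\<^sup>2)"
      using l1 by (intro mult_right_mono) auto
    ultimately show False using goodE[OF i \<psi>] by linarith
  qed
  \<comment> \<open>Twist by (-1)^m, which must be available on all k domains at once; hence the
    conclusion concerns some domain only.\<close>
  have x_loop: "\<exists>i\<in>?I. \<exists>m n. Loop i m n \<and> odd m"
  proof (rule ccontr)
    assume "\<not> ?thesis"
    then have ev: "\<And>i m n. i \<in> ?I \<Longrightarrow> Loop i m n \<Longrightarrow> even m" by blast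
    define \<sigma> :: "int \<Rightarrow> int \<Rightarrow> real" where "\<sigma> m n = (if even m then 1 else -1)" for m n
    have "\<exists>\<psi>. good \<sigma> i \<psi>" if "i \<in> ?I" for i
      by (rule lift[OF that]) (use ev[OF that] in \<open>auto simp: \<sigma>_def\<close>)
    then obtain \<psi> where \<psi>: "\<And>i. i \<in> ?I \<Longrightarrow> good \<sigma> i (\<psi> i)" by metis
    have sm: "smooth (\<psi> i)" if "i \<in> ?I" for i using \<psi>[OF that] by (simp add: good_def)
    \<comment> \<open>Integrals over the k vertical strips. Requiring consecutive ones to add up to
      zero gives k - 1 equations for k coefficients and makes the integrals of the combination
      alternate with an unprescribed size \<open>A 0\<close>.\<close>
    define a where "a j i = integral (cbox (real j / k, 0) (real (Suc j) / k, b)) (\<psi> i)" for j i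
    obtain c where c: "\<exists>i\<in>?I. c i \<noteq> 0" "\<forall>j<k - 1. (\<Sum>i\<in>?I. c i * (a j i + a (Suc j) i)) = 0"
      using homogeneous_solution[of ?I "k - 1" "\<lambda>j i. a j i + a (Suc j) i"] k by auto
    let ?P = "\<lambda>q. \<Sum>i\<in>?I. c i * \<psi> i q"
    have smP: "smooth ?P" using smooth_sum[of ?I \<psi> c] sm by simp
    define A where "A j = (\<Sum>i\<in>?I. c i * a j i)" for j
    have Aj: "integral (cbox (real j / k, 0) (real (Suc j) / k, b)) ?P = A j" for j
      unfolding A_def a_def by (rule integral_combination) (use sm in auto)
    have "A (Suc j) = - A j" if "j < k - 1" for j
      using c(2) that unfolding A_def by (simp add: distrib_left sum.distrib add_eq_0_iff)
    then have "j < k \<Longrightarrow> A j = (-1) ^ j * A 0" for j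
      by (induction j) auto
    then have alt: "\<And>j. j < k \<Longrightarrow> integral (cbox (real j / k, 0) (real (Suc j) / k, b)) ?P = (-1) ^ j * A 0"
      unfolding Aj by blast
    have "\<psi> i ((x, y) + lattice_vec b 1 0) = - \<psi> i (x, y)" if "i \<in> ?I" for i x y
      using \<psi>[OF that] unfolding good_def by (auto simp: \<sigma>_def)
    then have anti: "?P (x + 1, y) = - ?P (x, y)" for x y
      unfolding shift by (simp add: sum_negf[symmetric])
    have "?l * integral ?R (\<lambda>q. (?P q)\<^sup>2) \<le> integral ?R (\<lambda>q. (norm (grad ?P q))\<^sup>2)"
      unfolding integral_grad_split[OF smP]
      using b(2) by (intro twisted_inequality_x[OF k(2) b(1) _ smooth_has_grad[OF smP] anti alt]) auto
    with combination[OF \<psi> c(1)] show False by simp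
  qed
  have y_loop: "\<exists>i\<in>?I. \<exists>m n. Loop i m n \<and> odd n"
  proof (rule ccontr)
    assume "\<not> ?thesis"
    then have ev: "\<And>i m n. i \<in> ?I \<Longrightarrow> Loop i m n \<Longrightarrow> even n" by blast
    define \<sigma> :: "int \<Rightarrow> int \<Rightarrow> real" where "\<sigma> m n = (if even n then 1 else -1)" for m n
    have "\<exists>\<psi>. good \<sigma> i \<psi>" if "i \<in> ?I" for i
      by (rule lift[OF that]) (use ev[OF that] in \<open>auto simp: \<sigma>_def\<close>)
    then obtain \<psi> where \<psi>: "\<And>i. i \<in> ?I \<Longrightarrow> good \<sigma> i (\<psi> i)" by metis
    have sm: "smooth (\<psi> i)" if "i \<in> ?I" for i using \<psi>[OF that] by (simp add: good_def)
    \<comment> \<open>The two horizontal halves of the period cell. Two equations leave a nonzero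
      solution because there are at least three domains.\<close>
    define B where "B j = (if j = 0 then cbox (0, 0) (1, b / 2) else cbox (0, b / 2) (1, b) :: plane set)" for j :: nat
    obtain c where c: "\<exists>i\<in>?I. c i \<noteq> 0" "\<forall>j<2. (\<Sum>i\<in>?I. c i * integral (B j) (\<psi> i)) = 0"
      using homogeneous_solution[of ?I 2 "\<lambda>j i. integral (B j) (\<psi> i)"] k by auto
    let ?P = "\<lambda>q. \<Sum>i\<in>?I. c i * \<psi> i q"
    have smP: "smooth ?P" using smooth_sum[of ?I \<psi> c] sm by simp
    have m0: "integral (cbox (0, 0) (1, b / 2)) ?P = 0"
      using c(2)[rule_format, of 0] sm by (subst integral_combination) (auto simp: B_def)
    have m1: "integral (cbox (0, b / 2) (1, b)) ?P = 0"
      using c(2)[rule_format, of 1] sm by (subst integral_combination) (auto simp: B_def)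
    have "\<psi> i ((x, y) + lattice_vec b 0 1) = - \<psi> i (x, y)" if "i \<in> ?I" for i x y
      using \<psi>[OF that] unfolding good_def by (auto simp: \<sigma>_def)
    then have anti: "?P (x, y + b) = - ?P (x, y)" for x y
      unfolding shift by (simp add: sum_negf[symmetric])
    \<comment> \<open>From 1/b^2 > k^2 - 1 one gets 4/b^2 > 4 k^2 - 4, which exceeds k^2 for k at
      least 3.\<close>
    have l4: "?l \<le> 4 * pi\<^sup>2 / b\<^sup>2"
    proof -
      have "9 \<le> (real k)\<^sup>2" using k(1) power_mono[of 3 "real k" 2] by simp
      then have "(real k)\<^sup>2 \<le> 4 * (1 / b\<^sup>2)" using b(2) by linarith
      from mult_right_mono[OF this, of "pi\<^sup>2"] show ?thesis by simp
    qed
    have "?l * integral ?R (\<lambda>q. (?P q)\<^sup>2) \<le> integral ?R (\<lambda>q. (norm (grad ?P q))\<^sup>2)"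
      unfolding integral_grad_split[OF smP]
      using l1 l4 by (intro twisted_inequality_y[OF b(1) smooth_has_grad[OF smP] anti m0 m1]) auto
    with combination[OF \<psi> c(1)] show False by simp
  qed
  obtain i0 m0 n0 where i0: "i0 \<in> ?I" "Loop i0 m0 n0" "odd m0" using x_loop by blast
  obtain j0 m1 n1 where j0: "j0 \<in> ?I" "Loop j0 m1 n1" "odd n1" using y_loop by blast
  have in_I: "1 \<in> ?I" "2 \<in> ?I" using k by auto
  obtain m n where mn: "Loop 1 m n" "odd (m + n)" using odd_loop[OF in_I(1)] by blast
  \<comment> \<open>Parallelism compares distinct domains only, so the final contradiction needs a
    domain different from the one carrying the loop from \<open>x_loop\<close> or
    \<open>y_loop\<close>.\<close>
  have other: "\<exists>j\<in>?I. j \<noteq> i" for i :: nat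
    by (rule bexI[of _ "if i = 1 then 2 else 1"]) (use in_I in auto)
  show False
  proof (cases "odd m")
    case True
    then have n: "even n" using mn by simp
    \<comment> \<open>Modulo 2 the loop of the first domain has class (1, 0). Parallelism and an odd
      sum then force the same class on a loop of every other domain, and such a loop cannot be
      parallel to one with odd n in a different domain.\<close>
    have all: "\<exists>m n. Loop i m n \<and> odd m \<and> even n" if i: "i \<in> ?I" for i
    proof (cases "i = 1")
      case False
      obtain m' n' where l: "Loop i m' n'" "odd (m' + n')" using odd_loop[OF i] by blast
      have "m * n' = n * m'" using par[OF in_I(1) i _ mn(1) l(1)] False by simp
      then have "even (m * n')" using n by simp
      then have "even n'" using True by simp
      then show ?thesis using l by auto
    qed (use mn True n in auto)
    obtain j where j: "j \<in> ?I" "j \<noteq> j0" using other by blast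
    obtain m' n' where l: "Loop j m' n'" "odd m'" "even n'" using all[OF j(1)] by blast
    have "m' * n1 = n' * m1" by (rule par[OF j(1) j0(1) j(2) l(1) j0(2)])
    then have "even (m' * n1)" using l(3) by simp
    then show False using l(2) j0(3) by simp
  next
    case False
    then have m: "even m" "odd n" using mn by auto
    have all: "\<exists>m n. Loop i m n \<and> even m \<and> odd n" if i: "i \<in> ?I" for i
    proof (cases "i = 1")
      case False
      obtain m' n' where l: "Loop i m' n'" "odd (m' + n')" using odd_loop[OF i] by blast
      have "m * n' = n * m'" using par[OF in_I(1) i _ mn(1) l(1)] False by simp
      then have "even (n * m')" using m(1) by (metis even_mult_iff)
      then have "even m'" using m(2) by simp
      then show ?thesis using l by auto
    qed (use mn m in auto)
    obtain j where j: "j \<in> ?I" "j \<noteq> i0" using other by blast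
    obtain m' n' where l: "Loop j m' n'" "even m'" "odd n'" using all[OF j(1)] by blast
    have "m' * n0 = n' * m0" by (rule par[OF j(1) i0(1) j(2) l(1) i0(2)])
    then have "even (n' * m0)" using l(2) by (metis even_mult_iff)
    then show False using l(3) i0(3) by simp
  qed
qed

section \<open>Energy of the strip partition\<close>

lemma strip_is_partition:
  assumes k: "k > 0"
  shows "is_partition b k (strip_partition k b)"
  unfolding is_partition_def
proof (intro conjI ballI)
  have cm: "continuous_map euclidean (circle L) (circle_proj L)" for L
    by (rule quotient_imp_continuous_map[OF quotient_map_circle_proj])
  have conn: "connectedin (circle L) (circle_proj L ` S)" if "connected S" for L S
    by (rule connectedin_continuous_map_image[OF cm]) (use that in simp)
  fix i assume i: "i \<in> {1..k}"
  let ?J = "{(real i - 1) / real k <..< real i / real k}"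
  have "(real i - 1) / real k < real i / real k" using k by (intro divide_strict_right_mono) auto
  then have ne: "?J \<noteq> {}" by simp
  show "openin (torus b) (strip_partition k b i)"
    unfolding torus_def strip_partition_def openin_prod_Times_iff
    by (auto intro: openin_circle_image openin_topspace)
  show "connectedin (torus b) (strip_partition k b i)"
    unfolding torus_def strip_partition_def connectedin_Times topspace_circle
    by (intro disjI2 conjI conn) auto
  show "strip_partition k b i \<noteq> {}"
    unfolding strip_partition_def topspace_circle using ne by auto
next
  have "i = j" if ij: "i \<in> {1..k}" "j \<in> {1..k}" and x: "x \<in> {(real i - 1) / real k <..< real i / real k}"
    and y: "y \<in> {(real j - 1) / real k <..< real j / real k}" and eq: "circle_proj 1 x = circle_proj 1 y" for i j x y
  proof -
    obtain n :: int where n: "y = x + of_int n" using eq unfolding circle_proj_eq_iff by auto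
    have x': "real i - 1 < x * k" "x * k < real i" and y': "real j - 1 < y * k" "y * k < real j"
      using x y k by (auto simp: field_simps)
    have ij': "1 \<le> real i" "real i \<le> k" "1 \<le> real j" "real j \<le> k" using ij by auto
    \<comment> \<open>All strips have representatives inside (0, 1), so two of these can be
      congruent modulo 1 only if they are equal; the bounds then leave i = j.\<close>
    have "0 < x * k" "x * k < k" "0 < y * k" "y * k < k" using x' y' ij' by linarith+
    then have "0 < x" "x < 1" "0 < y" "y < 1" using k by (auto simp: zero_less_mult_iff)
    then have "\<bar>real_of_int n\<bar> < 1" using n by linarith
    then have "n = 0" by linarith
    then have "x * k = y * k" using n by simp
    then have "real i - 1 < real j" "real j - 1 < real i" using x' y' by linarith+
    then show ?thesis by linarith
  qed
  then show "disjoint_family_on (strip_partition k b) {1..k}"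
    unfolding disjoint_family_on_def strip_partition_def by fastforce
qed

lemma integral_shifted_support:
  fixes f :: "real \<Rightarrow> real"
  assumes f: "continuous_on UNIV f" "\<And>t. t \<notin> {0..w} \<Longrightarrow> f t = 0" and a: "0 \<le> a" "a + w \<le> 1"
  shows "integral {0..1} (\<lambda>x. f (x - a)) = integral {0..w} f"
proof -
  have "(f has_integral integral {0..w} f) {0..w}"
    by (intro integrable_integral integrable_continuous_interval continuous_on_subset[OF f(1)]) auto
  then have "((f \<circ> (+) (- a)) has_integral integral {0..w} f) {a..a + w}"
    unfolding has_integral_shift_Icc_real by simp
  then have "((f \<circ> (+) (- a)) has_integral integral {0..w} f) {0..1}"
    by (rule has_integral_on_superset) (use f(2) a in auto)
  then show ?thesis by (simp add: o_def integral_unique)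
qed

text \<open>Tested with a bump of width 1/k in x which is constant in y. This is admissible since
  the strip closes up in the y direction, and no y-energy arises.\<close>

lemma strip_lambda1_le:
  assumes k: "k > 0" and b: "b > 0" and i: "i \<in> {1..k}"
  shows "torus_lambda1 b (strip_partition k b i) \<le> (real k)\<^sup>2 * pi\<^sup>2"
proof (rule le_of_le_scaled)
  fix e :: real assume e: "0 < e" "e < 1 / 8"
  define w where "w = 1 / real k"
  define a where "a = (real i - 1) / real k"
  have w: "0 < w" "w \<le> 1" using k by (auto simp: w_def)
  have a: "0 \<le> a" "a + w \<le> 1" using i k by (auto simp: a_def w_def add_divide_distrib[symmetric])
  let ?\<omega> = "strip_partition k b i"
  have \<omega>: "openin (torus b) ?\<omega>" "?\<omega> \<noteq> {}"
    using strip_is_partition[OF k, of b] i by (auto simp: is_partition_def)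
  define \<phi> where "\<phi> = (\<lambda>p::plane. periodic_bump e w 1 (fst p + - a))"
  have sx: "smooth (\<lambda>p. fst p + - a)" by (intro smooth_add smooth_const smooth_fst)
  have sm: "smooth \<phi>" unfolding \<phi>_def by (rule smooth_periodic_bump[OF e(1) w sx])
  have \<phi>: "\<phi> \<in> torus_test b ?\<omega>"
    unfolding mem_torus_test
  proof (intro conjI allI subsetI sm)
    show "\<phi> (p + lattice_vec b m n) = \<phi> p" for p m n
      using periodic_bump_periodic[of 1 e w "fst p + - a" m] by (simp add: \<phi>_def lattice_vec_def algebra_simps)
    fix p assume "p \<in> closure {p. \<phi> p \<noteq> 0}"
    from periodic_bump_support[OF e(1) w sx this[unfolded \<phi>_def]] obtain m :: int
      where m: "0 < fst p + - a - of_int m * 1" "fst p + - a - of_int m * 1 < w" by blast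
    have "fst p - of_int m \<in> {(real i - 1) / real k <..< real i / real k}"
      using m by (auto simp: a_def w_def diff_divide_distrib)
    moreover have "circle_proj 1 (fst p) = circle_proj 1 (fst p - of_int m)"
      unfolding circle_proj_eq_iff by (intro exI[of _ "- m"]) simp
    ultimately show "p \<in> torus_proj b -` ?\<omega>"
      unfolding strip_partition_def torus_proj_def topspace_circle by auto
  qed
  \<comment> \<open>On the closed period interval the periodic bump is a single translate. To the
    left of a, and at the right end when a = 0, the wrapped argument falls where the bump
    vanishes.\<close>
  have base: "\<phi> p = sine_bump e w (fst p - a)" if x: "0 \<le> fst p" "fst p \<le> 1" for p
  proof (cases "fst p < a")
    case True
    then have "\<phi> p = sine_bump e w (fst p - a + 1)"
      using periodic_bump_base[of 1 "-1" "fst p + - a" e w] x a w by (simp add: \<phi>_def)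
    moreover have "fst p - a + 1 \<ge> w" using x a by linarith
    ultimately show ?thesis using True by (simp add: sine_bump_def)
  next
    case False
    show ?thesis
    proof (cases "fst p - a < 1")
      case True
      then show ?thesis using False periodic_bump_base[of 1 0 "fst p + - a" e w] by (simp add: \<phi>_def)
    next
      case False
      then have "fst p - a = 1" using x a by linarith
      then show ?thesis using w by (simp add: \<phi>_def periodic_bump_def sine_bump_def frac_def)
    qed
  qed
  let ?s = "sine_bump e w" and ?s' = "sine_bump' e w"
  note cs = sine_bump_cont[OF e(1) w(1)] sine_bump'_cont[OF e(1) w(1)]
  define A where "A = integral {0..w} (\<lambda>t. (?s t)\<^sup>2)"
  define A' where "A' = integral {0..w} (\<lambda>t. (?s' t)\<^sup>2)"
  have shifted: "integral {0..1} (\<lambda>x. (?s (x - a))\<^sup>2) = A" "integral {0..1} (\<lambda>x. (?s' (x - a))\<^sup>2) = A'"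
  proof -
    show "integral {0..1} (\<lambda>x. (?s (x - a))\<^sup>2) = A" unfolding A_def
      by (rule integral_shifted_support[OF _ _ a], intro continuous_on_power cs, auto simp: sine_bump_def)
    show "integral {0..1} (\<lambda>x. (?s' (x - a))\<^sup>2) = A'" unfolding A'_def
      by (rule integral_shifted_support[OF _ _ a], intro continuous_on_power cs, auto simp: sine_bump'_def)
  qed
  have cx: "continuous_on UNIV (\<lambda>x. (?s (x - a))\<^sup>2)" "continuous_on UNIV (\<lambda>x. (?s' (x - a))\<^sup>2)"
    by (intro continuous_on_power continuous_on_compose2[OF cs(1)[of UNIV]] continuous_on_compose2[OF cs(2)[of UNIV]] continuous_intros; simp)+
  have N: "integral (cbox (0, 0) (1, b)) (\<lambda>p. (\<phi> p)\<^sup>2) = A * b"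
  proof -
    have "integral (cbox (0, 0) (1, b)) (\<lambda>p. (\<phi> p)\<^sup>2) = integral (cbox (0, 0) (1, b)) (\<lambda>p. (?s (fst p - a))\<^sup>2 * 1)"
      by (rule integral_cong) (auto simp: base cbox_Pair_eq)
    also have "\<dots> = A * b"
      using integral_product[OF cx(1) continuous_on_const[of UNIV 1], of 0 0 1 b] b by (simp add: shifted)
    finally show ?thesis .
  qed
  have E: "integral (cbox (0, 0) (1, b)) (\<lambda>p. (norm (grad \<phi> p))\<^sup>2) = A' * b"
  proof -
    have "((\<lambda>p. (?s' (fst p - a))\<^sup>2 * 1) has_integral A' * b) (cbox (0, 0) (1, b))"
    proof -
      have "continuous_on UNIV (\<lambda>p::plane. (?s' (fst p - a))\<^sup>2 * 1)"
        by (intro continuous_intros continuous_on_compose2[OF cx(2)]) auto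
      from integrable_integral[OF integrable_on_rect[OF this, of "(0, 0)" "(1, b)"]]
      show ?thesis using integral_product[OF cx(2) continuous_on_const[of UNIV 1], of 0 0 1 b] b by (simp add: shifted)
    qed
    \<comment> \<open>The formula for \<phi> is known only for x in [0, 1], so its gradient can be
      read off in the open cell; the boundary does not affect the integral.\<close>
    moreover have "(norm (grad \<phi> p))\<^sup>2 = (?s' (fst p - a))\<^sup>2 * 1" if "p \<in> box (0, 0) (1, b)" for p
    proof -
      have p: "0 < fst p" "fst p < 1"
        using that by (auto simp: box_def Basis_prod_def ball_Un inner_prod_def)
      have "((\<lambda>p::plane. fst p - a) has_derivative (\<lambda>h. fst h)) (at p)"
        by (auto intro!: derivative_eq_intros)
      from has_derivative_compose[OF this sine_bump_deriv[OF e(1) w(1), of "fst p - a", unfolded has_field_derivative_def]]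
      have "((\<lambda>p::plane. ?s (fst p - a)) has_derivative (\<lambda>h. ?s' (fst p - a) * fst h)) (at p)" .
      then have "(\<phi> has_derivative (\<lambda>h. ?s' (fst p - a) * fst h)) (at p)"
      proof (rule has_derivative_transform_within_open)
        show "open ({0<..<1::real} \<times> (UNIV :: real set))" by (intro open_Times) auto
        show "p \<in> {0<..<1} \<times> UNIV" using p by (simp add: mem_Times_iff)
      qed (simp add: base mem_Times_iff)
      then have "grad \<phi> p = (?s' (fst p - a), 0)"
        by (intro grad_eq) (simp add: gderiv_def inner_prod_def mult.commute)
      then show ?thesis by (simp add: norm_plane_sq)
    qed
    ultimately have "((\<lambda>p. (norm (grad \<phi> p))\<^sup>2) has_integral A' * b) (cbox (0, 0) (1, b))"
      by (rule has_integral_spike_interior)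
    then show ?thesis by (rule integral_unique)
  qed
  have A: "A \<ge> w * (1 - 8 * e) / 2" using integral_sine_bump_sq[OF e(1) w(1)] by (simp add: A_def algebra_simps)
  have A': "A' \<le> pi\<^sup>2 / (2 * w)" using integral_sine_bump'_sq[OF e(1) w(1)] by (simp add: A'_def)
  have pos: "1 - 8 * e > 0" using e by simp
  have Apos: "A > 0" by (rule less_le_trans[OF _ A]) (use pos w in simp)
  have "torus_lambda1 b ?\<omega> * (A * b) \<le> A' * b"
    using torus_lambda1_le[OF b \<omega> \<phi>] unfolding N E .
  then have "torus_lambda1 b ?\<omega> \<le> A' / A"
    using Apos b by (simp add: pos_le_divide_eq mult.assoc[symmetric])
  then have "torus_lambda1 b ?\<omega> * (1 - 8 * e) \<le> A' / A * (1 - 8 * e)"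
    using pos by (intro mult_right_mono) auto
  also have "\<dots> = A' * ((1 - 8 * e) / A)" by simp
  also have "\<dots> \<le> pi\<^sup>2 / (2 * w) * (2 / w)"
  proof (intro mult_mono A')
    show "(1 - 8 * e) / A \<le> 2 / w" using A Apos w by (simp add: field_simps)
  qed (use pos Apos w in auto)
  also have "\<dots> = (real k)\<^sup>2 * pi\<^sup>2" by (simp add: w_def power2_eq_square)
  finally show "torus_lambda1 b ?\<omega> * (1 - 8 * e) \<le> (real k)\<^sup>2 * pi\<^sup>2" .
qed simp

lemma strip_partition_minimal:
  assumes k: "k \<ge> 3" "odd k" and b: "b > 0" "(real k)\<^sup>2 < 1 + 1 / b\<^sup>2"
  shows "is_minimal_partition b k (strip_partition k b)"
proof -
  have k0: "k > 0" using k by simp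
  have lower: "(real k)\<^sup>2 * pi\<^sup>2 \<le> energy b k D" if D: "is_partition b k D" for D
  proof -
    obtain i where i: "i \<in> {1..k}" "(real k)\<^sup>2 * pi\<^sup>2 \<le> torus_lambda1 b (D i)"
      using partition_energy_bound[OF k b D] by blast
    note i(2)
    also have "torus_lambda1 b (D i) \<le> energy b k D"
      unfolding energy_def using i(1) by (intro Max_ge) auto
    finally show ?thesis .
  qed
  note part = strip_is_partition[OF k0, of b]
  have "energy b k (strip_partition k b) \<le> (real k)\<^sup>2 * pi\<^sup>2"
    unfolding energy_def using k0 strip_lambda1_le[OF k0 b(1)] by (subst Max_le_iff) auto
  with lower[OF part] have e: "energy b k (strip_partition k b) = (real k)\<^sup>2 * pi\<^sup>2" by simp
  have "minimal_energy b k = (real k)\<^sup>2 * pi\<^sup>2"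
    unfolding minimal_energy_def
  proof (rule cInf_eq_minimum)
    show "(real k)\<^sup>2 * pi\<^sup>2 \<in> {energy b k D | D. is_partition b k D}" using e part by force
    show "(real k)\<^sup>2 * pi\<^sup>2 \<le> x" if "x \<in> {energy b k D | D. is_partition b k D}" for x
      using that lower by blast
  qed
  with e part show ?thesis by (simp add: is_minimal_partition_def)
qed

theorem theorem1p9:
  fixes k :: nat
  assumes "k \<ge> 3" and "odd k"
  shows "transition_value k \<ge> strip_transition_value k \<and> strip_transition_value k > 1 / real k"
proof
  let ?S = "{b. 0 < b \<and> b \<le> 1 \<and> strip_infimum b > (real k)\<^sup>2 * pi\<^sup>2}"
  let ?T = "{b. 0 < b \<and> b \<le> 1 \<and> is_minimal_partition b k (strip_partition k b)}"
  obtain b where b: "1 / real k < b" "b \<in> ?S"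
    using strip_transition_witness[of k] assms by auto
  have "b \<le> strip_transition_value k"
    unfolding strip_transition_value_def using b(2) by (intro cSup_upper bdd_aboveI[of _ 1]) auto
  with b(1) show "strip_transition_value k > 1 / real k" by simp
  have "?S \<subseteq> ?T"
  proof
    fix b assume "b \<in> ?S"
    then have b: "0 < b" "b \<le> 1" "(real k)\<^sup>2 * pi\<^sup>2 < strip_infimum b" by auto
    have "pi\<^sup>2 * (real k)\<^sup>2 < pi\<^sup>2 * (1 + 1 / b\<^sup>2)"
      using b(3) strip_infimum_bounds(2)[OF b(1,2)] by (simp add: distrib_left mult.commute)
    then have "(real k)\<^sup>2 < 1 + 1 / b\<^sup>2" by (rule mult_left_less_imp_less) simp
    with b show "b \<in> ?T" using strip_partition_minimal[OF assms] by simp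
  qed
  \<comment> \<open>The real supremum is monotone only for a nonempty smaller set and a bounded
    larger one; the witness b shows that the smaller one is nonempty.\<close>
  moreover have "?S \<noteq> {}" using b(2) by blast
  moreover have "bdd_above ?T" by (rule bdd_aboveI[of _ 1]) auto
  ultimately show "transition_value k \<ge> strip_transition_value k"
    unfolding transition_value_def strip_transition_value_def by (intro cSup_subset_mono)
qed

end
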